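(* Assume: (i) for all $x,u\in\mathbb R$, the processes $b(\cdot,x,u)$ and $\sigma(\cdot,x,u)$ are adapted and belong to $L^{2a}_{\mathcal F}(0,N-1)$; (ii) $b(n,x,u),\sigma(n,x,u)$ are differentiable with respect to $(x,u)$ and there is $L>0$ such that $|\phi(n,x_1,u_1)-\phi(n,x_2,u_2)|\le L(|x_1-x_2|+|u_1-u_2|)$ for all $n\in\{0,\dots,N-1\}$, $x_1,x_2,u_1,u_2\in\mathbb R$ and $\phi=b,\sigma,b_x,\sigma_x,b_u,\sigma_u$; (iii) $l(n,x,u),\Phi(x)$ are differentiable with respect to $(x,u)$ and $|l_x(n,x,u)|+|\Phi_x(x)|\le L(1+|x|+|u|)$ for all $n\in\{0,\dots,N-1\}$, $x,u\in\mathbb R$; (iv) by convention $b(N,x,u)=\sigma(N,x,u)=l(N,x,u)=0$ for all $(x,u)$. Let $u^*\in\mathbb U$ be an optimal control, i.e. $J(u^* )=\inf_{u\in\mathbb U}J(u)$, and let $X^*$ be the corresponding state process. Let $(p,q)$ be the solution of the backward stochastic difference equation $$\begin{cases} p_n+q_n\eta_n=p_{n+1}+b_x^*(n+1)p_{n+1}+\beta(n+1,n+1)\sigma_x^*(n+1)q_{n+1}\\ \qquad\qquad\quad+\,l_x^*(n+1)+\sigma_x^*(n+1)p_{n+1}\xi^H_{n+1},\qquad 0\le n\le N-1,\\ p_N=\Phi_x(X_N^* ),\\ q_N=0.\end{cases}$$ Then for all $n\in\{0,\dots,N-1\}$ and all $u\in\mathbb U$, almost surely, $$\Big[b_u^*(n)p_n+\sigma_u^*(n)p_n\sum_{k=0}^{n-1}c(n,k)\xi^H_k+\beta(n,n)\sigma_u^*(n)q_n+l_u^*(n)\Big]\cdot(u_n-u_n^*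 )\ge0,$$ where $c(n,k)=\sum_{l=0}^{n-1}\beta(n,l)\alpha(l,k)$.
   Context: Fix $H\in(0,1)$, $a>1$, $N\ge1$. All processes are scalar ($d=k=m=1$). $B^H$ is a fractional Brownian motion with Hurst parameter $H$ (continuous centered Gaussian, $\mathbb E[B^H(t)B^H(s)]=\frac12(t^{2H}+s^{2H}-|t-s|^{2H})$) on $(\Omega,\mathcal F,P)$; $\xi^H_n=B^H(n+1)-B^H(n)$, $n\ge0$; $\mathcal F_0\subset\mathcal F$ is a sub-$\sigma$-algebra independent of $(\xi^H_n)_n$, and $\mathcal F_n=\mathcal F_0\vee\sigma(\xi^H_0,\dots,\xi^H_{n-1})$. $L^\beta(\mathcal F_n)$ is the set of $\mathcal F_n$-measurable random variables with finite $\beta$-th absolute moment; $L^\beta_{\mathcal F}(n_1,n_2)$ is the set of processes $(X_n)_{n_1\le n\le n_2}$, $X_n$ being $\mathcal F_n$-measurable, with $\sum_{n=n_1}^{n_2}\mathbb E|X_n|^\beta<\infty$. White noise. Let $\rho(n,k)=\mathbb E[\xi^H_n\xi^H_k]=\frac12(|n-k+1|^{2H}+|n-k-1|^{2H}-2|n-k|^{2H})$. Let $\beta(n,k)$, $n,k\ge0$, be the lower triangular array ($\beta(n,k)=0$ for $k>n$) with positive diagonal determined by $\beta(n,k)=\big(\rho(n,k)-\sum_{j=0}^{k-1}\beta(n,j)\beta(k,j)\big)/\beta(k,k)$ for $k\le n$ (for $k=n$: $\beta(n,n)^2=\rho(n,n)-\sum_{j<n}\beta(n,j)^2$), and let $\alpha(n,k)$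 be its (lower triangular) inverse. Put $\eta_n=\sum_{k=0}^n\alpha(n,k)\xi^H_k$, so $\xi^H_n=\sum_{k=0}^n\beta(n,k)\eta_k$. Control problem. The state equation is $$X_{n+1}=X_n+b(n,X_n,u_n)+\sigma(n,X_n,u_n)\xi^H_n,\quad 0\le n\le N-1,\qquad X_0=x,$$ with $x\in L^{2a}(\mathcal F_0)$ independent of $(\xi^H_n)$, and the cost is $J(u)=\mathbb E\big[\sum_{n=0}^{N-1}l(n,X_n,u_n)+\Phi(X_N)\big]$. Here $b,\sigma,l$ are real-valued measurable functions of $(n,x,u)\in\{0,\dots,N-1\}\times\mathbb R\times\mathbb R$ ($b,\sigma$ possibly random and adapted), and $\Phi:\mathbb R\to\mathbb R$ is measurable. $\mathbb U$ is the set of progressively measurable (i.e. adapted) processes $u=(u_n)_{0\le n\le N-1}$ with values in a given closed convex set $\mathbf U\subset\mathbb R$ and $\mathbb E\sum_{n=0}^{N-1}|u_n|^{2a}<\infty$. Notation: $\phi^*(n)=\phi(n,X^*_n,u^*_n)$ for $\phi=b_x,\sigma_x,l_x,b_u,\sigma_u,l_u$, subscripts denoting partial derivatives; $b_x^*(N)=\sigma_x^*(N)=l_x^*(N)=0$ by the convention (iv). A solution $(p,q)$ of the backward equation is a pair of adapted square-integrable processes satisfying it almost surely. *)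

theory Defs
  imports "HOL-Probability.Probability"
begin

section \<open>Fractional Brownian motion and its increments\<close>

text \<open>Constants count as (degenerate) Gaussian random variables.\<close>

definition gaussian_rv :: "'w measure \<Rightarrow> ('w \<Rightarrow> real) \<Rightarrow> bool" where
  "gaussian_rv M X \<longleftrightarrow> X \<in> borel_measurable M \<and>
     ((\<exists>\<mu>. AE \<omega> in M. X \<omega> = \<mu>) \<or>
      (\<exists>\<mu> s. s > 0 \<and> distributed M lborel X (\<lambda>y. ennreal (normal_density \<mu> s y))))"

definition gaussian_process :: "'w measure \<Rightarrow> 't set \<Rightarrow> ('t \<Rightarrow> 'w \<Rightarrow> real) \<Rightarrow> bool" where
  "gaussian_process M T B \<longleftrightarrow>
     (\<forall>S c. finite S \<and> S \<subseteq> T \<longrightarrow> gaussian_rv M (\<lambda>\<omega>. \<Sum>t\<in>S. c t * B t \<omega>))"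

definition fractional_brownian_motion ::
  "'w measure \<Rightarrow> real \<Rightarrow> (real \<Rightarrow> 'w \<Rightarrow> real) \<Rightarrow> bool" where
  "fractional_brownian_motion M H B \<longleftrightarrow>
     gaussian_process M {0..} B \<and>
     (\<forall>t\<ge>0. (LINT \<omega>|M. B t \<omega>) = 0) \<and>
     (\<forall>t\<ge>0. \<forall>s\<ge>0. (LINT \<omega>|M. B t \<omega> * B s \<omega>) =
        (t powr (2*H) + s powr (2*H) - \<bar>t - s\<bar> powr (2*H)) / 2) \<and>
     (AE \<omega> in M. continuous_on {0..} (\<lambda>t. B t \<omega>))"

definition fbm_increment :: "(real \<Rightarrow> 'w \<Rightarrow> real) \<Rightarrow> nat \<Rightarrow> 'w \<Rightarrow> real" where
  "fbm_increment B n \<omega> = B (real n + 1) \<omega> - B (real n) \<omega>"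

definition noise_cov :: "real \<Rightarrow> nat \<Rightarrow> nat \<Rightarrow> real" where
  "noise_cov H n k =
     (\<bar>real n - real k + 1\<bar> powr (2*H) + \<bar>real n - real k - 1\<bar> powr (2*H)
       - 2 * \<bar>real n - real k\<bar> powr (2*H)) / 2"

text \<open>
  The array \<open>\<beta>\<close> is the Cholesky factor of the covariance array \<open>\<rho>\<close>: on and below the
  diagonal these conditions fix its entries row by row.
\<close>

definition cholesky_array :: "(nat \<Rightarrow> nat \<Rightarrow> real) \<Rightarrow> (nat \<Rightarrow> nat \<Rightarrow> real) \<Rightarrow> bool" where
  "cholesky_array \<rho> \<beta> \<longleftrightarrow>
     (\<forall>n k. n < k \<longrightarrow> \<beta> n k = 0) \<and>
     (\<forall>n. \<beta> n n > 0) \<and>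
     (\<forall>n k. k \<le> n \<longrightarrow> \<beta> n k = (\<rho> n k - (\<Sum>j<k. \<beta> n j * \<beta> k j)) / \<beta> k k)"

text \<open>
  For lower triangular arrays the matrix products of the infinite arrays reduce to the
  finite sums below.
\<close>

definition lower_triangular_inverse ::
  "(nat \<Rightarrow> nat \<Rightarrow> real) \<Rightarrow> (nat \<Rightarrow> nat \<Rightarrow> real) \<Rightarrow> bool" where
  "lower_triangular_inverse \<beta> \<alpha> \<longleftrightarrow>
     (\<forall>n k. n < k \<longrightarrow> \<alpha> n k = 0) \<and>
     (\<forall>n k. (\<Sum>j\<le>n. \<alpha> n j * \<beta> j k) = (if n = k then 1 else 0)) \<and>
     (\<forall>n k. (\<Sum>j\<le>n. \<beta> n j * \<alpha> j k) = (if n = k then 1 else 0))"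

section \<open>Filtration and spaces of processes\<close>

definition rv_sigma :: "'w measure \<Rightarrow> ('w \<Rightarrow> real) \<Rightarrow> 'w set set" where
  "rv_sigma M X = sets (vimage_algebra (space M) X borel)"

definition process_sigma :: "'w measure \<Rightarrow> (nat \<Rightarrow> 'w \<Rightarrow> real) \<Rightarrow> 'w set set" where
  "process_sigma M \<xi> = sigma_sets (space M) (\<Union>k. rv_sigma M (\<xi> k))"

definition noise_filtration ::
  "'w measure \<Rightarrow> 'w measure \<Rightarrow> (nat \<Rightarrow> 'w \<Rightarrow> real) \<Rightarrow> nat \<Rightarrow> 'w measure" where
  "noise_filtration M F0 \<xi> n = sigma (space M) (sets F0 \<union> (\<Union>k<n. rv_sigma M (\<xi> k)))"

definition in_Lp :: "'w measure \<Rightarrow> 'w measure \<Rightarrow> real \<Rightarrow> ('w \<Rightarrow> real) \<Rightarrow> bool" where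
  "in_Lp M G r X \<longleftrightarrow>
     X \<in> borel_measurable G \<and> (\<integral>\<^sup>+\<omega>. ennreal (\<bar>X \<omega>\<bar> powr r) \<partial>M) < \<infinity>"

definition in_Lp_process ::
  "'w measure \<Rightarrow> (nat \<Rightarrow> 'w measure) \<Rightarrow> real \<Rightarrow> nat \<Rightarrow> nat \<Rightarrow> (nat \<Rightarrow> 'w \<Rightarrow> real) \<Rightarrow> bool" where
  "in_Lp_process M F r n1 n2 X \<longleftrightarrow>
     (\<forall>n\<in>{n1..n2}. X n \<in> borel_measurable (F n)) \<and>
     (\<Sum>n=n1..n2. \<integral>\<^sup>+\<omega>. ennreal (\<bar>X n \<omega>\<bar> powr r) \<partial>M) < \<infinity>"

section \<open>The control problem\<close>

definition partial_x :: "(real \<Rightarrow> real \<Rightarrow> real) \<Rightarrow> real \<Rightarrow> real \<Rightarrow> real" where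
  "partial_x f x u = deriv (\<lambda>y. f y u) x"

definition partial_u :: "(real \<Rightarrow> real \<Rightarrow> real) \<Rightarrow> real \<Rightarrow> real \<Rightarrow> real" where
  "partial_u f x u = deriv (\<lambda>v. f x v) u"

definition lipschitz_xu :: "real \<Rightarrow> (real \<Rightarrow> real \<Rightarrow> real) \<Rightarrow> bool" where
  "lipschitz_xu L f \<longleftrightarrow>
     (\<forall>x1 x2 u1 u2. \<bar>f x1 u1 - f x2 u2\<bar> \<le> L * (\<bar>x1 - x2\<bar> + \<bar>u1 - u2\<bar>))"

definition differentiable_xu :: "(real \<Rightarrow> real \<Rightarrow> real) \<Rightarrow> bool" where
  "differentiable_xu f \<longleftrightarrow> (\<forall>z. (\<lambda>(x, u). f x u) differentiable (at z))"

primrec state ::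
  "(nat \<Rightarrow> 'w \<Rightarrow> real \<Rightarrow> real \<Rightarrow> real) \<Rightarrow> (nat \<Rightarrow> 'w \<Rightarrow> real \<Rightarrow> real \<Rightarrow> real) \<Rightarrow>
   (nat \<Rightarrow> 'w \<Rightarrow> real) \<Rightarrow> ('w \<Rightarrow> real) \<Rightarrow> (nat \<Rightarrow> 'w \<Rightarrow> real) \<Rightarrow> nat \<Rightarrow> 'w \<Rightarrow> real" where
  "state b \<sigma> \<xi> x u 0 = x"
| "state b \<sigma> \<xi> x u (Suc n) = (\<lambda>\<omega>. state b \<sigma> \<xi> x u n \<omega>
     + b n \<omega> (state b \<sigma> \<xi> x u n \<omega>) (u n \<omega>)
     + \<sigma> n \<omega> (state b \<sigma> \<xi> x u n \<omega>) (u n \<omega>) * \<xi> n \<omega>)"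

definition admissible ::
  "'w measure \<Rightarrow> (nat \<Rightarrow> 'w measure) \<Rightarrow> real \<Rightarrow> nat \<Rightarrow> real set \<Rightarrow> (nat \<Rightarrow> 'w \<Rightarrow> real) set" where
  "admissible M F a N U =
     {u. (\<forall>n<N. u n \<in> borel_measurable (F n)) \<and>
         (\<forall>n<N. \<forall>\<omega>\<in>space M. u n \<omega> \<in> U) \<and>
         (\<integral>\<^sup>+\<omega>. (\<Sum>n<N. ennreal (\<bar>u n \<omega>\<bar> powr (2*a))) \<partial>M) < \<infinity>}"

text \<open>
  The growth of \<open>l\<close> in the control is not restricted, so the cost of an admissible control
  need not be integrable.  The Bochner integral would then silently return \<open>0\<close>; instead the
  expectation is taken in the extended reals, where \<open>\<infinity> - \<infinity> = \<infinity>\<close>, so that a control whose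
  cost has no expectation is never preferred.
\<close>

definition ext_expectation :: "'w measure \<Rightarrow> ('w \<Rightarrow> real) \<Rightarrow> ereal" where
  "ext_expectation M Y =
     enn2ereal (\<integral>\<^sup>+\<omega>. ennreal (Y \<omega>) \<partial>M) - enn2ereal (\<integral>\<^sup>+\<omega>. ennreal (- Y \<omega>) \<partial>M)"

definition cost ::
  "'w measure \<Rightarrow> (nat \<Rightarrow> real \<Rightarrow> real \<Rightarrow> real) \<Rightarrow> (real \<Rightarrow> real) \<Rightarrow> nat \<Rightarrow>
   (nat \<Rightarrow> 'w \<Rightarrow> real) \<Rightarrow> (nat \<Rightarrow> 'w \<Rightarrow> real) \<Rightarrow> ereal" where
  "cost M l \<Phi> N X u =
     ext_expectation M (\<lambda>\<omega>. (\<Sum>n<N. l n (X n \<omega>) (u n \<omega>)) + \<Phi> (X N \<omega>))"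

text \<open>
  Optimality includes that the optimal value is a real number: if every cost were
  \<open>\<infinity>\<close>, every control would attain the infimum.
\<close>

definition optimal_control ::
  "(nat \<Rightarrow> 'w \<Rightarrow> real) set \<Rightarrow> ((nat \<Rightarrow> 'w \<Rightarrow> real) \<Rightarrow> ereal) \<Rightarrow> (nat \<Rightarrow> 'w \<Rightarrow> real) \<Rightarrow> bool" where
  "optimal_control A J u \<longleftrightarrow> u \<in> A \<and> \<bar>J u\<bar> \<noteq> \<infinity> \<and> J u = (INF v\<in>A. J v)"

section \<open>The adjoint backward equation\<close>

definition bsde_solution ::
  "'w measure \<Rightarrow> (nat \<Rightarrow> 'w measure) \<Rightarrow> nat \<Rightarrow> (nat \<Rightarrow> nat \<Rightarrow> real) \<Rightarrow>
   (nat \<Rightarrow> 'w \<Rightarrow> real) \<Rightarrow> (nat \<Rightarrow> 'w \<Rightarrow> real) \<Rightarrow>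
   (nat \<Rightarrow> 'w \<Rightarrow> real) \<Rightarrow> (nat \<Rightarrow> 'w \<Rightarrow> real) \<Rightarrow> (nat \<Rightarrow> 'w \<Rightarrow> real) \<Rightarrow> ('w \<Rightarrow> real) \<Rightarrow>
   (nat \<Rightarrow> 'w \<Rightarrow> real) \<Rightarrow> (nat \<Rightarrow> 'w \<Rightarrow> real) \<Rightarrow> bool" where
  "bsde_solution M F N \<beta> \<xi> \<eta> bx sx lx \<Phi>x p q \<longleftrightarrow>
     in_Lp_process M F 2 0 N p \<and> in_Lp_process M F 2 0 N q \<and>
     (\<forall>n<N. AE \<omega> in M.
        p n \<omega> + q n \<omega> * \<eta> n \<omega> =
          p (n+1) \<omega> + bx (n+1) \<omega> * p (n+1) \<omega>
          + \<beta> (n+1) (n+1) * sx (n+1) \<omega> * q (n+1) \<omega>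
          + lx (n+1) \<omega> + sx (n+1) \<omega> * p (n+1) \<omega> * \<xi> (n+1) \<omega>) \<and>
     (AE \<omega> in M. p N \<omega> = \<Phi>x \<omega>) \<and>
     (AE \<omega> in M. q N \<omega> = 0)"

end

theory Submission
  imports Defs
begin

text \<open>
  The proof is by convex variation.  The increments of the noise are correlated, so the martingale
  arguments behind the duality with the backward equation run through their innovations.

  \<^bold>\<open>Noise.\<close> The Cholesky factor turns the increments into a sequence \<open>\<eta>\<close> of innovations:
  \<open>\<xi>\<^sub>n = \<kappa>\<^sub>n + \<beta>(n,n) \<eta>\<^sub>n\<close>, where \<open>\<kappa>\<^sub>n = \<Sum>k<n. c(n,k) \<xi>\<^sub>k\<close> is known at time \<open>n\<close> and \<open>\<eta>\<^sub>n\<close> is standard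
  and uncorrelated with \<open>\<xi>\<^sub>0, \<dots>, \<xi>\<^sub>n\<^sub>-\<^sub>1\<close>.  By joint Gaussianity, characteristic functions factorise, so
  \<open>\<eta>\<^sub>n\<close> is independent of the whole past (\<open>indep_var_of_characters\<close>,
  \<open>fbm_innovation_noise\<close>).  For a variable \<open>Y\<close> known at time \<open>n\<close> this gives
  \<open>E[Y \<eta>\<^sub>n] = 0\<close>, \<open>E[Y \<xi>\<^sub>n] = E[Y \<kappa>\<^sub>n]\<close> and \<open>E[Y \<xi>\<^sub>n \<eta>\<^sub>n] = \<beta>(n,n) E[Y]\<close>
  (\<open>innovation_orthogonal\<close>).

  \<^bold>\<open>Variation.\<close> Perturb the optimal control in a bounded adapted direction \<open>h\<close>.  The state moves by at
  most \<open>\<epsilon>\<close> times a polynomial in the noise (\<open>perturbed_gap\<close>) and is differentiable in \<open>\<epsilon>\<close> at \<open>0\<close>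
  with derivative \<open>Z\<close> solving the linearised equation.  Dominated convergence differentiates the
  cost: its derivative is \<open>E[\<Sum>k<N. (l\<^sub>x Z\<^sub>k + l\<^sub>u h\<^sub>k) + \<Phi>\<^sub>x Z\<^sub>N]\<close> (\<open>first_variation\<close>).

  \<^bold>\<open>Duality.\<close> Multiplying the backward equation by \<open>Z\<close> and telescoping with the three identities above
  replaces every \<open>Z\<close> by \<open>p\<close> and \<open>q\<close>: the derivative is \<open>\<Sum>k<N. E[h\<^sub>k G\<^sub>k]\<close>, where \<open>G\<^sub>k\<close> is the bracket of the
  theorem (\<open>duality\<close>).

  \<^bold>\<open>Localisation.\<close> The running cost may grow arbitrarily in the control, so a general direction \<open>u - u\<^sup>*\<close>
  need not give an integrable cost.  Instead \<open>h\<close> is \<open>u\<^sub>n - u\<^sup>*\<^sub>n\<close> at the single time \<open>n\<close>, cut off to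
  the event that \<open>G\<^sub>n (u\<^sub>n - u\<^sup>*\<^sub>n) < 0\<close> and that \<open>u\<^sub>n - u\<^sup>*\<^sub>n\<close> and the difference quotients of \<open>l\<close> along it are
  bounded by \<open>K\<close>.  Optimality forces the integral of a negative function over this event to be
  nonnegative, so the event is null; differentiability of \<open>l\<close> makes the events exhaust
  \<open>{G\<^sub>n (u\<^sub>n - u\<^sup>*\<^sub>n) < 0}\<close> as \<open>K\<close> grows (\<open>maximum_principle\<close>).
\<close>

section \<open>Moments\<close>

definition all_moments :: "'w measure \<Rightarrow> ('w \<Rightarrow> real) \<Rightarrow> bool" where
  "all_moments M f \<longleftrightarrow> f \<in> borel_measurable M \<and> (\<forall>r::nat. integrable M (\<lambda>\<omega>. \<bar>f \<omega>\<bar> ^ r))"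

text \<open>
  The state is bounded by an \<open>L\<^sup>r\<close> variable, built from the data and the control, times a
  polynomial in the noise.  Recording this product form gives a class that is stable under further
  multiplication by the noise, unlike \<open>L\<^sup>r\<close> itself, and still lies in \<open>L\<^sup>s\<close> for every \<open>s < r\<close>.
\<close>

definition almost_Lp :: "'w measure \<Rightarrow> real \<Rightarrow> ('w \<Rightarrow> real) \<Rightarrow> bool" where
  "almost_Lp M r f \<longleftrightarrow> f \<in> borel_measurable M \<and>
     (\<exists>S Q. S \<in> borel_measurable M \<and> integrable M (\<lambda>\<omega>. \<bar>S \<omega>\<bar> powr r) \<and> all_moments M Q \<and>
        (\<forall>\<omega>\<in>space M. \<bar>f \<omega>\<bar> \<le> \<bar>S \<omega>\<bar> * \<bar>Q \<omega>\<bar>))"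

lemma all_moments_measurable [measurable_dest]: "all_moments M f \<Longrightarrow> f \<in> borel_measurable M"
  by (simp add: all_moments_def)

lemma almost_Lp_measurable [measurable_dest]: "almost_Lp M r f \<Longrightarrow> f \<in> borel_measurable M"
  by (simp add: almost_Lp_def)

lemma all_moments_bound:
  assumes "all_moments M g" "f \<in> borel_measurable M"
    and "\<And>\<omega>. \<omega> \<in> space M \<Longrightarrow> \<bar>f \<omega>\<bar> \<le> \<bar>g \<omega>\<bar>"
  shows "all_moments M f"
  unfolding all_moments_def
proof (intro conjI allI)
  fix r :: nat
  have "integrable M (\<lambda>\<omega>. \<bar>g \<omega>\<bar> ^ r)" using assms(1) by (simp add: all_moments_def)
  then show "integrable M (\<lambda>\<omega>. \<bar>f \<omega>\<bar> ^ r)"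
    by (rule Bochner_Integration.integrable_bound) (use assms in \<open>auto intro!: AE_I2 power_mono\<close>)
qed fact

lemma all_moments_integrable: "all_moments M f \<Longrightarrow> integrable M f"
  unfolding all_moments_def
  by (erule conjE, drule spec[of _ 1]) (simp add: integrable_abs_iff)

lemma (in finite_measure) all_moments_const [intro, simp]: "all_moments M (\<lambda>\<omega>. c)"
  by (simp add: all_moments_def)

lemma all_moments_abs [intro]: "all_moments M f \<Longrightarrow> all_moments M (\<lambda>\<omega>. \<bar>f \<omega>\<bar>)"
  using borel_measurable_abs[OF all_moments_measurable] by (auto intro: all_moments_bound)

lemma all_moments_add [intro]:
  assumes f: "all_moments M f" and g: "all_moments M g"
  shows "all_moments M (\<lambda>\<omega>. f \<omega> + g \<omega>)"
  unfolding all_moments_def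
proof (intro conjI allI)
  note [measurable] = f g
  show "(\<lambda>\<omega>. f \<omega> + g \<omega>) \<in> borel_measurable M" by measurable
  fix r :: nat
  have "integrable M (\<lambda>\<omega>. 2 ^ r * (\<bar>f \<omega>\<bar> ^ r + \<bar>g \<omega>\<bar> ^ r))"
    using f g by (simp add: all_moments_def)
  then show "integrable M (\<lambda>\<omega>. \<bar>f \<omega> + g \<omega>\<bar> ^ r)"
  proof (rule Bochner_Integration.integrable_bound)
    have "\<bar>x + y\<bar> ^ r \<le> 2 ^ r * (\<bar>x\<bar> ^ r + \<bar>y\<bar> ^ r)" for x y :: real
    proof -
      have "\<bar>x + y\<bar> ^ r \<le> (2 * max \<bar>x\<bar> \<bar>y\<bar>) ^ r" by (intro power_mono) auto
      also have "\<dots> \<le> 2 ^ r * (\<bar>x\<bar> ^ r + \<bar>y\<bar> ^ r)"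
        by (auto simp: power_mult_distrib max_def)
      finally show ?thesis .
    qed
    then show "AE \<omega> in M. norm (\<bar>f \<omega> + g \<omega>\<bar> ^ r) \<le> norm (2 ^ r * (\<bar>f \<omega>\<bar> ^ r + \<bar>g \<omega>\<bar> ^ r))"
      by (intro AE_I2) (simp add: order_trans[OF _ abs_ge_self])
  qed measurable
qed

lemma all_moments_mult [intro]:
  assumes f: "all_moments M f" and g: "all_moments M g"
  shows "all_moments M (\<lambda>\<omega>. f \<omega> * g \<omega>)"
  unfolding all_moments_def
proof (intro conjI allI)
  note [measurable] = f g
  show "(\<lambda>\<omega>. f \<omega> * g \<omega>) \<in> borel_measurable M" by measurable
  fix r :: nat
  have "integrable M (\<lambda>\<omega>. \<bar>f \<omega>\<bar> ^ (r * 2) + \<bar>g \<omega>\<bar> ^ (r * 2))"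
    using f g unfolding all_moments_def by (intro Bochner_Integration.integrable_add) blast+
  then show "integrable M (\<lambda>\<omega>. \<bar>f \<omega> * g \<omega>\<bar> ^ r)"
  proof (rule Bochner_Integration.integrable_bound)
    have "x * y \<le> x\<^sup>2 + y\<^sup>2" for x y :: real
      using sum_squares_bound[of x y] zero_le_power2[of x] zero_le_power2[of y]
      by (cases "x * y \<ge> 0") (linarith)+
    from this[of "\<bar>f \<omega>\<bar> ^ r" "\<bar>g \<omega>\<bar> ^ r" for \<omega>]
    show "AE \<omega> in M. norm (\<bar>f \<omega> * g \<omega>\<bar> ^ r) \<le> norm (\<bar>f \<omega>\<bar> ^ (r * 2) + \<bar>g \<omega>\<bar> ^ (r * 2))"
      by (intro AE_I2) (simp add: abs_mult power_mult_distrib power_mult)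
  qed measurable
qed

lemma (in finite_measure) all_moments_diff [intro]:
  assumes "all_moments M f" "all_moments M g"
  shows "all_moments M (\<lambda>\<omega>. f \<omega> - g \<omega>)"
  using all_moments_add[OF assms(1) all_moments_mult[OF all_moments_const[of "-1"] assms(2)]]
  by simp

lemma (in finite_measure) all_moments_sum [intro]:
  "(\<And>i. i \<in> I \<Longrightarrow> all_moments M (f i)) \<Longrightarrow> all_moments M (\<lambda>\<omega>. \<Sum>i\<in>I. f i \<omega>)"
  by (induction I rule: infinite_finite_induct) auto

lemma (in finite_measure) bounded_all_moments:
  assumes "f \<in> borel_measurable M" "\<And>\<omega>. \<omega> \<in> space M \<Longrightarrow> \<bar>f \<omega>\<bar> \<le> K"
  shows "all_moments M f"
  by (rule all_moments_bound[OF all_moments_const[of K]]) (use assms in force)+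

lemma powr_add_le:
  fixes x y r :: real
  assumes "x \<ge> 0" "y \<ge> 0" "r > 0"
  shows "(x + y) powr r \<le> 2 powr r * (x powr r + y powr r)"
proof -
  have "(x + y) powr r \<le> (2 * max x y) powr r" using assms by (intro powr_mono2) auto
  also have "\<dots> \<le> 2 powr r * (x powr r + y powr r)"
    using assms by (auto simp: powr_mult max_def)
  finally show ?thesis .
qed

text \<open>
  The pointwise inequality behind Hoelder's: the threshold \<open>y = x\<^bsup>(r - s)/s\<^esup>\<close> is where
  \<open>(x y)\<^sup>s = x\<^sup>r\<close>.  Above it, \<open>x\<close> is at most a power of \<open>y\<close>; the summand \<open>1\<close> pays for rounding the
  resulting exponent of \<open>y\<close> up to an integer.
\<close>

lemma young_powr:
  fixes x y r s :: real
  assumes "x \<ge> 0" "y \<ge> 0" "0 < s" "s < r" and m: "real m \<ge> s * s / (r - s) + s"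
  shows "(x * y) powr s \<le> x powr r + y ^ m + 1"
proof (cases "y \<le> x powr ((r - s) / s)")
  case True
  then have "(x * y) powr s \<le> (x * x powr ((r - s) / s)) powr s"
    using assms by (intro powr_mono2 mult_left_mono) auto
  also have "\<dots> = x powr r"
    using assms by (simp add: powr_mult powr_powr powr_add[symmetric])
  finally show ?thesis using assms(2) by (simp add: add_increasing2)
next
  case False
  then have y: "y > 0" using assms by (meson le_less_trans not_le powr_ge_zero)
  have "x \<le> y powr (s / (r - s))"
  proof (cases "x = 0")
    case False
    then have "x = (x powr ((r - s) / s)) powr (s / (r - s))"
      using assms by (simp add: powr_powr)
    also have "\<dots> \<le> y powr (s / (r - s))"
      using \<open>\<not> y \<le> _\<close> assms by (intro powr_mono2) auto
    finally show ?thesis .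
  qed simp
  then have "(x * y) powr s \<le> (y powr (s / (r - s)) * y) powr s"
    using assms by (intro powr_mono2 mult_right_mono) auto
  also have "\<dots> = y powr (s * s / (r - s) + s)"
    using y by (simp add: powr_mult powr_powr powr_add[symmetric])
  also have "\<dots> \<le> y ^ m + 1"
  proof (cases "y \<le> 1")
    case True
    then have "y powr (s * s / (r - s) + s) \<le> 1"
      using y assms by (intro powr_le1) (auto intro!: add_nonneg_nonneg divide_nonneg_nonneg)
    then show ?thesis using y by (simp add: add_increasing)
  next
    case False
    then have "y powr (s * s / (r - s) + s) \<le> y powr real m"
      using m by (intro powr_mono) auto
    then show ?thesis using y by (simp add: powr_realpow)
  qed
  finally show ?thesis using powr_ge_zero[of x r] by linarith
qed

lemma (in finite_measure) almost_Lp_integrable_powr: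
  assumes f: "almost_Lp M r f" and s: "0 < s" "s < r"
  shows "integrable M (\<lambda>\<omega>. \<bar>f \<omega>\<bar> powr s)"
proof -
  from f obtain S Q where [measurable]: "f \<in> borel_measurable M" "S \<in> borel_measurable M"
    and S: "integrable M (\<lambda>\<omega>. \<bar>S \<omega>\<bar> powr r)" and Q: "all_moments M Q"
    and le: "\<And>\<omega>. \<omega> \<in> space M \<Longrightarrow> \<bar>f \<omega>\<bar> \<le> \<bar>S \<omega>\<bar> * \<bar>Q \<omega>\<bar>"
    unfolding almost_Lp_def by blast
  obtain m :: nat where m: "real m \<ge> s * s / (r - s) + s" using real_arch_simple by blast
  have "integrable M (\<lambda>\<omega>. \<bar>S \<omega>\<bar> powr r + \<bar>Q \<omega>\<bar> ^ m + 1)"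
    using S Q by (auto simp: all_moments_def)
  then show ?thesis
  proof (rule Bochner_Integration.integrable_bound)
    show "AE \<omega> in M. norm (\<bar>f \<omega>\<bar> powr s) \<le> norm (\<bar>S \<omega>\<bar> powr r + \<bar>Q \<omega>\<bar> ^ m + 1)"
    proof (rule AE_I2)
      fix \<omega> assume "\<omega> \<in> space M"
      then have "\<bar>f \<omega>\<bar> powr s \<le> (\<bar>S \<omega>\<bar> * \<bar>Q \<omega>\<bar>) powr s"
        using s le by (intro powr_mono2) auto
      also have "\<dots> \<le> \<bar>S \<omega>\<bar> powr r + \<bar>Q \<omega>\<bar> ^ m + 1"
        by (rule young_powr) (use s m in auto)
      finally show "norm (\<bar>f \<omega>\<bar> powr s) \<le> norm (\<bar>S \<omega>\<bar> powr r + \<bar>Q \<omega>\<bar> ^ m + 1)" by simp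
    qed
  qed measurable
qed

lemma (in finite_measure) almost_Lp_integrable:
  assumes "almost_Lp M r f" "1 < r" shows "integrable M f"
proof -
  have [measurable]: "f \<in> borel_measurable M" using assms by measurable
  have "integrable M (\<lambda>\<omega>. \<bar>f \<omega>\<bar>)" using almost_Lp_integrable_powr[OF assms(1), of 1] assms(2) by simp
  then show ?thesis by (simp add: integrable_abs_iff)
qed

lemma almost_Lp_bound:
  assumes "almost_Lp M r g" "f \<in> borel_measurable M"
    and "\<And>\<omega>. \<omega> \<in> space M \<Longrightarrow> \<bar>f \<omega>\<bar> \<le> \<bar>g \<omega>\<bar>"
  shows "almost_Lp M r f"
  using assms unfolding almost_Lp_def by (meson order_trans)

lemma (in finite_measure) Lp_almost_Lp:
  assumes "f \<in> borel_measurable M" "integrable M (\<lambda>\<omega>. \<bar>f \<omega>\<bar> powr r)"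
  shows "almost_Lp M r f"
  unfolding almost_Lp_def
  by (intro conjI assms(1) exI[of _ f] exI[of _ "\<lambda>_. 1"]) (use assms in auto)

lemma (in finite_measure) all_moments_almost_Lp:
  assumes "all_moments M f"
  shows "almost_Lp M r f"
  unfolding almost_Lp_def
  by (intro conjI all_moments_measurable[OF assms] exI[of _ f] exI[of _ "\<lambda>_. 1"]) (use assms in auto)

lemma almost_Lp_mult_all_moments [intro]:
  assumes "almost_Lp M r f" and g: "all_moments M g"
  shows "almost_Lp M r (\<lambda>\<omega>. f \<omega> * g \<omega>)"
proof -
  from assms(1) obtain S Q where [measurable]: "f \<in> borel_measurable M" "S \<in> borel_measurable M"
    and S: "integrable M (\<lambda>\<omega>. \<bar>S \<omega>\<bar> powr r)" and Q: "all_moments M Q"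
    and le: "\<And>\<omega>. \<omega> \<in> space M \<Longrightarrow> \<bar>f \<omega>\<bar> \<le> \<bar>S \<omega>\<bar> * \<bar>Q \<omega>\<bar>"
    unfolding almost_Lp_def by blast
  have [measurable]: "g \<in> borel_measurable M" using g by measurable
  show ?thesis unfolding almost_Lp_def
    by (intro conjI exI[of _ S] exI[of _ "\<lambda>\<omega>. Q \<omega> * g \<omega>"])
       (use S Q g le in \<open>auto simp: abs_mult mult.assoc[symmetric] intro!: mult_right_mono\<close>)
qed

lemma all_moments_mult_almost_Lp [intro]:
  "all_moments M g \<Longrightarrow> almost_Lp M r f \<Longrightarrow> almost_Lp M r (\<lambda>\<omega>. g \<omega> * f \<omega>)"
  by (subst mult.commute) (rule almost_Lp_mult_all_moments)

lemma almost_Lp_abs [intro]: "almost_Lp M r f \<Longrightarrow> almost_Lp M r (\<lambda>\<omega>. \<bar>f \<omega>\<bar>)"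
  using borel_measurable_abs[OF almost_Lp_measurable] by (auto intro: almost_Lp_bound)

lemma almost_Lp_add [intro]:
  assumes f: "almost_Lp M r f" and g: "almost_Lp M r g" and r: "r > 0"
  shows "almost_Lp M r (\<lambda>\<omega>. f \<omega> + g \<omega>)"
proof -
  from f obtain S Q where [measurable]: "f \<in> borel_measurable M" "S \<in> borel_measurable M"
    and S: "integrable M (\<lambda>\<omega>. \<bar>S \<omega>\<bar> powr r)" and Q: "all_moments M Q"
    and le: "\<And>\<omega>. \<omega> \<in> space M \<Longrightarrow> \<bar>f \<omega>\<bar> \<le> \<bar>S \<omega>\<bar> * \<bar>Q \<omega>\<bar>"
    unfolding almost_Lp_def by blast
  from g obtain S' Q' where [measurable]: "g \<in> borel_measurable M" "S' \<in> borel_measurable M"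
    and S': "integrable M (\<lambda>\<omega>. \<bar>S' \<omega>\<bar> powr r)" and Q': "all_moments M Q'"
    and le': "\<And>\<omega>. \<omega> \<in> space M \<Longrightarrow> \<bar>g \<omega>\<bar> \<le> \<bar>S' \<omega>\<bar> * \<bar>Q' \<omega>\<bar>"
    unfolding almost_Lp_def by blast
  have "integrable M (\<lambda>\<omega>. 2 powr r * (\<bar>S \<omega>\<bar> powr r + \<bar>S' \<omega>\<bar> powr r))"
    using S S' by auto
  then have SS: "integrable M (\<lambda>\<omega>. \<bar>\<bar>S \<omega>\<bar> + \<bar>S' \<omega>\<bar>\<bar> powr r)"
    by (rule Bochner_Integration.integrable_bound)
       (auto intro!: AE_I2 powr_add_le r order_trans[OF powr_add_le])
  show ?thesis unfolding almost_Lp_def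
  proof (intro conjI exI ballI)
    show "integrable M (\<lambda>\<omega>. \<bar>\<bar>S \<omega>\<bar> + \<bar>S' \<omega>\<bar>\<bar> powr r)" by fact
    show "all_moments M (\<lambda>\<omega>. \<bar>Q \<omega>\<bar> + \<bar>Q' \<omega>\<bar>)" using Q Q' by auto
    fix \<omega> assume \<omega>: "\<omega> \<in> space M"
    have "\<bar>f \<omega> + g \<omega>\<bar> \<le> \<bar>S \<omega>\<bar> * \<bar>Q \<omega>\<bar> + \<bar>S' \<omega>\<bar> * \<bar>Q' \<omega>\<bar>" using le[OF \<omega>] le'[OF \<omega>] by linarith
    also have "\<dots> \<le> \<bar>\<bar>S \<omega>\<bar> + \<bar>S' \<omega>\<bar>\<bar> * \<bar>\<bar>Q \<omega>\<bar> + \<bar>Q' \<omega>\<bar>\<bar>"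
      by (simp add: algebra_simps)
    finally show "\<bar>f \<omega> + g \<omega>\<bar> \<le> \<bar>\<bar>S \<omega>\<bar> + \<bar>S' \<omega>\<bar>\<bar> * \<bar>\<bar>Q \<omega>\<bar> + \<bar>Q' \<omega>\<bar>\<bar>" .
  qed measurable
qed

lemma (in finite_measure) almost_Lp_sum [intro]:
  "(\<And>i. i \<in> I \<Longrightarrow> almost_Lp M r (f i)) \<Longrightarrow> r > 0 \<Longrightarrow> almost_Lp M r (\<lambda>\<omega>. \<Sum>i\<in>I. f i \<omega>)"
  by (induction I rule: infinite_finite_induct) (auto intro: all_moments_almost_Lp[OF all_moments_const])

section \<open>Fourier uniqueness and independence\<close>

text \<open>
  Taking \<open>t = 0\<close>, the positive and the negative part of \<open>V\<close> have the same mass.  Normalised, they are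
  densities under which \<open>X\<close> has the same characteristic function, hence the same distribution by
  Levy's uniqueness theorem.
\<close>

lemma (in prob_space) Fourier_null_real:
  fixes V X :: "'a \<Rightarrow> real"
  assumes V: "integrable M V" and X [measurable]: "X \<in> borel_measurable M"
    and null: "\<And>t. (CLINT \<omega>|M. V \<omega> * iexp (t * X \<omega>)) = 0"
    and B [measurable]: "B \<in> sets borel"
  shows "(LINT \<omega>|M. V \<omega> * indicator B (X \<omega>)) = 0"
proof -
  have [measurable]: "V \<in> borel_measurable M" using V by measurable
  define m where "m = (LINT \<omega>|M. max 0 (V \<omega>))"
  have int: "integrable M (\<lambda>\<omega>. max 0 (V \<omega>))" "integrable M (\<lambda>\<omega>. max 0 (- V \<omega>))"
    using V by auto
  have split: "V \<omega> = max 0 (V \<omega>) - max 0 (- V \<omega>)" for \<omega> by (auto simp: max_def)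
  have "complex_of_real (LINT \<omega>|M. V \<omega>) = 0" using null[of 0] by simp
  then have "(LINT \<omega>|M. max 0 (V \<omega>) - max 0 (- V \<omega>)) = 0" by (simp flip: split)
  then have m': "m = (LINT \<omega>|M. max 0 (- V \<omega>))"
    using int unfolding m_def by simp
  have "m \<ge> 0" unfolding m_def by simp
  then consider "m = 0" | "m > 0" by linarith
  then show ?thesis
  proof cases
    case 1
    have "AE \<omega> in M. max 0 (V \<omega>) = 0" "AE \<omega> in M. max 0 (- V \<omega>) = 0"
      using 1 m' int unfolding m_def
      by (auto simp flip: integral_nonneg_eq_0_iff_AE)
    then have "AE \<omega> in M. V \<omega> * indicator B (X \<omega>) = 0"
      by eventually_elim (auto simp: max_def split: if_splits)
    then show ?thesis by (simp add: integral_eq_zero_AE)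
  next
    case 2
    define D where "D W = distr (density M (\<lambda>\<omega>. ennreal (W \<omega> / m))) borel X" for W :: "'a \<Rightarrow> real"
    have D: "real_distribution (D W)" 
        "char (D W) t = (CLINT \<omega>|M. W \<omega> * iexp (t * X \<omega>)) / m"
        "measure (D W) B = (LINT \<omega>|M. W \<omega> * indicator B (X \<omega>)) / m"
      if W: "integrable M W" "(LINT \<omega>|M. W \<omega>) = m" "\<And>\<omega>. W \<omega> \<ge> 0" for W t
    proof -
      have [measurable]: "W \<in> borel_measurable M" using W by measurable
      have "(\<integral>\<^sup>+ \<omega>. ennreal (W \<omega> / m) \<partial>M) = ennreal (LINT \<omega>|M. W \<omega> / m)"
        using W 2 by (intro nn_integral_eq_integral) auto
      then have "prob_space (density M (\<lambda>\<omega>. ennreal (W \<omega> / m)))"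
        using W 2 by (intro prob_spaceI) (simp add: emeasure_density cong: nn_integral_cong)
      then have ps: "prob_space (D W)" unfolding D_def
        by (rule prob_space.prob_space_distr) simp
      then show "real_distribution (D W)"
        by (auto simp: real_distribution_def real_distribution_axioms_def D_def)
      have "char (D W) t = (CLINT \<omega>|M. (W \<omega> / m) *\<^sub>R iexp (t * X \<omega>))"
        unfolding char_def D_def
        by (subst integral_distr) (auto simp: integral_density W 2 less_imp_le)
      also have "\<dots> = (CLINT \<omega>|M. W \<omega> * iexp (t * X \<omega>) / m)"
        by (simp add: scaleR_conv_of_real)
      also have "\<dots> = (CLINT \<omega>|M. W \<omega> * iexp (t * X \<omega>)) / m" by simp
      finally show "char (D W) t = (CLINT \<omega>|M. W \<omega> * iexp (t * X \<omega>)) / m" .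
      interpret D: prob_space "D W" by fact
      have "measure (D W) B = (LINT y|D W. indicator B y)"
        using B by (simp add: D_def)
      also have "\<dots> = (LINT \<omega>|M. (W \<omega> / m) *\<^sub>R indicator B (X \<omega>))"
        unfolding D_def
        by (subst integral_distr) (auto simp: integral_density W 2 less_imp_le)
      also have "\<dots> = (LINT \<omega>|M. W \<omega> * indicator B (X \<omega>)) / m" by simp
      finally show "measure (D W) B = (LINT \<omega>|M. W \<omega> * indicator B (X \<omega>)) / m" .
    qed
    have integ: "integrable M (\<lambda>\<omega>. complex_of_real (W \<omega>) * iexp (t * X \<omega>))" 
      if "integrable M W" for W :: "'a \<Rightarrow> real" and t
    proof -
      have [measurable]: "W \<in> borel_measurable M" using that by measurable
      show ?thesis
        by (rule Bochner_Integration.integrable_bound[OF that]) (auto simp: norm_mult)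
    qed
    have "(CLINT \<omega>|M. max 0 (V \<omega>) * iexp (t * X \<omega>)) = (CLINT \<omega>|M. max 0 (- V \<omega>) * iexp (t * X \<omega>))" for t
    proof -
      have "(CLINT \<omega>|M. max 0 (V \<omega>) * iexp (t * X \<omega>)) - (CLINT \<omega>|M. max 0 (- V \<omega>) * iexp (t * X \<omega>))
        = (CLINT \<omega>|M. (max 0 (V \<omega>) - max 0 (- V \<omega>)) * iexp (t * X \<omega>))"
        using integ[OF int(1), of t] integ[OF int(2), of t] by (simp add: left_diff_distrib)
      also have "\<dots> = 0" using null[of t] by (simp flip: split)
      finally show ?thesis by simp
    qed
    then have "char (D (\<lambda>\<omega>. max 0 (V \<omega>))) = char (D (\<lambda>\<omega>. max 0 (- V \<omega>)))"
      using D(2) int m' by (auto simp: m_def fun_eq_iff)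
    then have "D (\<lambda>\<omega>. max 0 (V \<omega>)) = D (\<lambda>\<omega>. max 0 (- V \<omega>))"
      using D(1) int m' by (intro Levy_uniqueness) (auto simp: m_def)
    then have "(LINT \<omega>|M. max 0 (V \<omega>) * indicator B (X \<omega>)) = (LINT \<omega>|M. max 0 (- V \<omega>) * indicator B (X \<omega>))"
      using D(3)[of "\<lambda>\<omega>. max 0 (V \<omega>)"] D(3)[of "\<lambda>\<omega>. max 0 (- V \<omega>)"] int m' 2 by (auto simp: m_def)
    moreover have "integrable M (\<lambda>\<omega>. W \<omega> * indicator B (X \<omega>))" if "integrable M W" for W :: "'a \<Rightarrow> real"
    proof -
      have [measurable]: "W \<in> borel_measurable M" using that by measurable
      show ?thesis
        by (rule Bochner_Integration.integrable_bound[OF that]) (auto simp: indicator_def)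
    qed
    ultimately have "(LINT \<omega>|M. (max 0 (V \<omega>) - max 0 (- V \<omega>)) * indicator B (X \<omega>)) = 0"
      using int by (simp add: left_diff_distrib)
    then show ?thesis by (simp flip: split)
  qed
qed

text \<open>
  Conjugating the hypothesis only replaces \<open>t\<close> by \<open>-t\<close>, so it passes from \<open>V\<close> to its conjugate and
  thus to its real and imaginary parts.
\<close>

lemma (in prob_space) Fourier_null:
  fixes V :: "'a \<Rightarrow> complex" and X :: "'a \<Rightarrow> real"
  assumes V: "integrable M V" and X [measurable]: "X \<in> borel_measurable M"
    and null: "\<And>t. (CLINT \<omega>|M. V \<omega> * iexp (t * X \<omega>)) = 0"
    and B [measurable]: "B \<in> sets borel"
  shows "(CLINT \<omega>|M. V \<omega> * indicator B (X \<omega>)) = 0"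
proof -
  have [measurable]: "V \<in> borel_measurable M" using V by measurable
  have [measurable]: "(\<lambda>\<omega>. cnj (V \<omega>)) \<in> borel_measurable M"
    by (rule borel_measurable_continuous_on[of cnj]) (auto intro!: continuous_intros)
  have i: "integrable M (\<lambda>\<omega>. V \<omega> * iexp (t * X \<omega>))" for t
    by (rule Bochner_Integration.integrable_bound[OF V]) (auto simp: norm_mult)
  have c: "(CLINT \<omega>|M. cnj (V \<omega>) * iexp (t * X \<omega>)) = 0" for t
  proof -
    have "(CLINT \<omega>|M. cnj (V \<omega>) * iexp (t * X \<omega>)) = (CLINT \<omega>|M. cnj (V \<omega> * iexp ((-t) * X \<omega>)))"
      by (simp add: exp_cnj)
    also have "\<dots> = cnj (CLINT \<omega>|M. V \<omega> * iexp ((-t) * X \<omega>))" by (rule Bochner_Integration.integral_cnj)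
    also have "\<dots> = 0" by (subst null) simp
    finally show ?thesis .
  qed
  have ic: "integrable M (\<lambda>\<omega>. cnj (V \<omega>) * iexp (t * X \<omega>))" for t
    by (rule Bochner_Integration.integrable_bound[OF V]) (auto simp: norm_mult)
  have Re: "(LINT \<omega>|M. Re (V \<omega>) * indicator B (X \<omega>)) = 0"
  proof (rule Fourier_null_real[OF _ X _ B])
    show "integrable M (\<lambda>\<omega>. Re (V \<omega>))" using V by simp
    fix t
    have "(CLINT \<omega>|M. complex_of_real (Re (V \<omega>)) * iexp (t * X \<omega>))
      = (CLINT \<omega>|M. (V \<omega> * iexp (t * X \<omega>) + cnj (V \<omega>) * iexp (t * X \<omega>)) / 2)"
      by (simp add: complex_add_cnj flip: distrib_right)
    also have "\<dots> = 0" using i[of t] ic[of t] null[of t] c[of t] by simp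
    finally show "(CLINT \<omega>|M. complex_of_real (Re (V \<omega>)) * iexp (t * X \<omega>)) = 0" .
  qed
  have Im: "(LINT \<omega>|M. Im (V \<omega>) * indicator B (X \<omega>)) = 0"
  proof (rule Fourier_null_real[OF _ X _ B])
    show "integrable M (\<lambda>\<omega>. Im (V \<omega>))" using V by simp
    fix t
    have "(CLINT \<omega>|M. complex_of_real (Im (V \<omega>)) * iexp (t * X \<omega>))
      = (CLINT \<omega>|M. (V \<omega> * iexp (t * X \<omega>) - cnj (V \<omega>) * iexp (t * X \<omega>)) / (2 * \<i>))"
      by (intro Bochner_Integration.integral_cong refl) (simp add: complex_diff_cnj mult.left_commute flip: left_diff_distrib)
    also have "\<dots> = 0" using i[of t] ic[of t] null[of t] c[of t] by simp
    finally show "(CLINT \<omega>|M. complex_of_real (Im (V \<omega>)) * iexp (t * X \<omega>)) = 0" .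
  qed
  have iB: "integrable M (\<lambda>\<omega>. V \<omega> * indicator B (X \<omega>))"
    by (rule Bochner_Integration.integrable_bound[OF V]) (auto simp: norm_mult indicator_def)
  show ?thesis
  proof (rule complex_eqI)
    have "Re (CLINT \<omega>|M. V \<omega> * indicator B (X \<omega>)) = (LINT \<omega>|M. Re (V \<omega> * indicator B (X \<omega>)))"
      by (rule Bochner_Integration.integral_Re[OF iB, symmetric])
    also have "\<dots> = (LINT \<omega>|M. Re (V \<omega>) * indicator B (X \<omega>))"
      by (intro Bochner_Integration.integral_cong) (auto simp: indicator_def)
    finally show "Re (CLINT \<omega>|M. V \<omega> * indicator B (X \<omega>)) = Re 0" using Re by simp
    have "Im (CLINT \<omega>|M. V \<omega> * indicator B (X \<omega>)) = (LINT \<omega>|M. Im (V \<omega> * indicator B (X \<omega>)))"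
      by (rule Bochner_Integration.integral_Im[OF iB, symmetric])
    also have "\<dots> = (LINT \<omega>|M. Im (V \<omega>) * indicator B (X \<omega>))"
      by (intro Bochner_Integration.integral_cong) (auto simp: indicator_def)
    finally show "Im (CLINT \<omega>|M. V \<omega> * indicator B (X \<omega>)) = Im 0" using Im by simp
  qed
qed

lemma sets_noise_filtration:
  assumes "sets F0 \<subseteq> Pow (space M)"
  shows "sets (noise_filtration M F0 \<xi> n) =
    sigma_sets (space M) (sets F0 \<union> (\<Union>k<n. {\<xi> k -` B \<inter> space M |B. B \<in> sets borel}))"
    and space_noise_filtration: "space (noise_filtration M F0 \<xi> n) = space M"
proof -
  have "rv_sigma M X = {X -` B \<inter> space M |B. B \<in> sets borel}" for X :: "'a \<Rightarrow> real"
    unfolding rv_sigma_def by (rule sets_vimage_algebra2) auto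
  moreover have "sets F0 \<union> (\<Union>k<n. {\<xi> k -` B \<inter> space M |B. B \<in> sets borel}) \<subseteq> Pow (space M)"
    using assms by auto
  ultimately show "sets (noise_filtration M F0 \<xi> n) =
      sigma_sets (space M) (sets F0 \<union> (\<Union>k<n. {\<xi> k -` B \<inter> space M |B. B \<in> sets borel}))"
    "space (noise_filtration M F0 \<xi> n) = space M"
    by (simp_all add: noise_filtration_def space_measure_of)
qed

text \<open>
  Uniqueness for one real variable suffices for the joint law with all the \<open>\<xi>\<^sub>k\<close>: the exponentials in
  \<open>\<xi>\<^sub>0, \<xi>\<^sub>1, \<dots>\<close> are traded for indicators of Borel sets one variable at a time, the remaining
  exponentials and the factor \<open>exp (i s Y) - E[exp (i s Y)]\<close> serving as the complex weight \<open>V\<close> of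
  \<open>Fourier_null\<close>.  At the end \<open>exp (i s Y)\<close> is traded in the same way.
\<close>

lemma (in prob_space) indep_var_of_characters:
  fixes \<xi> :: "nat \<Rightarrow> 'a \<Rightarrow> real" and Y Z :: "'a \<Rightarrow> real"
  assumes F0: "subalgebra M F0"
    and \<xi> [measurable]: "\<And>k. \<xi> k \<in> borel_measurable M" and Y [measurable]: "Y \<in> borel_measurable M"
    and factor: "\<And>A t s. A \<in> sets F0 \<Longrightarrow>
      (CLINT \<omega>|M. indicator A \<omega> * iexp (\<Sum>k<n. t k * \<xi> k \<omega>) * iexp (s * Y \<omega>)) =
      (CLINT \<omega>|M. indicator A \<omega> * iexp (\<Sum>k<n. t k * \<xi> k \<omega>)) * (CLINT \<omega>|M. iexp (s * Y \<omega>))"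
    and Z: "Z \<in> borel_measurable (noise_filtration M F0 \<xi> n)"
  shows "indep_var borel Z borel Y"
proof -
  have space_F0: "space F0 = space M" and sets_F0: "sets F0 \<subseteq> sets M"
    using F0 by (auto simp: subalgebra_def)
  define C where "C A B m = A \<inter> {\<omega>\<in>space M. \<forall>k<m. \<xi> k \<omega> \<in> B k}" for A B and m :: nat
  define \<phi> where "\<phi> s = (CLINT \<omega>|M. iexp (s * Y \<omega>))" for s
  have C_sets [measurable]: "C A B m \<in> sets M"
    if "A \<in> sets F0" "\<And>k. B k \<in> sets borel" for A B m
  proof -
    have "A \<in> sets M" using that sets_F0 by auto
    moreover have "{\<omega>\<in>space M. \<forall>k<m. \<xi> k \<omega> \<in> B k} \<in> sets M"
      using that(2) by measurable
    ultimately show ?thesis unfolding C_def by blast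
  qed
  \<comment> \<open>The first \<open>m\<close> exponentials have already been replaced by indicators.\<close>
  have null: "(CLINT \<omega>|M. indicator (C A B m) \<omega> * iexp (\<Sum>k\<in>{m..<n}. t k * \<xi> k \<omega>)
      * (iexp (s * Y \<omega>) - \<phi> s)) = 0"
    if A: "A \<in> sets F0" and B: "\<And>k. B k \<in> sets borel" and "m \<le> n" for A B m t s
    using \<open>m \<le> n\<close>
  proof (induction m arbitrary: t)
    case 0
    have CA: "C A B 0 = A" using sets.sets_into_space[OF A] space_F0 by (auto simp: C_def)
    have [measurable]: "A \<in> sets M" using A sets_F0 by auto
    have i: "integrable M (\<lambda>\<omega>. indicator A \<omega> * iexp (\<Sum>k<n. t k * \<xi> k \<omega>) :: complex)"
      "integrable M (\<lambda>\<omega>. indicator A \<omega> * iexp (\<Sum>k<n. t k * \<xi> k \<omega>) * iexp (s * Y \<omega>) :: complex)"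
      by (rule integrable_const_bound[where B=1]; auto simp: norm_mult indicator_def)+
    have "(CLINT \<omega>|M. indicator A \<omega> * iexp (\<Sum>k<n. t k * \<xi> k \<omega>) * (iexp (s * Y \<omega>) - \<phi> s))
      = (CLINT \<omega>|M. indicator A \<omega> * iexp (\<Sum>k<n. t k * \<xi> k \<omega>) * iexp (s * Y \<omega>))
        - (CLINT \<omega>|M. indicator A \<omega> * iexp (\<Sum>k<n. t k * \<xi> k \<omega>)) * \<phi> s"
      using i by (simp add: right_diff_distrib)
    then show ?case using factor[OF A, of t s]
      unfolding CA by (simp add: \<phi>_def atLeast0LessThan)
  next
    case (Suc m)
    let ?V = "\<lambda>\<omega>. indicator (C A B m) \<omega> * iexp (\<Sum>k\<in>{Suc m..<n}. t k * \<xi> k \<omega>) * (iexp (s * Y \<omega>) - \<phi> s)"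
    have [measurable]: "C A B m \<in> sets M" by (intro C_sets A B)
    have "(CLINT \<omega>|M. ?V \<omega> * indicator (B m) (\<xi> m \<omega>)) = 0"
    proof (rule Fourier_null[OF _ \<xi> _ B])
      show "integrable M ?V"
      proof (rule integrable_const_bound[where B="1 + norm (\<phi> s)"])
        have "norm (iexp (s * Y \<omega>) - \<phi> s) \<le> 1 + norm (\<phi> s)" for \<omega>
          using norm_triangle_ineq4[of "iexp (s * Y \<omega>)" "\<phi> s"] by simp
        then show "AE \<omega> in M. norm (?V \<omega>) \<le> 1 + norm (\<phi> s)"
          by (auto simp: norm_mult indicator_def)
      qed measurable
      fix r
      have m: "{m..<n} = insert m {Suc m..<n}" using Suc.prems by auto
      have "(\<Sum>k\<in>{m..<n}. (t(m := r)) k * \<xi> k \<omega>) = r * \<xi> m \<omega> + (\<Sum>k\<in>{Suc m..<n}. t k * \<xi> k \<omega>)" for \<omega>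
        unfolding m by (subst sum.insert) (auto intro!: sum.cong)
      then have "(CLINT \<omega>|M. ?V \<omega> * iexp (r * \<xi> m \<omega>)) = (CLINT \<omega>|M. indicator (C A B m) \<omega>
          * iexp (\<Sum>k\<in>{m..<n}. (t(m := r)) k * \<xi> k \<omega>) * (iexp (s * Y \<omega>) - \<phi> s))"
        by (simp add: exp_add distrib_left mult_ac)
      also have "\<dots> = 0" using Suc by simp
      finally show "(CLINT \<omega>|M. ?V \<omega> * iexp (r * \<xi> m \<omega>)) = 0" .
    qed
    moreover have "?V \<omega> * indicator (B m) (\<xi> m \<omega>) = indicator (C A B (Suc m)) \<omega>
        * iexp (\<Sum>k\<in>{Suc m..<n}. t k * \<xi> k \<omega>) * (iexp (s * Y \<omega>) - \<phi> s)" for \<omega>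
      by (auto simp: C_def indicator_def less_Suc_eq)
    ultimately show ?case by (simp only:)
  qed
  define Cyl where "Cyl = {C A B n | A B. A \<in> sets F0 \<and> (\<forall>k. B k \<in> sets borel)}"
  have CylI: "C A B n \<in> Cyl" if "A \<in> sets F0" "\<And>k. B k \<in> sets borel" for A B
    unfolding Cyl_def using that by blast
  have product: "prob (C A B n \<inter> (Y -` D \<inter> space M)) = prob (C A B n) * prob (Y -` D \<inter> space M)"
    if A: "A \<in> sets F0" and B: "\<And>k. B k \<in> sets borel" and D [measurable]: "D \<in> sets borel" for A B D
  proof -
    have [measurable]: "C A B n \<in> sets M" by (intro C_sets A B)
    let ?P = "prob (C A B n)"
    have i: "integrable M (\<lambda>\<omega>. indicator (C A B n) \<omega> * iexp (s * Y \<omega>) :: complex)"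
      "integrable M (\<lambda>\<omega>. iexp (s * Y \<omega>) :: complex)" for s
      by (rule integrable_const_bound[where B=1]; auto simp: norm_mult indicator_def)+
    have ii: "integrable M (\<lambda>\<omega>. indicator (C A B n) \<omega> :: complex)"
      by (rule integrable_const_bound[where B=1]; auto simp: norm_mult indicator_def)
    have "(LINT \<omega>|M. (indicator (C A B n) \<omega> - ?P) * indicator D (Y \<omega>)) = 0"
    proof (rule Fourier_null_real[OF _ Y _ D])
      show "integrable M (\<lambda>\<omega>. indicator (C A B n) \<omega> - ?P)" by (auto simp: less_top[symmetric])
      fix s
      have "(CLINT \<omega>|M. indicator (C A B n) \<omega>) = complex_of_real ?P"
        using integral_of_real[of M "indicator (C A B n)"] 
        by (simp add: of_real_indicator less_top[symmetric])
      moreover have "(CLINT \<omega>|M. indicator (C A B n) \<omega> * (iexp (s * Y \<omega>) - \<phi> s)) = 0"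
        using null[of A B n "\<lambda>_. 0" s] A B by simp
      ultimately have "(CLINT \<omega>|M. indicator (C A B n) \<omega> * iexp (s * Y \<omega>)) = ?P * \<phi> s"
        using i[of s] ii by (simp add: right_diff_distrib)
      moreover have "(CLINT \<omega>|M. complex_of_real (indicator (C A B n) \<omega> - ?P) * iexp (s * Y \<omega>))
        = (CLINT \<omega>|M. indicator (C A B n) \<omega> * iexp (s * Y \<omega>) - ?P * iexp (s * Y \<omega>))"
        by (simp add: left_diff_distrib of_real_indicator)
      moreover have "\<dots> = (CLINT \<omega>|M. indicator (C A B n) \<omega> * iexp (s * Y \<omega>)) - ?P * \<phi> s"
        using i[of s] by (simp add: \<phi>_def)
      ultimately show "(CLINT \<omega>|M. complex_of_real (indicator (C A B n) \<omega> - ?P) * iexp (s * Y \<omega>)) = 0"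
        by simp
    qed
    moreover have "(LINT \<omega>|M. (indicator (C A B n) \<omega> - ?P) * indicator D (Y \<omega>))
        = (LINT \<omega>|M. indicator (C A B n \<inter> (Y -` D \<inter> space M)) \<omega> - ?P * indicator (Y -` D \<inter> space M) \<omega>)"
      by (intro Bochner_Integration.integral_cong refl) (auto simp: indicator_def)
    ultimately have "(LINT \<omega>|M. indicator (C A B n \<inter> (Y -` D \<inter> space M)) \<omega>
        - ?P * indicator (Y -` D \<inter> space M) \<omega>) = 0"
      by (simp only:)
    then show ?thesis by (simp add: less_top[symmetric])
  qed
  have "indep_set Cyl {Y -` D \<inter> space M |D. D \<in> sets borel}"
    unfolding indep_sets2_eq using product C_sets by (auto simp: Cyl_def)
  then have indep: "indep_set (sigma_sets (space M) Cyl)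
      (sigma_sets (space M) {Y -` D \<inter> space M |D. D \<in> sets borel})"
  proof (rule indep_set_sigma_sets)
    show "Int_stable Cyl"
    proof (rule Int_stableI)
      fix a b assume "a \<in> Cyl" "b \<in> Cyl"
      then obtain A B A' B' where *: "a = C A B n" "b = C A' B' n" "A \<in> sets F0" "A' \<in> sets F0"
        "\<And>k. B k \<in> sets borel" "\<And>k. B' k \<in> sets borel"
        unfolding Cyl_def by blast
      have "a \<inter> b = C (A \<inter> A') (\<lambda>k. B k \<inter> B' k) n" using * by (auto simp: C_def)
      then show "a \<inter> b \<in> Cyl" unfolding Cyl_def using * by blast
    qed
    show "Int_stable {Y -` D \<inter> space M |D. D \<in> sets borel}"
    proof (rule Int_stableI)
      fix a b assume "a \<in> {Y -` D \<inter> space M |D. D \<in> sets borel}" "b \<in> {Y -` D \<inter> space M |D. D \<in> sets borel}"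
      then obtain D D' where "a = Y -` D \<inter> space M" "b = Y -` D' \<inter> space M" "D \<in> sets borel" "D' \<in> sets borel"
        by blast
      then have "a \<inter> b = Y -` (D \<inter> D') \<inter> space M" "D \<inter> D' \<in> sets borel" by auto
      then show "a \<inter> b \<in> {Y -` D \<inter> space M |D. D \<in> sets borel}" by blast
    qed
  qed
  have sF: "sets F0 \<subseteq> Pow (space M)" using sets.space_closed[of F0] space_F0 by simp
  have gen: "sets F0 \<union> (\<Union>k<n. {\<xi> k -` B \<inter> space M |B. B \<in> sets borel}) \<subseteq> Cyl"
  proof (intro Un_least UN_least subsetI)
    fix A assume A: "A \<in> sets F0"
    then have "A = C A (\<lambda>_. UNIV) n" using sF by (auto simp: C_def)
    moreover have "C A (\<lambda>_. UNIV) n \<in> Cyl" by (rule CylI[OF A]) simp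
    ultimately show "A \<in> Cyl" by simp
  next
    fix k E assume k: "k \<in> {..<n}" and "E \<in> {\<xi> k -` B \<inter> space M |B. B \<in> sets borel}"
    then obtain B where B: "B \<in> sets borel" and E: "E = \<xi> k -` B \<inter> space M" by blast
    let ?B = "\<lambda>j. if j = k then B else UNIV"
    have "(\<forall>j<n. \<xi> j \<omega> \<in> ?B j) \<longleftrightarrow> \<xi> k \<omega> \<in> B" for \<omega>
      using k by (metis UNIV_I lessThan_iff)
    then have "E = C (space M) ?B n" unfolding E C_def by blast
    moreover have "C (space M) ?B n \<in> Cyl"
      unfolding space_F0[symmetric] by (rule CylI) (use B in auto)
    ultimately show "E \<in> Cyl" by simp
  qed
  let ?F = "noise_filtration M F0 \<xi> n"
  have FPi: "sets ?F \<subseteq> sigma_sets (space M) Cyl"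
    unfolding sets_noise_filtration[OF sF] by (rule sigma_sets_mono') (rule gen)
  have "Cyl \<subseteq> sets M" using C_sets by (auto simp: Cyl_def)
  then have Pi_M: "sigma_sets (space M) Cyl \<subseteq> sets M" by (rule sets.sigma_sets_subset)
  have Z_sets: "Z -` D \<inter> space M \<in> sets ?F" if "D \<in> sets borel" for D
    using measurable_sets[OF Z that] by (simp add: space_noise_filtration[OF sF])
  have Z_M: "Z \<in> borel_measurable M"
    using Z_sets FPi Pi_M by (intro measurableI) auto
  have "sigma_sets (space M) {Z -` D \<inter> space M |D. D \<in> sets borel} \<subseteq> sigma_sets (space M) Cyl"
    using Z_sets FPi by (intro sigma_sets_mono) auto
  with indep show ?thesis
    unfolding indep_var_eq indep_sets2_eq using Z_M by auto
qed

section \<open>The noise and its innovations\<close>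

text \<open>
  An almost surely constant variable counts as Gaussian; when centred it is the case of zero variance.
\<close>

lemma (in prob_space) gaussian_rv_centred:
  assumes X: "gaussian_rv M X" and mean: "expectation X = 0"
  shows "all_moments M X"
    and "(CLINT \<omega>|M. iexp (t * X \<omega>)) = exp (- (t\<^sup>2 * expectation (\<lambda>\<omega>. (X \<omega>)\<^sup>2) / 2))"
proof -
  have X_meas [measurable]: "X \<in> borel_measurable M" using X by (simp add: gaussian_rv_def)
  have "all_moments M X \<and> 
    (CLINT \<omega>|M. iexp (t * X \<omega>)) = exp (- (t\<^sup>2 * expectation (\<lambda>\<omega>. (X \<omega>)\<^sup>2) / 2))"
    using X unfolding gaussian_rv_def
  proof (elim conjE disjE exE)
    fix \<mu> assume "AE \<omega> in M. X \<omega> = \<mu>"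
    moreover from this have "expectation X = (LINT \<omega>|M. \<mu>)"
      by (intro integral_cong_AE) auto
    ultimately have AE: "AE \<omega> in M. X \<omega> = 0" using mean by (simp add: prob_space)
    have "integrable M (\<lambda>\<omega>. \<bar>X \<omega>\<bar> ^ r)" for r :: nat
      using AE by (intro integrable_const_bound[where B=1]) (auto elim!: eventually_mono simp: power_0_left)
    moreover have "(CLINT \<omega>|M. iexp (t * X \<omega>)) = (CLINT \<omega>|M. 1)"
      using AE by (intro integral_cong_AE) auto
    moreover have "expectation (\<lambda>\<omega>. (X \<omega>)\<^sup>2) = (LINT \<omega>|M. 0)"
      using AE by (intro integral_cong_AE) auto
    ultimately show ?thesis by (simp add: all_moments_def prob_space)
  next
    fix \<mu> s :: real assume s: "s > 0" and D: "distributed M lborel X (\<lambda>y. ennreal (normal_density \<mu> s y))"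
    have "\<mu> = 0" using normal_distributed_expectation[OF s D] mean by simp
    note D = D[unfolded this]
    have "variance X = s\<^sup>2" by (rule normal_distributed_variance[OF s D])
    then have var: "expectation (\<lambda>\<omega>. (X \<omega>)\<^sup>2) = s\<^sup>2" using mean by simp
    have "integrable M (\<lambda>\<omega>. \<bar>X \<omega>\<bar> ^ r)" for r :: nat
      using distributed_integrable[OF D, of "\<lambda>x. \<bar>x\<bar> ^ r"] integrable_normal_moment_abs[OF s, of 0 r]
      by simp
    moreover have "(CLINT \<omega>|M. iexp (t * X \<omega>)) = exp (- (t\<^sup>2 * s\<^sup>2 / 2))"
    proof -
      have "distributed M lborel (\<lambda>\<omega>. X \<omega> / s) std_normal_density"
        using normal_standard_normal_convert[OF s, of X 0] D by simp
      then have "distr M lborel (\<lambda>\<omega>. X \<omega> / s) = std_normal_distribution"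
        by (simp add: distributed_def)
      then have "char (distr M lborel (\<lambda>\<omega>. X \<omega> / s)) (t * s) = exp (- ((t * s)\<^sup>2 / 2))"
        by (simp add: char_std_normal_distribution)
      moreover have "char (distr M lborel (\<lambda>\<omega>. X \<omega> / s)) (t * s) = (CLINT \<omega>|M. iexp (t * s * (X \<omega> / s)))"
        unfolding char_def by (subst integral_distr) auto
      ultimately show ?thesis using s by (simp add: power_mult_distrib)
    qed
    ultimately show ?thesis by (simp add: all_moments_def var)
  qed
  then show "all_moments M X"
    "(CLINT \<omega>|M. iexp (t * X \<omega>)) = exp (- (t\<^sup>2 * expectation (\<lambda>\<omega>. (X \<omega>)\<^sup>2) / 2))"
    by blast+
qed

text \<open>
  Summation by parts writes a combination of increments as a combination of values of \<open>B\<close> at the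
  integers, to which the definition of a Gaussian process applies.
\<close>

lemma gaussian_increments:
  assumes "gaussian_process M {0..} B"
  shows "gaussian_rv M (\<lambda>\<omega>. \<Sum>k\<le>n. a k * fbm_increment B k \<omega>)"
proof -
  define c where "c t = (let j = nat \<lfloor>t\<rfloor> in (if j \<ge> 1 then a (j - 1) else 0) - (if j \<le> n then a j else 0))"
    for t :: real
  have "gaussian_rv M (\<lambda>\<omega>. \<Sum>t\<in>real ` {..Suc n}. c t * B t \<omega>)"
    by (rule assms[unfolded gaussian_process_def, rule_format]) auto
  moreover have "(\<Sum>t\<in>real ` {..Suc n}. c t * B t \<omega>) = (\<Sum>k\<le>n. a k * fbm_increment B k \<omega>)" for \<omega>
  proof -
    have "(\<Sum>t\<in>real ` {..Suc n}. c t * B t \<omega>) = (\<Sum>j\<le>Suc n. c (real j) * B (real j) \<omega>)"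
      by (subst sum.reindex) (auto simp: inj_on_def)
    also have "\<dots> = (\<Sum>j\<le>Suc n. (if j \<ge> 1 then a (j - 1) else 0) * B (real j) \<omega>)
        - (\<Sum>j\<le>Suc n. (if j \<le> n then a j else 0) * B (real j) \<omega>)"
      by (simp add: c_def Let_def left_diff_distrib sum_subtractf)
    also have "(\<Sum>j\<le>Suc n. (if j \<ge> 1 then a (j - 1) else 0) * B (real j) \<omega>)
        = (\<Sum>k\<le>n. a k * B (real k + 1) \<omega>)"
      by (subst sum.atMost_Suc_shift) (simp add: add.commute)
    also have "(\<Sum>j\<le>Suc n. (if j \<le> n then a j else 0) * B (real j) \<omega>) = (\<Sum>k\<le>n. a k * B (real k) \<omega>)"
      by simp
    finally show ?thesis by (simp add: fbm_increment_def right_diff_distrib sum_subtractf)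
  qed
  ultimately show ?thesis by simp
qed

text \<open>
  The recursion for \<open>\<beta>\<close> states this with the sum ending at the smaller index; triangularity allows any
  common bound \<open>m\<close>, so that the sums for different rows can later be interchanged.
\<close>

lemma cholesky_product:
  assumes chol: "cholesky_array \<rho> \<beta>" and sym: "\<And>n k. \<rho> n k = \<rho> k n" and "n \<le> m" "k \<le> m"
  shows "\<rho> n k = (\<Sum>j\<le>m. \<beta> n j * \<beta> k j)"
proof -
  have tri: "\<beta> n k = 0" if "n < k" for n k using chol that unfolding cholesky_array_def by blast
  have pos: "\<beta> n n > 0" for n using chol unfolding cholesky_array_def by blast
  have main: "\<rho> n k = (\<Sum>j\<le>m. \<beta> n j * \<beta> k j)" if "k \<le> n" "n \<le> m" for n k
  proof -
    have "\<beta> n k = (\<rho> n k - (\<Sum>j<k. \<beta> n j * \<beta> k j)) / \<beta> k k"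
      using chol that unfolding cholesky_array_def by blast
    then have "\<rho> n k = \<beta> n k * \<beta> k k + (\<Sum>j<k. \<beta> n j * \<beta> k j)"
      using pos[of k] by (simp add: field_simps)
    also have "\<dots> = (\<Sum>j\<le>k. \<beta> n j * \<beta> k j)" by (simp flip: lessThan_Suc_atMost)
    also have "\<dots> = (\<Sum>j\<le>m. \<beta> n j * \<beta> k j)"
      by (rule sum.mono_neutral_left) (use that tri in auto)
    finally show ?thesis .
  qed
  show ?thesis
  proof (cases "k \<le> n")
    case False
    then have "\<rho> k n = (\<Sum>j\<le>m. \<beta> k j * \<beta> n j)" using main[of n k] assms by simp
    then show ?thesis by (simp add: sym[of n k] mult.commute)
  qed (use main assms in simp)
qed

lemma noise_cov_sym: "noise_cov H n k = noise_cov H k n"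
proof -
  have "\<bar>real n - real k + 1\<bar> = \<bar>real k - real n - 1\<bar>" "\<bar>real n - real k - 1\<bar> = \<bar>real k - real n + 1\<bar>"
    "\<bar>real n - real k\<bar> = \<bar>real k - real n\<bar>" by linarith+
  then show ?thesis unfolding noise_cov_def by (simp only: add.commute)
qed

text \<open>
  With \<open>\<eta> = \<alpha> \<xi>\<close> this is \<open>\<xi> = \<beta> \<eta>\<close>, the terms \<open>\<eta>\<^sub>k\<close> with \<open>k < n\<close> being expressed again through
  \<open>\<xi>\<close>.
\<close>

lemma whitening_decomposition:
  fixes \<xi> :: "nat \<Rightarrow> real"
  assumes inv: "lower_triangular_inverse \<beta> \<alpha>"
  shows "\<xi> n = (\<Sum>j<n. (\<Sum>k<n. \<beta> n k * \<alpha> k j) * \<xi> j) + \<beta> n n * (\<Sum>j\<le>n. \<alpha> n j * \<xi> j)"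
proof -
  have tri: "\<alpha> k j = 0" if "k < j" for k j using inv that by (auto simp: lower_triangular_inverse_def)
  have "(\<Sum>j<n. (\<Sum>k<n. \<beta> n k * \<alpha> k j) * \<xi> j) = (\<Sum>j\<le>n. (\<Sum>k<n. \<beta> n k * \<alpha> k j) * \<xi> j)"
    using tri by (simp flip: lessThan_Suc_atMost)
  also have "\<dots> + \<beta> n n * (\<Sum>j\<le>n. \<alpha> n j * \<xi> j) = (\<Sum>j\<le>n. ((\<Sum>k<n. \<beta> n k * \<alpha> k j) + \<beta> n n * \<alpha> n j) * \<xi> j)"
    by (simp add: sum_distrib_left sum.distrib distrib_right mult.assoc)
  also have "\<dots> = (\<Sum>j\<le>n. (\<Sum>k\<le>n. \<beta> n k * \<alpha> k j) * \<xi> j)"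
    by (simp flip: lessThan_Suc_atMost)
  also have "\<dots> = (\<Sum>j\<le>n. (if n = j then 1 else 0) * \<xi> j)"
    using inv by (simp add: lower_triangular_inverse_def)
  also have "\<dots> = \<xi> n" by (simp add: if_distrib[of "\<lambda>a. a * _"] sum.delta cong: if_cong)
  finally show ?thesis by simp
qed

text \<open>
  The form in which the control argument sees the noise: at each time it is the sum of a part known from
  the past and a multiple of a standardised variable independent of the past.
\<close>

locale innovation_noise = prob_space M for M :: "'w measure" +
  fixes F :: "nat \<Rightarrow> 'w measure" and \<xi> \<kappa> \<eta> :: "nat \<Rightarrow> 'w \<Rightarrow> real" and d :: "nat \<Rightarrow> real"
  assumes F_sub: "subalgebra M (F n)"
    and F_mono: "subalgebra (F (Suc n)) (F n)"
    and noise_measurable: "\<xi> n \<in> borel_measurable (F (Suc n))"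
    and predictable: "\<kappa> n \<in> borel_measurable (F n)"
    and predictable_moments: "all_moments M (\<kappa> n)"
    and innovation_moments: "all_moments M (\<eta> n)"
    and noise_decomposition: "\<xi> n \<omega> = \<kappa> n \<omega> + d n * \<eta> n \<omega>"
    and innovation_indep: "Z \<in> borel_measurable (F n) \<Longrightarrow> indep_var borel Z borel (\<eta> n)"
    and innovation_mean: "expectation (\<eta> n) = 0"
    and innovation_variance: "expectation (\<lambda>\<omega>. (\<eta> n \<omega>)\<^sup>2) = 1"
begin

lemma noise_moments: "all_moments M (\<xi> n)"
  unfolding noise_decomposition[abs_def]
  by (intro all_moments_add all_moments_mult predictable_moments innovation_moments all_moments_const)

lemma adapted_measurable: "f \<in> borel_measurable (F n) \<Longrightarrow> f \<in> borel_measurable M"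
  by (rule measurable_from_subalg[OF F_sub])

lemma space_F: "space (F n) = space M"
  using F_sub by (simp add: subalgebra_def)

text \<open>
  Independence removes \<open>\<eta>\<^sub>n\<close> from expectations against the past, and the decomposition of \<open>\<xi>\<^sub>n\<close> reduces
  its moments to those of \<open>\<eta>\<^sub>n\<close>.  The last identity is the source of the term \<open>\<beta>(n,n) \<sigma>\<^sub>u q\<^sub>n\<close> in the
  maximum principle.
\<close>

lemma innovation_orthogonal:
  assumes Y: "Y \<in> borel_measurable (F n)" and int: "almost_Lp M 2 Y"
  shows "expectation (\<lambda>\<omega>. Y \<omega> * \<eta> n \<omega>) = 0"
    and "expectation (\<lambda>\<omega>. Y \<omega> * \<xi> n \<omega>) = expectation (\<lambda>\<omega>. Y \<omega> * \<kappa> n \<omega>)"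
    and "expectation (\<lambda>\<omega>. Y \<omega> * \<xi> n \<omega> * \<eta> n \<omega>) = d n * expectation Y"
proof -
  have Lp: "integrable M f" if "almost_Lp M 2 f" for f
    using that by (rule almost_Lp_integrable) simp
  have zero: "expectation (\<lambda>\<omega>. Z \<omega> * \<eta> n \<omega>) = 0"
    if "Z \<in> borel_measurable (F n)" "almost_Lp M 2 Z" for Z
    using indep_var_lebesgue_integral[OF innovation_indep[OF that(1)] Lp[OF that(2)]
      all_moments_integrable[OF innovation_moments]] by (simp add: innovation_mean)
  show "expectation (\<lambda>\<omega>. Y \<omega> * \<eta> n \<omega>) = 0" by (rule zero[OF Y int])
  have i1: "almost_Lp M 2 (\<lambda>\<omega>. Y \<omega> * \<kappa> n \<omega>)" "almost_Lp M 2 (\<lambda>\<omega>. Y \<omega> * \<eta> n \<omega>)"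
    "almost_Lp M 2 (\<lambda>\<omega>. Y \<omega> * \<kappa> n \<omega> * \<eta> n \<omega>)" "almost_Lp M 2 (\<lambda>\<omega>. Y \<omega> * \<eta> n \<omega> * \<eta> n \<omega>)"
    by (intro almost_Lp_mult_all_moments int predictable_moments innovation_moments)+
  have "expectation (\<lambda>\<omega>. Y \<omega> * \<xi> n \<omega>)
      = expectation (\<lambda>\<omega>. Y \<omega> * \<kappa> n \<omega> + d n * (Y \<omega> * \<eta> n \<omega>))"
    by (simp add: noise_decomposition algebra_simps)
  also have "\<dots> = expectation (\<lambda>\<omega>. Y \<omega> * \<kappa> n \<omega>)"
    using i1[THEN Lp] zero[OF Y int] by simp
  finally show "expectation (\<lambda>\<omega>. Y \<omega> * \<xi> n \<omega>) = expectation (\<lambda>\<omega>. Y \<omega> * \<kappa> n \<omega>)" .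
  have sq: "expectation (\<lambda>\<omega>. Y \<omega> * \<eta> n \<omega> * \<eta> n \<omega>) = expectation Y"
  proof -
    have "indep_var borel Y borel ((\<lambda>x. x\<^sup>2) \<circ> \<eta> n)"
      using indep_var_compose[OF innovation_indep[OF Y], of "\<lambda>x. x" borel "\<lambda>x. x\<^sup>2" borel]
      by (simp add: comp_def)
    then have "expectation (\<lambda>\<omega>. Y \<omega> * (\<eta> n \<omega>)\<^sup>2) = expectation Y * expectation (\<lambda>\<omega>. (\<eta> n \<omega>)\<^sup>2)"
      using indep_var_lebesgue_integral[of Y "\<lambda>\<omega>. (\<eta> n \<omega>)\<^sup>2"] Lp[OF int]
        all_moments_integrable[OF all_moments_mult[OF innovation_moments innovation_moments], of n n]
      by (simp add: comp_def power2_eq_square)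
    then show ?thesis unfolding innovation_variance by (simp add: power2_eq_square mult.assoc)
  qed
  have "expectation (\<lambda>\<omega>. Y \<omega> * \<xi> n \<omega> * \<eta> n \<omega>)
      = expectation (\<lambda>\<omega>. Y \<omega> * \<kappa> n \<omega> * \<eta> n \<omega> + d n * (Y \<omega> * \<eta> n \<omega> * \<eta> n \<omega>))"
    by (simp add: noise_decomposition algebra_simps)
  also have "\<dots> = expectation (\<lambda>\<omega>. Y \<omega> * \<kappa> n \<omega> * \<eta> n \<omega>) + d n * expectation Y"
    using i1[THEN Lp] sq by simp
  also have "expectation (\<lambda>\<omega>. Y \<omega> * \<kappa> n \<omega> * \<eta> n \<omega>) = 0"
    by (rule zero) (use Y predictable i1 in auto)
  finally show "expectation (\<lambda>\<omega>. Y \<omega> * \<xi> n \<omega> * \<eta> n \<omega>) = d n * expectation Y" by simp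
qed

end


text \<open>
  The Cholesky relations give \<open>E[\<eta>\<^sub>n \<xi>\<^sub>k] = \<beta>(k,n)\<close> for \<open>k \<le> n\<close>, which vanishes for \<open>k < n\<close>.  For
  jointly Gaussian variables zero covariance makes characteristic functions factorise, and an event of
  \<open>F\<^sub>0\<close> splits off because \<open>F\<^sub>0\<close> is independent of all increments.
\<close>

lemma (in prob_space) fbm_innovation_noise:
  fixes B :: "real \<Rightarrow> 'a \<Rightarrow> real"
  assumes fbm: "fractional_brownian_motion M H B" and F0: "subalgebra M F0"
    and indep: "indep_set (sets F0) (process_sigma M (fbm_increment B))"
    and chol: "cholesky_array (noise_cov H) \<beta>" and inv: "lower_triangular_inverse \<beta> \<alpha>"
  shows "innovation_noise M (noise_filtration M F0 (fbm_increment B)) (fbm_increment B)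
    (\<lambda>n \<omega>. \<Sum>k<n. (\<Sum>j<n. \<beta> n j * \<alpha> j k) * fbm_increment B k \<omega>)
    (\<lambda>n \<omega>. \<Sum>k\<le>n. \<alpha> n k * fbm_increment B k \<omega>) (\<lambda>n. \<beta> n n)"
proof -
  define \<xi> where "\<xi> = fbm_increment B"
  define \<eta> where "\<eta> n \<omega> = (\<Sum>k\<le>n. \<alpha> n k * \<xi> k \<omega>)" for n \<omega>
  define F where "F = noise_filtration M F0 \<xi>"
  have gp: "gaussian_process M {0..} B" and meanB: "\<And>t. t \<ge> 0 \<Longrightarrow> expectation (B t) = 0"
    and covB: "\<And>s t. t \<ge> 0 \<Longrightarrow> s \<ge> 0 \<Longrightarrow> expectation (\<lambda>\<omega>. B t \<omega> * B s \<omega>) =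
        (t powr (2*H) + s powr (2*H) - \<bar>t - s\<bar> powr (2*H)) / 2"
    using fbm by (auto simp: fractional_brownian_motion_def)
  have momB: "all_moments M (B t)" if "t \<ge> 0" for t
  proof (rule gaussian_rv_centred)
    show "gaussian_rv M (B t)"
      using gp[unfolded gaussian_process_def, rule_format, of "{t}" "\<lambda>_. 1"] that by simp
  qed (simp add: meanB that)
  have mom: "all_moments M (\<xi> k)" for k
    unfolding \<xi>_def fbm_increment_def by (intro all_moments_diff momB) auto
  note int = mom[THEN all_moments_integrable]
  have [measurable]: "\<xi> k \<in> borel_measurable M" for k using mom by measurable
  have mean: "expectation (\<xi> k) = 0" for k
  proof -
    have "expectation (\<xi> k) = expectation (B (real k + 1)) - expectation (B (real k))"
      unfolding \<xi>_def fbm_increment_def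
      by (intro Bochner_Integration.integral_diff all_moments_integrable momB) auto
    then show ?thesis by (simp add: meanB)
  qed
  have cov: "expectation (\<lambda>\<omega>. \<xi> n \<omega> * \<xi> k \<omega>) = noise_cov H n k" for n k
  proof -
    have i: "integrable M (\<lambda>\<omega>. B t \<omega> * B s \<omega>)" if "t \<ge> 0" "s \<ge> 0" for s t
      by (intro all_moments_integrable all_moments_mult momB that)
    have "expectation (\<lambda>\<omega>. \<xi> n \<omega> * \<xi> k \<omega>) = expectation (\<lambda>\<omega>.
        B (real n + 1) \<omega> * B (real k + 1) \<omega> - B (real n + 1) \<omega> * B (real k) \<omega>
        - B (real n) \<omega> * B (real k + 1) \<omega> + B (real n) \<omega> * B (real k) \<omega>)"
      unfolding \<xi>_def fbm_increment_def by (simp add: algebra_simps)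
    also have "\<dots> = expectation (\<lambda>\<omega>. B (real n + 1) \<omega> * B (real k + 1) \<omega>)
        - expectation (\<lambda>\<omega>. B (real n + 1) \<omega> * B (real k) \<omega>)
        - expectation (\<lambda>\<omega>. B (real n) \<omega> * B (real k + 1) \<omega>)
        + expectation (\<lambda>\<omega>. B (real n) \<omega> * B (real k) \<omega>)"
      by (simp add: i)
    also have "\<dots> = noise_cov H n k"
    proof -
      have nn: "0 \<le> real m + 1" "0 \<le> real m" for m by auto
      have "\<bar>real n + 1 - (real k + 1)\<bar> = \<bar>real n - real k\<bar>" "\<bar>real n + 1 - real k\<bar> = \<bar>real n - real k + 1\<bar>"
        "\<bar>real n - (real k + 1)\<bar> = \<bar>real n - real k - 1\<bar>" by linarith+
      moreover have combine: "(A1 + B1 - C1) / 2 - (A1 + B2 - C2) / 2 - (A2 + B1 - C3) / 2 + (A2 + B2 - C1) / 2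
          = (C2 + C3 - 2 * C1) / 2" for A1 A2 B1 B2 C1 C2 C3 :: real by (simp add: field_simps)
      ultimately show ?thesis
        unfolding noise_cov_def covB[OF nn(1) nn(1)] covB[OF nn(1) nn(2)] covB[OF nn(2) nn(1)] covB[OF nn(2) nn(2)]
        by (simp only: combine)
    qed
    finally show ?thesis .
  qed
  have lin_mom: "all_moments M (\<lambda>\<omega>. \<Sum>k\<in>I. a k * \<xi> k \<omega>)" for I :: "nat set" and a
    by (intro all_moments_sum all_moments_mult all_moments_const mom)
  \<comment> \<open>Centred linear combinations are Gaussian, so second moments determine all characters.\<close>
  have lin_char: "(CLINT \<omega>|M. iexp (\<Sum>k\<le>n. a k * \<xi> k \<omega>))
      = exp (- (expectation (\<lambda>\<omega>. (\<Sum>k\<le>n. a k * \<xi> k \<omega>)\<^sup>2) / 2))" for n a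
    using gaussian_rv_centred(2)[OF gaussian_increments[OF gp, of a n], of 1] int mean
    by (simp add: \<xi>_def)
  have eta_xi: "expectation (\<lambda>\<omega>. \<eta> n \<omega> * \<xi> k \<omega>) = \<beta> k n" if "k \<le> n" for n k
  proof -
    have "expectation (\<lambda>\<omega>. \<eta> n \<omega> * \<xi> k \<omega>) = expectation (\<lambda>\<omega>. \<Sum>j\<le>n. \<alpha> n j * (\<xi> j \<omega> * \<xi> k \<omega>))"
      by (simp add: \<eta>_def sum_distrib_right mult.assoc)
    also have "\<dots> = (\<Sum>j\<le>n. \<alpha> n j * noise_cov H j k)"
      by (subst Bochner_Integration.integral_sum)
         (auto intro!: all_moments_integrable all_moments_mult mom simp: cov)
    also have "\<dots> = (\<Sum>j\<le>n. \<alpha> n j * (\<Sum>i\<le>n. \<beta> j i * \<beta> k i))"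
      using that by (intro sum.cong refl) (simp add: cholesky_product[OF chol noise_cov_sym])
    also have "\<dots> = (\<Sum>i\<le>n. \<beta> k i * (\<Sum>j\<le>n. \<alpha> n j * \<beta> j i))"
      by (simp add: sum_distrib_left) (subst sum.swap, simp add: mult_ac)
    also have "\<dots> = (\<Sum>i\<le>n. \<beta> k i * (if n = i then 1 else 0))"
      using inv by (simp add: lower_triangular_inverse_def)
    also have "\<dots> = (\<Sum>i\<le>n. if n = i then \<beta> k i else 0)" by (intro sum.cong) auto
    also have "\<dots> = \<beta> k n" by simp
    finally show ?thesis .
  qed
  have mom_eta: "all_moments M (\<eta> n)" for n unfolding \<eta>_def by (rule lin_mom)
  have [measurable]: "\<eta> n \<in> borel_measurable M" for n using mom_eta by measurable
  have mean_eta: "expectation (\<eta> n) = 0" for n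
    unfolding \<eta>_def using int mean by simp
  have var_eta: "expectation (\<lambda>\<omega>. (\<eta> n \<omega>)\<^sup>2) = 1" for n
  proof -
    have "expectation (\<lambda>\<omega>. (\<eta> n \<omega>)\<^sup>2) = expectation (\<lambda>\<omega>. \<Sum>k\<le>n. \<alpha> n k * (\<eta> n \<omega> * \<xi> k \<omega>))"
      by (simp add: power2_eq_square sum_distrib_left mult_ac)
        (simp add: \<eta>_def sum_distrib_left sum_distrib_right mult_ac)
    also have "\<dots> = (\<Sum>k\<le>n. \<alpha> n k * \<beta> k n)"
      by (subst Bochner_Integration.integral_sum)
         (auto intro!: all_moments_integrable all_moments_mult mom mom_eta simp: eta_xi)
    also have "\<dots> = 1" using inv by (simp add: lower_triangular_inverse_def)
    finally show ?thesis .
  qed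
  have space_F0: "space F0 = space M" and sF0: "sets F0 \<subseteq> sets M"
    using F0 by (auto simp: subalgebra_def)
  have sF: "sets F0 \<subseteq> Pow (space M)" using sets.space_closed[of F0] space_F0 by simp
  have joint_char: "(CLINT \<omega>|M. iexp (\<Sum>k<n. t k * \<xi> k \<omega>) * iexp (s * \<eta> n \<omega>)) =
      (CLINT \<omega>|M. iexp (\<Sum>k<n. t k * \<xi> k \<omega>)) * (CLINT \<omega>|M. iexp (s * \<eta> n \<omega>))" for n t s
  proof -
    define R where "R \<omega> = (\<Sum>k<n. t k * \<xi> k \<omega>)" for \<omega>
    have R: "R \<omega> = (\<Sum>k\<le>n. (if k < n then t k else 0) * \<xi> k \<omega>)" for \<omega>
      unfolding R_def by (simp flip: lessThan_Suc_atMost)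
    have mR: "all_moments M R" unfolding R_def by (rule lin_mom)
    have tri: "\<beta> k n = 0" if "k < n" for k using chol that unfolding cholesky_array_def by blast
    have orth: "expectation (\<lambda>\<omega>. R \<omega> * \<eta> n \<omega>) = 0"
    proof -
      have "expectation (\<lambda>\<omega>. R \<omega> * \<eta> n \<omega>) = expectation (\<lambda>\<omega>. \<Sum>k<n. t k * (\<eta> n \<omega> * \<xi> k \<omega>))"
        by (simp add: R_def sum_distrib_right sum_distrib_left mult_ac)
      also have "\<dots> = 0"
        by (subst Bochner_Integration.integral_sum)
           (auto intro!: all_moments_integrable all_moments_mult mom mom_eta simp: eta_xi tri)
      finally show ?thesis .
    qed
    have i: "integrable M (\<lambda>\<omega>. R \<omega> * R \<omega>)" "integrable M (\<lambda>\<omega>. R \<omega> * \<eta> n \<omega>)" 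
      "integrable M (\<lambda>\<omega>. \<eta> n \<omega> * \<eta> n \<omega>)"
      by (intro all_moments_integrable all_moments_mult mR mom_eta)+
    have Rs: "R \<omega> + s * \<eta> n \<omega> = (\<Sum>k\<le>n. ((if k < n then t k else 0) + s * \<alpha> n k) * \<xi> k \<omega>)" for \<omega>
      unfolding R \<eta>_def sum_distrib_left sum.distrib[symmetric]
      by (intro sum.cong refl) (simp only: distrib_right mult.assoc)
    have se: "s * \<eta> n \<omega> = (\<Sum>k\<le>n. (s * \<alpha> n k) * \<xi> k \<omega>)" for \<omega>
      unfolding \<eta>_def by (simp add: sum_distrib_left mult_ac)
    have 1: "(CLINT \<omega>|M. iexp (R \<omega> + s * \<eta> n \<omega>)) = exp (- (expectation (\<lambda>\<omega>. (R \<omega> + s * \<eta> n \<omega>)\<^sup>2) / 2))"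
      unfolding Rs by (rule lin_char)
    have 2: "(CLINT \<omega>|M. iexp (R \<omega>)) = exp (- (expectation (\<lambda>\<omega>. (R \<omega>)\<^sup>2) / 2))"
      unfolding R by (rule lin_char)
    have 3: "(CLINT \<omega>|M. iexp (s * \<eta> n \<omega>)) = exp (- (expectation (\<lambda>\<omega>. (s * \<eta> n \<omega>)\<^sup>2) / 2))"
      unfolding se by (rule lin_char)
    have "expectation (\<lambda>\<omega>. (R \<omega> + s * \<eta> n \<omega>)\<^sup>2) = expectation (\<lambda>\<omega>. R \<omega> * R \<omega> 
        + 2 * s * (R \<omega> * \<eta> n \<omega>) + s\<^sup>2 * (\<eta> n \<omega> * \<eta> n \<omega>))"
      by (simp add: power2_eq_square algebra_simps)
    also have "\<dots> = expectation (\<lambda>\<omega>. (R \<omega>)\<^sup>2) + s\<^sup>2 * expectation (\<lambda>\<omega>. (\<eta> n \<omega>)\<^sup>2)"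
      using i orth by (simp add: power2_eq_square)
    also have "s\<^sup>2 * expectation (\<lambda>\<omega>. (\<eta> n \<omega>)\<^sup>2) = expectation (\<lambda>\<omega>. (s * \<eta> n \<omega>)\<^sup>2)"
      by (simp add: power_mult_distrib)
    finally have "(CLINT \<omega>|M. iexp (R \<omega> + s * \<eta> n \<omega>)) = (CLINT \<omega>|M. iexp (R \<omega>)) * (CLINT \<omega>|M. iexp (s * \<eta> n \<omega>))"
      unfolding 1 2 3 by (simp add: exp_add[symmetric] add_divide_distrib of_real_mult[symmetric] del: of_real_mult)
    then show ?thesis by (simp add: R_def exp_add distrib_left)
  qed
  define G where "G = sigma (space M) (\<Union>k. rv_sigma M (\<xi> k))"
  have rv: "rv_sigma M X = {X -` B \<inter> space M |B. B \<in> sets borel}" for X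
    unfolding rv_sigma_def by (rule sets_vimage_algebra2) auto
  have G_gen: "(\<Union>k. rv_sigma M (\<xi> k)) \<subseteq> Pow (space M)" by (auto simp: rv)
  have sets_G: "sets G = process_sigma M \<xi>" and space_G: "space G = space M"
    unfolding G_def process_sigma_def using G_gen by (simp_all add: space_measure_of)
  have xi_G [measurable]: "\<xi> k \<in> borel_measurable G" for k
  proof (rule measurableI)
    fix D :: "real set" assume "D \<in> sets borel"
    then have "\<xi> k -` D \<inter> space M \<in> (\<Union>k. rv_sigma M (\<xi> k))" by (auto simp: rv)
    then show "\<xi> k -` D \<inter> space G \<in> sets G"
      unfolding sets_G space_G process_sigma_def by (rule sigma_sets.Basic)
  qed simp
  have factor: "(CLINT \<omega>|M. indicator A \<omega> * g \<omega>) = (CLINT \<omega>|M. indicator A \<omega>) * (CLINT \<omega>|M. g \<omega>)"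
    if A: "A \<in> sets F0" and g: "g \<in> borel_measurable G" and bd: "\<And>\<omega>. norm (g \<omega>) \<le> 1"
    for A and g :: "'a \<Rightarrow> complex"
  proof (rule indep_var_lebesgue_integral)
    have AM [measurable]: "A \<in> sets M" using A sF0 by auto
    have subG: "sets G \<subseteq> sets M"
      using indep_setD_ev2[OF indep] by (simp add: sets_G \<xi>_def)
    have gM [measurable]: "g \<in> borel_measurable M"
      using g measurable_from_subalg[of M G] subG space_G by (simp add: subalgebra_def)
    show "integrable M (indicator A :: 'a \<Rightarrow> complex)"
      by (rule integrable_const_bound[where B=1]) (auto simp: indicator_def)
    show "integrable M g" by (rule integrable_const_bound[where B=1]) (auto simp: bd)
    have "{indicator A -` D \<inter> space M |D. D \<in> sets (borel :: complex measure)} \<subseteq> sets F0"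
    proof safe
      fix D :: "complex set" assume "D \<in> sets borel"
      moreover have "(indicator A :: 'a \<Rightarrow> complex) \<in> borel_measurable F0" using A by measurable
      ultimately show "indicator A -` D \<inter> space M \<in> sets F0"
        using space_F0 by (metis measurable_sets)
    qed
    then have 1: "sigma_sets (space M) {indicator A -` D \<inter> space M |D. D \<in> sets (borel :: complex measure)} \<subseteq> sets F0"
      unfolding space_F0[symmetric] by (rule sets.sigma_sets_subset)
    have "{g -` D \<inter> space M |D. D \<in> sets borel} \<subseteq> sets G"
      using measurable_sets[OF g] space_G by auto
    then have 2: "sigma_sets (space M) {g -` D \<inter> space M |D. D \<in> sets borel} \<subseteq> sets G"
      unfolding space_G[symmetric] by (rule sets.sigma_sets_subset)
    show "indep_var borel (indicator A :: 'a \<Rightarrow> complex) borel g"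
      unfolding indep_var_eq indep_sets2_eq
    proof (intro conjI ballI)
      fix a b assume "a \<in> sigma_sets (space M) {indicator A -` D \<inter> space M |D. D \<in> sets (borel :: complex measure)}"
        "b \<in> sigma_sets (space M) {g -` D \<inter> space M |D. D \<in> sets borel}"
      then have "a \<in> sets F0" "b \<in> process_sigma M (fbm_increment B)"
        using 1 2 sets_G unfolding \<xi>_def by blast+
      then show "prob (a \<inter> b) = prob a * prob b" by (rule indep_setD[OF indep])
    qed (use 1 2 sF0 subG in \<open>auto intro!: borel_measurable_indicator\<close>)
  qed
  have eta_indep: "indep_var borel Z borel (\<eta> n)" if Z: "Z \<in> borel_measurable (F n)" for Z n
  proof (rule indep_var_of_characters[OF F0 _ _ _ Z[unfolded F_def]])
    fix A t s assume A: "A \<in> sets F0"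
    have [measurable]: "\<eta> n \<in> borel_measurable G" unfolding \<eta>_def by measurable
    have "(\<lambda>\<omega>. \<Sum>k<n. t k * \<xi> k \<omega>) \<in> borel_measurable G"
      by (intro borel_measurable_sum borel_measurable_times borel_measurable_const xi_G)
    then have sum_G: "(\<lambda>\<omega>. iexp (\<Sum>k<n. t k * \<xi> k \<omega>)) \<in> borel_measurable G"
      by (rule measurable_compose) measurable
    have "(CLINT \<omega>|M. indicator A \<omega> * iexp (\<Sum>k<n. t k * \<xi> k \<omega>) * iexp (s * \<eta> n \<omega>))
      = (CLINT \<omega>|M. indicator A \<omega> * (iexp (\<Sum>k<n. t k * \<xi> k \<omega>) * iexp (s * \<eta> n \<omega>)))"
      by (simp add: mult.assoc)
    also have "\<dots> = (CLINT \<omega>|M. indicator A \<omega>) * (CLINT \<omega>|M. iexp (\<Sum>k<n. t k * \<xi> k \<omega>) * iexp (s * \<eta> n \<omega>))"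
      by (rule factor[OF A]) (measurable, simp add: norm_mult)
    also have "\<dots> = (CLINT \<omega>|M. indicator A \<omega>) * (CLINT \<omega>|M. iexp (\<Sum>k<n. t k * \<xi> k \<omega>)) * (CLINT \<omega>|M. iexp (s * \<eta> n \<omega>))"
      unfolding joint_char by (simp add: mult.assoc)
    also have "(CLINT \<omega>|M. indicator A \<omega>) * (CLINT \<omega>|M. iexp (\<Sum>k<n. t k * \<xi> k \<omega>))
      = (CLINT \<omega>|M. indicator A \<omega> * iexp (\<Sum>k<n. t k * \<xi> k \<omega>))"
      by (rule factor[OF A, symmetric]) (rule sum_G, simp)
    finally show "(CLINT \<omega>|M. indicator A \<omega> * iexp (\<Sum>k<n. t k * \<xi> k \<omega>) * iexp (s * \<eta> n \<omega>)) =
      (CLINT \<omega>|M. indicator A \<omega> * iexp (\<Sum>k<n. t k * \<xi> k \<omega>)) * (CLINT \<omega>|M. iexp (s * \<eta> n \<omega>))" .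
  qed auto
  have space_Fn: "space (F n) = space M" for n unfolding F_def by (rule space_noise_filtration[OF sF])
  have sets_Fn: "sets (F n) = sigma_sets (space M) (sets F0 \<union> (\<Union>k<n. {\<xi> k -` D \<inter> space M |D. D \<in> sets borel}))" for n
    unfolding F_def by (rule sets_noise_filtration[OF sF])
  have F_sub: "subalgebra M (F n)" for n
    unfolding subalgebra_def space_Fn sets_Fn using sF0 by (auto intro!: sets.sigma_sets_subset)
  have F_mono: "subalgebra (F (Suc n)) (F n)" for n
    unfolding subalgebra_def space_Fn sets_Fn
    by (intro conjI refl sigma_sets_mono' Un_mono order_refl UN_mono) auto
  have xi_F: "\<xi> k \<in> borel_measurable (F n)" if "k < n" for k n
    by (rule measurableI) (use that in \<open>auto simp: space_Fn sets_Fn intro!: sigma_sets.Basic\<close>)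
  have "innovation_noise M F \<xi> (\<lambda>n \<omega>. \<Sum>k<n. (\<Sum>j<n. \<beta> n j * \<alpha> j k) * \<xi> k \<omega>) \<eta> (\<lambda>n. \<beta> n n)"
  proof unfold_locales
    fix n \<omega>
    show "\<xi> n \<omega> = (\<Sum>k<n. (\<Sum>j<n. \<beta> n j * \<alpha> j k) * \<xi> k \<omega>) + \<beta> n n * \<eta> n \<omega>"
      unfolding \<eta>_def by (rule whitening_decomposition[OF inv])
    show "(\<lambda>\<omega>. \<Sum>k<n. (\<Sum>j<n. \<beta> n j * \<alpha> j k) * \<xi> k \<omega>) \<in> borel_measurable (F n)"
      using xi_F by (intro borel_measurable_sum borel_measurable_times) auto
  qed (use F_sub F_mono xi_F lin_mom mom_eta eta_indep mean_eta var_eta in auto)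
  then show ?thesis unfolding F_def \<eta>_def[abs_def] \<xi>_def .
qed

section \<open>Partial derivatives\<close>

text \<open>
  The partial derivatives are defined through \<open>deriv\<close> along the axes; joint differentiability is what
  makes them the coordinates of the Frechet derivative.
\<close>

lemma has_derivative_xu:
  assumes "differentiable_xu f"
  shows "((\<lambda>(y, v). f y v) has_derivative
    (\<lambda>(dy, dv). partial_x f y0 v0 * dy + partial_u f y0 v0 * dv)) (at (y0, v0))"
proof -
  obtain D where D: "((\<lambda>(y, v). f y v) has_derivative D) (at (y0, v0))"
    using assms unfolding differentiable_xu_def differentiable_def by blast
  interpret D: bounded_linear D using D by (rule has_derivative_bounded_linear)
  have Dx: "D (dy, 0) = D (1, 0) * dy" and Dv: "D (0, dv) = D (0, 1) * dv" for dy dv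
    using D.scaleR[of dy "(1, 0)"] D.scaleR[of dv "(0, 1)"] by (simp_all add: mult.commute)
  have "((\<lambda>y. (\<lambda>(y, v). f y v) (y, v0)) has_derivative (\<lambda>dy. D (dy, 0))) (at y0)"
    by (rule has_derivative_compose[of "\<lambda>y. (y, v0)", OF _ D]) (auto intro!: derivative_eq_intros)
  moreover have "(\<lambda>dy. D (dy, 0)) = (\<lambda>dy. D (1, 0) * dy)"
    by (rule ext) (fact Dx)
  ultimately have "((\<lambda>y. f y v0) has_field_derivative D (1, 0)) (at y0)"
    by (simp add: has_field_derivative_def)
  then have x: "partial_x f y0 v0 = D (1, 0)" unfolding partial_x_def by (rule DERIV_imp_deriv)
  have "((\<lambda>v. (\<lambda>(y, v). f y v) (y0, v)) has_derivative (\<lambda>dv. D (0, dv))) (at v0)"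
    by (rule has_derivative_compose[of "\<lambda>v. (y0, v)", OF _ D]) (auto intro!: derivative_eq_intros)
  moreover have "(\<lambda>dv. D (0, dv)) = (\<lambda>dv. D (0, 1) * dv)"
    by (rule ext) (fact Dv)
  ultimately have "((\<lambda>v. f y0 v) has_field_derivative D (0, 1)) (at v0)"
    by (simp add: has_field_derivative_def)
  then have u: "partial_u f y0 v0 = D (0, 1)" unfolding partial_u_def by (rule DERIV_imp_deriv)
  have sum: "D (dy, dv) = D (1, 0) * dy + D (0, 1) * dv" for dy dv
    using D.add[of "(dy, 0)" "(0, dv)"] by (simp add: Dx[of dy] Dv[of dv])
  have "D = (\<lambda>(dy, dv). partial_x f y0 v0 * dy + partial_u f y0 v0 * dv)"
    unfolding x u
  proof
    fix z show "D z = (case z of (dy, dv) \<Rightarrow> D (1, 0) * dy + D (0, 1) * dv)"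
      by (cases z) (simp only: prod.case, rule sum)
  qed
  with D show ?thesis by simp
qed

lemma chain_rule_xu:
  assumes f: "differentiable_xu f"
    and g: "(g has_real_derivative g') (at t)" and h: "(h has_real_derivative h') (at t)"
  shows "((\<lambda>s. f (g s) (h s)) has_real_derivative
    partial_x f (g t) (h t) * g' + partial_u f (g t) (h t) * h') (at t)"
proof -
  have "((\<lambda>s. (g s, h s)) has_derivative (\<lambda>ds. (g' * ds, h' * ds))) (at t)"
    using g h unfolding has_field_derivative_def by (rule has_derivative_Pair)
  from has_derivative_compose[OF this has_derivative_xu[OF f], unfolded prod.case]
  show ?thesis unfolding has_field_derivative_def
    by (rule has_derivative_eq_rhs) (auto simp: fun_eq_iff algebra_simps)
qed

lemma has_real_derivative_partial_x:
  "differentiable_xu f \<Longrightarrow> ((\<lambda>y. f y v) has_real_derivative partial_x f y v) (at y)"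
  using chain_rule_xu[of f "\<lambda>y. y" 1 y "\<lambda>_. v" 0] by (simp add: DERIV_ident)

lemma has_real_derivative_partial_u:
  "differentiable_xu f \<Longrightarrow> ((\<lambda>v. f y v) has_real_derivative partial_u f y v) (at v)"
  using chain_rule_xu[of f "\<lambda>_. y" 0 v "\<lambda>v. v" 1] by (simp add: DERIV_ident)

lemma deriv_le_lipschitz:
  fixes f :: "real \<Rightarrow> real"
  assumes D: "(f has_real_derivative D) (at y)" and lip: "\<And>z. \<bar>f z - f y\<bar> \<le> L * \<bar>z - y\<bar>"
  shows "\<bar>D\<bar> \<le> L"
proof (rule tendsto_upperbound)
  show "((\<lambda>h. \<bar>(f (y + h) - f y) / h\<bar>) \<longlongrightarrow> \<bar>D\<bar>) (at 0)"
    using D unfolding DERIV_def by (rule tendsto_rabs)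
  show "\<forall>\<^sub>F h in at 0. \<bar>(f (y + h) - f y) / h\<bar> \<le> L"
    unfolding eventually_at_filter
  proof (rule always_eventually, safe)
    fix h :: real assume "h \<noteq> 0"
    then show "\<bar>(f (y + h) - f y) / h\<bar> \<le> L" using lip[of "y + h"] by (simp add: divide_le_eq)
  qed
qed simp

lemma partial_bounds:
  assumes "differentiable_xu f" "lipschitz_xu L f"
  shows "\<bar>partial_x f y v\<bar> \<le> L" "\<bar>partial_u f y v\<bar> \<le> L"
proof -
  have lip: "\<bar>f x1 u1 - f x2 u2\<bar> \<le> L * (\<bar>x1 - x2\<bar> + \<bar>u1 - u2\<bar>)" for x1 x2 u1 u2
    using assms(2) by (simp add: lipschitz_xu_def)
  show "\<bar>partial_x f y v\<bar> \<le> L"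
    by (rule deriv_le_lipschitz[OF has_real_derivative_partial_x[OF assms(1)]])
       (use lip[of _ v y v] in simp)
  show "\<bar>partial_u f y v\<bar> \<le> L"
    by (rule deriv_le_lipschitz[OF has_real_derivative_partial_u[OF assms(1)]])
       (use lip[of y _ y v] in simp)
qed

text \<open>
  Along countably many step sizes, derivatives become limits of sequences, as needed for measurability
  and for dominated convergence.
\<close>

lemma DERIV_sequentially:
  fixes f :: "real \<Rightarrow> real"
  assumes "(f has_real_derivative D) (at y)"
  shows "(\<lambda>m. (f (y + 1 / real (Suc m)) - f y) * real (Suc m)) \<longlonglongrightarrow> D"
proof -
  have "((\<lambda>h. (f (y + h) - f y) / h) \<longlongrightarrow> D) (at 0)" using assms by (simp add: DERIV_def)
  moreover have "filterlim (\<lambda>m. 1 / real (Suc m)) (at 0) sequentially"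
    using LIMSEQ_inverse_real_of_nat by (simp add: filterlim_at inverse_eq_divide)
  ultimately have "(\<lambda>m. (f (y + 1 / real (Suc m)) - f y) / (1 / real (Suc m))) \<longlonglongrightarrow> D"
    by (rule filterlim_compose)
  then show ?thesis by simp
qed

lemma partial_measurable:
  fixes f :: "'w \<Rightarrow> real \<Rightarrow> real \<Rightarrow> real"
  assumes f: "(\<lambda>(\<omega>, y, v). f \<omega> y v) \<in> borel_measurable (G \<Otimes>\<^sub>M (borel \<Otimes>\<^sub>M borel))"
    and diff: "\<And>\<omega>. \<omega> \<in> space G \<Longrightarrow> differentiable_xu (f \<omega>)"
    and [measurable]: "y \<in> borel_measurable G" "v \<in> borel_measurable G"
  shows "(\<lambda>\<omega>. partial_x (f \<omega>) (y \<omega>) (v \<omega>)) \<in> borel_measurable G"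
    and "(\<lambda>\<omega>. partial_u (f \<omega>) (y \<omega>) (v \<omega>)) \<in> borel_measurable G"
proof -
  have comp: "(\<lambda>\<omega>. f \<omega> (y \<omega>) (v \<omega>)) \<in> borel_measurable G"
    if [measurable]: "y \<in> borel_measurable G" "v \<in> borel_measurable G" for y v
    using measurable_compose[of "\<lambda>\<omega>. (\<omega>, y \<omega>, v \<omega>)", OF _ f] by simp
  show "(\<lambda>\<omega>. partial_x (f \<omega>) (y \<omega>) (v \<omega>)) \<in> borel_measurable G"
  proof (rule borel_measurable_LIMSEQ_real)
    fix \<omega> assume "\<omega> \<in> space G"
    from DERIV_sequentially[OF has_real_derivative_partial_x[OF diff[OF this]]]
    show "(\<lambda>m. (f \<omega> (y \<omega> + 1 / real (Suc m)) (v \<omega>) - f \<omega> (y \<omega>) (v \<omega>)) * real (Suc m))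
        \<longlonglongrightarrow> partial_x (f \<omega>) (y \<omega>) (v \<omega>)" .
  qed (intro borel_measurable_times borel_measurable_diff comp borel_measurable_const; measurable)
  show "(\<lambda>\<omega>. partial_u (f \<omega>) (y \<omega>) (v \<omega>)) \<in> borel_measurable G"
  proof (rule borel_measurable_LIMSEQ_real)
    fix \<omega> assume "\<omega> \<in> space G"
    from DERIV_sequentially[OF has_real_derivative_partial_u[OF diff[OF this]]]
    show "(\<lambda>m. (f \<omega> (y \<omega>) (v \<omega> + 1 / real (Suc m)) - f \<omega> (y \<omega>) (v \<omega>)) * real (Suc m))
        \<longlonglongrightarrow> partial_u (f \<omega>) (y \<omega>) (v \<omega>)" .
  qed (intro borel_measurable_times borel_measurable_diff comp borel_measurable_const; measurable)
qed

lemma mean_value_bound: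
  fixes f :: "real \<Rightarrow> real"
  assumes D: "\<And>z. (f has_real_derivative f' z) (at z)"
    and bd: "\<And>z. \<bar>z - y\<bar> \<le> \<bar>w - y\<bar> \<Longrightarrow> \<bar>f' z\<bar> \<le> C"
  shows "\<bar>f w - f y\<bar> \<le> C * \<bar>w - y\<bar>"
proof (rule field_differentiable_bound[where S = "closed_segment y w" and f' = f', unfolded real_norm_def])
  fix z assume "z \<in> closed_segment y w"
  then show "\<bar>f' z\<bar> \<le> C" by (intro bd) (auto simp: closed_segment_eq_real_ivl split: if_splits)
qed (use D in \<open>auto intro: has_field_derivative_at_within\<close>)

section \<open>The controlled state and its first variation\<close>

definition total_cost :: "(nat \<Rightarrow> real \<Rightarrow> real \<Rightarrow> real) \<Rightarrow> (real \<Rightarrow> real) \<Rightarrow> nat \<Rightarrow>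
   (nat \<Rightarrow> 'w \<Rightarrow> real) \<Rightarrow> (nat \<Rightarrow> 'w \<Rightarrow> real) \<Rightarrow> 'w \<Rightarrow> real" where
  "total_cost l \<Phi> N X u \<omega> = (\<Sum>n<N. l n (X n \<omega>) (u n \<omega>)) + \<Phi> (X N \<omega>)"

text \<open>
  The control \<open>us\<close> is an arbitrary reference control; it becomes optimal only in the maximum principle.
\<close>

locale controlled_system = innovation_noise M F \<xi> \<kappa> \<eta> d
  for M :: "'w measure" and F \<xi> \<kappa> \<eta> d +
  fixes b \<sigma> :: "nat \<Rightarrow> 'w \<Rightarrow> real \<Rightarrow> real \<Rightarrow> real"
    and l :: "nat \<Rightarrow> real \<Rightarrow> real \<Rightarrow> real" and \<Phi> :: "real \<Rightarrow> real"
    and x :: "'w \<Rightarrow> real" and us :: "nat \<Rightarrow> 'w \<Rightarrow> real" and N :: nat and r L :: real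
  assumes r: "r > 2" and L: "L \<ge> 0" and N: "N \<ge> 1"
    and b_measurable: "n < N \<Longrightarrow> (\<lambda>(\<omega>, y, v). b n \<omega> y v) \<in> borel_measurable (F n \<Otimes>\<^sub>M (borel \<Otimes>\<^sub>M borel))"
    and \<sigma>_measurable: "n < N \<Longrightarrow> (\<lambda>(\<omega>, y, v). \<sigma> n \<omega> y v) \<in> borel_measurable (F n \<Otimes>\<^sub>M (borel \<Otimes>\<^sub>M borel))"
    and l_measurable: "n < N \<Longrightarrow> (\<lambda>(y, v). l n y v) \<in> borel_measurable (borel \<Otimes>\<^sub>M borel)"
    and \<Phi>_measurable: "\<Phi> \<in> borel_measurable borel"
    and b_moment: "n < N \<Longrightarrow> almost_Lp M r (\<lambda>\<omega>. b n \<omega> 0 0)"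
    and \<sigma>_moment: "n < N \<Longrightarrow> almost_Lp M r (\<lambda>\<omega>. \<sigma> n \<omega> 0 0)"
    and b_smooth: "n < N \<Longrightarrow> \<omega> \<in> space M \<Longrightarrow> differentiable_xu (b n \<omega>) \<and> lipschitz_xu L (b n \<omega>)"
    and \<sigma>_smooth: "n < N \<Longrightarrow> \<omega> \<in> space M \<Longrightarrow> differentiable_xu (\<sigma> n \<omega>) \<and> lipschitz_xu L (\<sigma> n \<omega>)"
    and l_smooth: "n < N \<Longrightarrow> differentiable_xu (l n)"
    and \<Phi>_smooth: "\<Phi> differentiable (at y)"
    and l_growth: "n < N \<Longrightarrow> \<bar>partial_x (l n) y v\<bar> \<le> L * (1 + \<bar>y\<bar> + \<bar>v\<bar>)"
    and \<Phi>_growth: "\<bar>deriv \<Phi> y\<bar> \<le> L * (1 + \<bar>y\<bar>)"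
    and x_adapted: "x \<in> borel_measurable (F 0)" and x_moment: "almost_Lp M r x"
    and u_adapted: "n < N \<Longrightarrow> us n \<in> borel_measurable (F n)"
    and u_moment: "n < N \<Longrightarrow> almost_Lp M r (us n)"
begin

abbreviation X :: "nat \<Rightarrow> 'w \<Rightarrow> real" where "X \<equiv> state b \<sigma> \<xi> x us"

definition bx where "bx n \<omega> = partial_x (b n \<omega>) (X n \<omega>) (us n \<omega>)"
definition sx where "sx n \<omega> = partial_x (\<sigma> n \<omega>) (X n \<omega>) (us n \<omega>)"
definition lx where "lx n \<omega> = partial_x (l n) (X n \<omega>) (us n \<omega>)"
definition bu where "bu n \<omega> = partial_u (b n \<omega>) (X n \<omega>) (us n \<omega>)"
definition su where "su n \<omega> = partial_u (\<sigma> n \<omega>) (X n \<omega>) (us n \<omega>)"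
definition lu where "lu n \<omega> = partial_u (l n) (X n \<omega>) (us n \<omega>)"

lemma coefficient_lipschitz:
  assumes "n < N" "\<omega> \<in> space M"
  shows "\<bar>b n \<omega> y v - b n \<omega> y' v'\<bar> \<le> L * (\<bar>y - y'\<bar> + \<bar>v - v'\<bar>)"
    and "\<bar>\<sigma> n \<omega> y v - \<sigma> n \<omega> y' v'\<bar> \<le> L * (\<bar>y - y'\<bar> + \<bar>v - v'\<bar>)"
  using b_smooth[OF assms] \<sigma>_smooth[OF assms] by (auto simp: lipschitz_xu_def)

lemma coefficient_adapted:
  assumes "n < N" and [measurable]: "y \<in> borel_measurable (F n)" "v \<in> borel_measurable (F n)"
  shows "(\<lambda>\<omega>. b n \<omega> (y \<omega>) (v \<omega>)) \<in> borel_measurable (F n)"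
    and "(\<lambda>\<omega>. \<sigma> n \<omega> (y \<omega>) (v \<omega>)) \<in> borel_measurable (F n)"
    and "(\<lambda>\<omega>. l n (y \<omega>) (v \<omega>)) \<in> borel_measurable (F n)"
  using measurable_compose[of "\<lambda>\<omega>. (\<omega>, y \<omega>, v \<omega>)", OF _ b_measurable[OF assms(1)]]
    measurable_compose[of "\<lambda>\<omega>. (\<omega>, y \<omega>, v \<omega>)", OF _ \<sigma>_measurable[OF assms(1)]]
    measurable_compose[of "\<lambda>\<omega>. (y \<omega>, v \<omega>)", OF _ l_measurable[OF assms(1)]] by simp_all

lemma state_adapted:
  assumes u: "\<And>n. n < N \<Longrightarrow> u n \<in> borel_measurable (F n)" and "k \<le> N"
  shows "state b \<sigma> \<xi> x u k \<in> borel_measurable (F k)"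
  using \<open>k \<le> N\<close>
proof (induction k)
  case 0
  then show ?case using x_adapted by simp
next
  case (Suc k)
  then have k: "k < N" and IH: "state b \<sigma> \<xi> x u k \<in> borel_measurable (F k)" by auto
  have [measurable]: "state b \<sigma> \<xi> x u k \<in> borel_measurable (F (Suc k))" "\<xi> k \<in> borel_measurable (F (Suc k))"
    "(\<lambda>\<omega>. b k \<omega> (state b \<sigma> \<xi> x u k \<omega>) (u k \<omega>)) \<in> borel_measurable (F (Suc k))"
    "(\<lambda>\<omega>. \<sigma> k \<omega> (state b \<sigma> \<xi> x u k \<omega>) (u k \<omega>)) \<in> borel_measurable (F (Suc k))"
    by (rule measurable_from_subalg[OF F_mono] noise_measurable IH coefficient_adapted k u)+
  show ?case by simp
qed

lemma state_moment: "k \<le> N \<Longrightarrow> almost_Lp M r (X k)"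
proof (induction k)
  case 0
  then show ?case using x_moment by simp
next
  case (Suc k)
  then have k: "k < N" and IH: "almost_Lp M r (X k)" by auto
  have u: "almost_Lp M r (us k)" by (rule u_moment[OF k])
  have Xk: "X k \<in> borel_measurable (F k)" using k u_adapted by (intro state_adapted) auto
  have coef: "almost_Lp M r (\<lambda>\<omega>. f \<omega> (X k \<omega>) (us k \<omega>))"
    if f0: "almost_Lp M r (\<lambda>\<omega>. f \<omega> 0 0)"
      and m: "(\<lambda>\<omega>. f \<omega> (X k \<omega>) (us k \<omega>)) \<in> borel_measurable (F k)"
      and lip: "\<And>\<omega>. \<omega> \<in> space M \<Longrightarrow> \<bar>f \<omega> (X k \<omega>) (us k \<omega>) - f \<omega> 0 0\<bar> \<le> L * (\<bar>X k \<omega> - 0\<bar> + \<bar>us k \<omega> - 0\<bar>)" for f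
  proof (rule almost_Lp_bound)
    show "almost_Lp M r (\<lambda>\<omega>. \<bar>f \<omega> 0 0\<bar> + L * (\<bar>X k \<omega>\<bar> + \<bar>us k \<omega>\<bar>))"
      using r by (intro almost_Lp_add almost_Lp_abs all_moments_mult_almost_Lp all_moments_const IH u f0) auto
    show "(\<lambda>\<omega>. f \<omega> (X k \<omega>) (us k \<omega>)) \<in> borel_measurable M" by (rule adapted_measurable[OF m])
    fix \<omega> assume "\<omega> \<in> space M"
    from lip[OF this] show "\<bar>f \<omega> (X k \<omega>) (us k \<omega>)\<bar> \<le> \<bar>\<bar>f \<omega> 0 0\<bar> + L * (\<bar>X k \<omega>\<bar> + \<bar>us k \<omega>\<bar>)\<bar>"
      by (simp add: abs_if split: if_splits)
  qed
  note adapted = coefficient_adapted[OF k Xk u_adapted[OF k]]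
  have "almost_Lp M r (\<lambda>\<omega>. b k \<omega> (X k \<omega>) (us k \<omega>))"
    by (rule coef[OF b_moment[OF k] adapted(1)]) (rule coefficient_lipschitz[OF k])
  moreover have "almost_Lp M r (\<lambda>\<omega>. \<sigma> k \<omega> (X k \<omega>) (us k \<omega>))"
    by (rule coef[OF \<sigma>_moment[OF k] adapted(2)]) (rule coefficient_lipschitz[OF k])
  ultimately show ?case
    using r unfolding state.simps
    by (intro almost_Lp_add almost_Lp_mult_all_moments noise_moments IH) auto
qed

lemma state_adapted': "k \<le> N \<Longrightarrow> X k \<in> borel_measurable (F k)"
  by (rule state_adapted[OF u_adapted])

lemma derivatives_adapted:
  assumes "n < N"
  shows "bx n \<in> borel_measurable (F n)" "sx n \<in> borel_measurable (F n)" "lx n \<in> borel_measurable (F n)"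
    "bu n \<in> borel_measurable (F n)" "su n \<in> borel_measurable (F n)" "lu n \<in> borel_measurable (F n)"
proof -
  have l: "(\<lambda>(\<omega>, y, v). l n y v) \<in> borel_measurable (F n \<Otimes>\<^sub>M (borel \<Otimes>\<^sub>M borel))"
    using measurable_compose[OF measurable_snd l_measurable[OF assms], of "F n"]
    by (simp add: case_prod_beta')
  note * = state_adapted'[OF less_imp_le[OF assms]] u_adapted[OF assms]
  show "bx n \<in> borel_measurable (F n)" "bu n \<in> borel_measurable (F n)"
    unfolding bx_def[abs_def] bu_def[abs_def]
    by (rule partial_measurable[OF b_measurable[OF assms] _ *]; use b_smooth assms space_F in auto)+
  show "sx n \<in> borel_measurable (F n)" "su n \<in> borel_measurable (F n)"
    unfolding sx_def[abs_def] su_def[abs_def]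
    by (rule partial_measurable[OF \<sigma>_measurable[OF assms] _ *]; use \<sigma>_smooth assms space_F in auto)+
  show "lx n \<in> borel_measurable (F n)" "lu n \<in> borel_measurable (F n)"
    unfolding lx_def[abs_def] lu_def[abs_def]
    by (rule partial_measurable[OF l _ *]; use l_smooth assms in auto)+
qed

lemma derivatives_bounded:
  assumes "n < N" "\<omega> \<in> space M"
  shows "\<bar>bx n \<omega>\<bar> \<le> L" "\<bar>sx n \<omega>\<bar> \<le> L" "\<bar>bu n \<omega>\<bar> \<le> L" "\<bar>su n \<omega>\<bar> \<le> L"
  unfolding bx_def sx_def bu_def su_def
  using b_smooth[OF assms] \<sigma>_smooth[OF assms] by (auto intro: partial_bounds)

lemma derivatives_moments:
  assumes "n < N"
  shows "all_moments M (bx n)" "all_moments M (sx n)" "all_moments M (bu n)" "all_moments M (su n)"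
  using derivatives_adapted[OF assms, THEN adapted_measurable] derivatives_bounded[OF assms]
  by (auto intro: bounded_all_moments[where K = L])

lemma running_gradient_moment:
  assumes "n < N"
  shows "almost_Lp M r (lx n)"
proof (rule almost_Lp_bound)
  show "almost_Lp M r (\<lambda>\<omega>. L * (1 + \<bar>X n \<omega>\<bar> + \<bar>us n \<omega>\<bar>))"
    using r assms
    by (intro all_moments_mult_almost_Lp almost_Lp_add almost_Lp_abs all_moments_const state_moment
        u_moment all_moments_almost_Lp) auto
  show "lx n \<in> borel_measurable M" by (rule adapted_measurable[OF derivatives_adapted(3)[OF assms]])
  fix \<omega>
  have "\<bar>lx n \<omega>\<bar> \<le> L * (1 + \<bar>X n \<omega>\<bar> + \<bar>us n \<omega>\<bar>)" unfolding lx_def by (rule l_growth[OF assms])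
  then show "\<bar>lx n \<omega>\<bar> \<le> \<bar>L * (1 + \<bar>X n \<omega>\<bar> + \<bar>us n \<omega>\<bar>)\<bar>" by linarith
qed

lemma \<Phi>_deriv: "(\<Phi> has_real_derivative deriv \<Phi> y) (at y)"
  using \<Phi>_smooth by (simp add: DERIV_deriv_iff_real_differentiable)

lemma terminal_gradient_moment: "almost_Lp M r (\<lambda>\<omega>. deriv \<Phi> (X N \<omega>))"
proof (rule almost_Lp_bound)
  show "almost_Lp M r (\<lambda>\<omega>. L * (1 + \<bar>X N \<omega>\<bar>))"
    using r
    by (intro all_moments_mult_almost_Lp almost_Lp_add almost_Lp_abs all_moments_const state_moment
        all_moments_almost_Lp) auto
  have "deriv \<Phi> \<in> borel_measurable borel"
  proof (rule borel_measurable_LIMSEQ_real)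
    fix y show "(\<lambda>m. (\<Phi> (y + 1 / real (Suc m)) - \<Phi> y) * real (Suc m)) \<longlonglongrightarrow> deriv \<Phi> y"
      by (rule DERIV_sequentially[OF \<Phi>_deriv])
  next
    note [measurable] = \<Phi>_measurable
    show "(\<lambda>y. (\<Phi> (y + 1 / real (Suc m)) - \<Phi> y) * real (Suc m)) \<in> borel_measurable borel" for m by measurable
  qed
  then show "(\<lambda>\<omega>. deriv \<Phi> (X N \<omega>)) \<in> borel_measurable M"
    using adapted_measurable[OF state_adapted'[OF order_refl]] by (rule measurable_compose[rotated])
  fix \<omega>
  have "\<bar>deriv \<Phi> (X N \<omega>)\<bar> \<le> L * (1 + \<bar>X N \<omega>\<bar>)" by (rule \<Phi>_growth)
  then show "\<bar>deriv \<Phi> (X N \<omega>)\<bar> \<le> \<bar>L * (1 + \<bar>X N \<omega>\<bar>)\<bar>" by linarith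
qed

abbreviation perturbed :: "(nat \<Rightarrow> 'w \<Rightarrow> real) \<Rightarrow> real \<Rightarrow> nat \<Rightarrow> 'w \<Rightarrow> real" where
  "perturbed h \<epsilon> \<equiv> state b \<sigma> \<xi> x (\<lambda>k \<omega>. us k \<omega> + \<epsilon> * h k \<omega>)"

text \<open>
  If the direction is bounded by \<open>K\<close>, the Lipschitz condition lets the distance between perturbed and
  reference state, divided by \<open>\<epsilon>\<close>, grow no faster than this recursion, whose solution is a polynomial
  in the absolute noise.  The linearised state obeys the same bound.
\<close>

primrec gap :: "real \<Rightarrow> nat \<Rightarrow> 'w \<Rightarrow> real" where
  "gap K 0 = (\<lambda>\<omega>. 0)"
| "gap K (Suc k) = (\<lambda>\<omega>. gap K k \<omega> + L * (gap K k \<omega> + K) * (1 + \<bar>\<xi> k \<omega>\<bar>))"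

text \<open>
  The derivative of the perturbed state in \<open>\<epsilon>\<close> at \<open>0\<close>, obtained by differentiating the recursion for the
  state.
\<close>

primrec variation :: "(nat \<Rightarrow> 'w \<Rightarrow> real) \<Rightarrow> nat \<Rightarrow> 'w \<Rightarrow> real" where
  "variation h 0 = (\<lambda>\<omega>. 0)"
| "variation h (Suc k) = (\<lambda>\<omega>. variation h k \<omega> + (bx k \<omega> * variation h k \<omega> + bu k \<omega> * h k \<omega>)
     + (sx k \<omega> * variation h k \<omega> + su k \<omega> * h k \<omega>) * \<xi> k \<omega>)"

lemma gap_nonneg: "K \<ge> 0 \<Longrightarrow> gap K k \<omega> \<ge> 0"
  by (induction k) (auto intro!: add_nonneg_nonneg mult_nonneg_nonneg L)

lemma gap_moments: "all_moments M (gap K k)"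
proof (induction k)
  case (Suc k)
  then show ?case unfolding gap.simps
    by (intro all_moments_add all_moments_mult all_moments_const all_moments_abs noise_moments)
qed simp

lemma perturbed_gap:
  assumes h: "\<And>k. k < N \<Longrightarrow> \<bar>h k \<omega>\<bar> \<le> K" and "\<epsilon> \<ge> 0" and \<omega>: "\<omega> \<in> space M" and "k \<le> N"
  shows "\<bar>perturbed h \<epsilon> k \<omega> - X k \<omega>\<bar> \<le> \<epsilon> * gap K k \<omega>"
  using \<open>k \<le> N\<close>
proof (induction k)
  case (Suc k)
  then have k: "k < N" by simp
  define u' where "u' = us k \<omega> + \<epsilon> * h k \<omega>"
  define e where "e = L * (\<epsilon> * gap K k \<omega> + \<epsilon> * K)"
  have IH: "\<bar>perturbed h \<epsilon> k \<omega> - X k \<omega>\<bar> \<le> \<epsilon> * gap K k \<omega>" using Suc by simp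
  have "\<bar>u' - us k \<omega>\<bar> \<le> \<epsilon> * K"
    using h[OF k] \<open>\<epsilon> \<ge> 0\<close> by (simp add: u'_def abs_mult mult_left_mono)
  with IH have *: "L * (\<bar>perturbed h \<epsilon> k \<omega> - X k \<omega>\<bar> + \<bar>u' - us k \<omega>\<bar>) \<le> e"
    unfolding e_def using L by (intro mult_left_mono) auto
  let ?db = "b k \<omega> (perturbed h \<epsilon> k \<omega>) u' - b k \<omega> (X k \<omega>) (us k \<omega>)"
  let ?ds = "\<sigma> k \<omega> (perturbed h \<epsilon> k \<omega>) u' - \<sigma> k \<omega> (X k \<omega>) (us k \<omega>)"
  have db: "\<bar>?db\<bar> \<le> e" and ds: "\<bar>?ds\<bar> \<le> e"
    using coefficient_lipschitz[OF k \<omega>, of "perturbed h \<epsilon> k \<omega>" u' "X k \<omega>" "us k \<omega>"] * by linarith+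
  have "\<bar>?ds * \<xi> k \<omega>\<bar> \<le> e * \<bar>\<xi> k \<omega>\<bar>" using ds by (simp add: abs_mult mult_right_mono)
  moreover have "perturbed h \<epsilon> (Suc k) \<omega> - X (Suc k) \<omega> = (perturbed h \<epsilon> k \<omega> - X k \<omega>) + ?db + ?ds * \<xi> k \<omega>"
    by (simp add: u'_def algebra_simps)
  ultimately have "\<bar>perturbed h \<epsilon> (Suc k) \<omega> - X (Suc k) \<omega>\<bar> \<le> \<epsilon> * gap K k \<omega> + e + e * \<bar>\<xi> k \<omega>\<bar>"
    using IH db by linarith
  also have "\<dots> = \<epsilon> * gap K (Suc k) \<omega>" by (simp add: e_def algebra_simps)
  finally show ?case .
qed simp

lemma variation_bound:
  assumes h: "\<And>k. k < N \<Longrightarrow> \<bar>h k \<omega>\<bar> \<le> K" and \<omega>: "\<omega> \<in> space M" and "k \<le> N"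
  shows "\<bar>variation h k \<omega>\<bar> \<le> gap K k \<omega>"
  using \<open>k \<le> N\<close>
proof (induction k)
  case (Suc k)
  then have k: "k < N" and IH: "\<bar>variation h k \<omega>\<bar> \<le> gap K k \<omega>" by auto
  note d = derivatives_bounded[OF k \<omega>]
  have "\<bar>bx k \<omega> * variation h k \<omega>\<bar> \<le> L * gap K k \<omega>" "\<bar>bu k \<omega> * h k \<omega>\<bar> \<le> L * K"
    "\<bar>sx k \<omega> * variation h k \<omega>\<bar> \<le> L * gap K k \<omega>" "\<bar>su k \<omega> * h k \<omega>\<bar> \<le> L * K"
    unfolding abs_mult using d IH h[OF k] L by (auto intro!: mult_mono)
  then have *: "\<bar>bx k \<omega> * variation h k \<omega> + bu k \<omega> * h k \<omega>\<bar> \<le> L * (gap K k \<omega> + K)"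
    "\<bar>sx k \<omega> * variation h k \<omega> + su k \<omega> * h k \<omega>\<bar> \<le> L * (gap K k \<omega> + K)"
    unfolding distrib_left by linarith+
  have "\<bar>(sx k \<omega> * variation h k \<omega> + su k \<omega> * h k \<omega>) * \<xi> k \<omega>\<bar> \<le> L * (gap K k \<omega> + K) * \<bar>\<xi> k \<omega>\<bar>"
    unfolding abs_mult using *(2) by (intro mult_right_mono) auto
  then have "\<bar>variation h (Suc k) \<omega>\<bar> \<le> gap K k \<omega> + L * (gap K k \<omega> + K) + L * (gap K k \<omega> + K) * \<bar>\<xi> k \<omega>\<bar>"
    using *(1) IH unfolding variation.simps by linarith
  then show ?case by (simp add: algebra_simps)
qed simp

lemma variation_adapted:
  assumes h: "\<And>k. k < N \<Longrightarrow> h k \<in> borel_measurable (F k)" and "k \<le> N"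
  shows "variation h k \<in> borel_measurable (F k)"
  using \<open>k \<le> N\<close>
proof (induction k)
  case (Suc k)
  then have k: "k < N" and IH: "variation h k \<in> borel_measurable (F k)" by auto
  have [measurable]: "variation h k \<in> borel_measurable (F (Suc k))" "\<xi> k \<in> borel_measurable (F (Suc k))"
    "bx k \<in> borel_measurable (F (Suc k))" "bu k \<in> borel_measurable (F (Suc k))"
    "sx k \<in> borel_measurable (F (Suc k))" "su k \<in> borel_measurable (F (Suc k))"
    "h k \<in> borel_measurable (F (Suc k))"
    by (rule measurable_from_subalg[OF F_mono] noise_measurable IH derivatives_adapted k h)+
  show ?case by simp
qed simp

lemma variation_moments:
  assumes "\<And>k. k < N \<Longrightarrow> h k \<in> borel_measurable (F k)"
    and "\<And>k \<omega>. k < N \<Longrightarrow> \<omega> \<in> space M \<Longrightarrow> \<bar>h k \<omega>\<bar> \<le> K" and "k \<le> N"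
  shows "all_moments M (variation h k)"
proof (rule all_moments_bound[OF gap_moments[of K k]])
  show "variation h k \<in> borel_measurable M" by (intro adapted_measurable[of _ k] variation_adapted assms)
  fix \<omega> assume "\<omega> \<in> space M"
  then have "\<bar>variation h k \<omega>\<bar> \<le> gap K k \<omega>"
    by (intro variation_bound) (use assms in auto)
  then show "\<bar>variation h k \<omega>\<bar> \<le> \<bar>gap K k \<omega>\<bar>" by linarith
qed

lemma state_has_derivative:
  assumes \<omega>: "\<omega> \<in> space M" and "k \<le> N"
  shows "((\<lambda>\<epsilon>. perturbed h \<epsilon> k \<omega>) has_real_derivative variation h k \<omega>) (at 0)"
  using \<open>k \<le> N\<close>
proof (induction k)
  case (Suc k)
  then have k: "k < N"
    and IH: "((\<lambda>\<epsilon>. perturbed h \<epsilon> k \<omega>) has_real_derivative variation h k \<omega>) (at 0)" by auto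
  have u: "((\<lambda>\<epsilon>. us k \<omega> + \<epsilon> * h k \<omega>) has_real_derivative h k \<omega>) (at 0)"
    by (auto intro!: derivative_eq_intros)
  have "((\<lambda>\<epsilon>. b k \<omega> (perturbed h \<epsilon> k \<omega>) (us k \<omega> + \<epsilon> * h k \<omega>)) has_real_derivative
      bx k \<omega> * variation h k \<omega> + bu k \<omega> * h k \<omega>) (at 0)"
    "((\<lambda>\<epsilon>. \<sigma> k \<omega> (perturbed h \<epsilon> k \<omega>) (us k \<omega> + \<epsilon> * h k \<omega>)) has_real_derivative
      sx k \<omega> * variation h k \<omega> + su k \<omega> * h k \<omega>) (at 0)"
    using chain_rule_xu[OF conjunct1[OF b_smooth[OF k \<omega>]] IH u]
      chain_rule_xu[OF conjunct1[OF \<sigma>_smooth[OF k \<omega>]] IH u]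
    by (simp_all add: bx_def bu_def sx_def su_def)
  with IH show ?case unfolding state.simps variation.simps
    by (intro DERIV_add DERIV_cmult_right)
qed simp

definition cost_variation :: "(nat \<Rightarrow> 'w \<Rightarrow> real) \<Rightarrow> 'w \<Rightarrow> real" where
  "cost_variation h \<omega> = (\<Sum>k<N. lx k \<omega> * variation h k \<omega> + lu k \<omega> * h k \<omega>)
     + deriv \<Phi> (X N \<omega>) * variation h N \<omega>"

abbreviation perturbed_cost :: "(nat \<Rightarrow> 'w \<Rightarrow> real) \<Rightarrow> real \<Rightarrow> 'w \<Rightarrow> real" where
  "perturbed_cost h \<epsilon> \<equiv> total_cost l \<Phi> N (perturbed h \<epsilon>) (\<lambda>k \<omega>. us k \<omega> + \<epsilon> * h k \<omega>)"

lemma cost_has_derivative: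
  assumes \<omega>: "\<omega> \<in> space M"
  shows "((\<lambda>\<epsilon>. perturbed_cost h \<epsilon> \<omega>) has_real_derivative cost_variation h \<omega>) (at 0)"
  unfolding total_cost_def cost_variation_def
proof (intro DERIV_add DERIV_sum)
  fix k assume "k \<in> {..<N}"
  then have k: "k < N" by simp
  have u: "((\<lambda>\<epsilon>. us k \<omega> + \<epsilon> * h k \<omega>) has_real_derivative h k \<omega>) (at 0)"
    by (auto intro!: derivative_eq_intros)
  show "((\<lambda>\<epsilon>. l k (perturbed h \<epsilon> k \<omega>) (us k \<omega> + \<epsilon> * h k \<omega>)) has_real_derivative
      lx k \<omega> * variation h k \<omega> + lu k \<omega> * h k \<omega>) (at 0)"
    using chain_rule_xu[OF l_smooth[OF k] state_has_derivative[OF \<omega>] u] k by (simp add: lx_def lu_def)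
next
  have "(\<Phi> has_real_derivative deriv \<Phi> (X N \<omega>)) (at (perturbed h 0 N \<omega>))" using \<Phi>_deriv by simp
  from DERIV_chain2[OF this state_has_derivative[OF \<omega> order_refl]]
  show "((\<lambda>\<epsilon>. \<Phi> (perturbed h \<epsilon> N \<omega>)) has_real_derivative deriv \<Phi> (X N \<omega>) * variation h N \<omega>) (at 0)" .
qed

text \<open>
  The mean value theorem bounds the change of the cost that is due to the state, using the linear growth
  of \<open>l\<^sub>x\<close> and \<open>\<Phi>\<^sub>x\<close>.  The constant \<open>C\<close> accounts for the change that is due to the control, about which the
  growth conditions say nothing.
\<close>

definition cost_gap :: "real \<Rightarrow> real \<Rightarrow> 'w \<Rightarrow> real" where
  "cost_gap K C \<omega> = (\<Sum>k<N. L * (1 + \<bar>X k \<omega>\<bar> + gap K k \<omega> + \<bar>us k \<omega>\<bar> + K) * gap K k \<omega> + C)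
     + L * (1 + \<bar>X N \<omega>\<bar> + gap K N \<omega>) * gap K N \<omega>"

lemma cost_gap_integrable: "integrable M (cost_gap K C)"
proof (rule almost_Lp_integrable)
  show "almost_Lp M r (cost_gap K C)"
    unfolding cost_gap_def[abs_def] using r
    by (intro almost_Lp_add almost_Lp_sum almost_Lp_mult_all_moments all_moments_mult_almost_Lp
        almost_Lp_abs all_moments_const gap_moments state_moment u_moment
        all_moments_almost_Lp[OF all_moments_const] all_moments_almost_Lp[OF gap_moments]) auto
qed (use r in simp)

text \<open>
  Changing first the state and then the control separates the part of the running cost controlled by
  \<open>l\<^sub>x\<close> from the part controlled by the assumption on \<open>C\<close>.
\<close>

lemma perturbed_cost_gap:
  assumes h: "\<And>k. k < N \<Longrightarrow> \<bar>h k \<omega>\<bar> \<le> K" and \<epsilon>: "0 \<le> \<epsilon>" "\<epsilon> \<le> 1" and \<omega>: "\<omega> \<in> space M"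
    and C: "\<And>k. k < N \<Longrightarrow> \<bar>l k (X k \<omega>) (us k \<omega> + \<epsilon> * h k \<omega>) - l k (X k \<omega>) (us k \<omega>)\<bar> \<le> \<epsilon> * C"
  shows "\<bar>perturbed_cost h \<epsilon> \<omega> - total_cost l \<Phi> N X us \<omega>\<bar> \<le> \<epsilon> * cost_gap K C \<omega>"
proof -
  have "K \<ge> 0" using h[of 0] N by linarith
  note gap0 = gap_nonneg[OF this]
  let ?P = "\<lambda>k. perturbed h \<epsilon> k \<omega>" and ?u = "\<lambda>k. us k \<omega> + \<epsilon> * h k \<omega>"
  have close: "\<bar>?P k - X k \<omega>\<bar> \<le> \<epsilon> * gap K k \<omega>" if "k \<le> N" for k
    by (rule perturbed_gap) (use h \<epsilon> \<omega> that in auto)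
  have close1: "\<bar>?P k - X k \<omega>\<bar> \<le> gap K k \<omega>" if "k \<le> N" for k
    using close[OF that] mult_right_mono[OF \<epsilon>(2) gap0[of k \<omega>]] by linarith
  have running: "\<bar>l k (?P k) (?u k) - l k (X k \<omega>) (us k \<omega>)\<bar>
      \<le> \<epsilon> * (L * (1 + \<bar>X k \<omega>\<bar> + gap K k \<omega> + \<bar>us k \<omega>\<bar> + K) * gap K k \<omega> + C)" if k: "k < N" for k
  proof -
    have "\<bar>\<epsilon> * h k \<omega>\<bar> \<le> 1 * K" unfolding abs_mult using h[OF k] \<epsilon> by (intro mult_mono) auto
    then have u: "\<bar>?u k\<bar> \<le> \<bar>us k \<omega>\<bar> + K" by linarith
    let ?C = "L * (1 + \<bar>X k \<omega>\<bar> + gap K k \<omega> + \<bar>us k \<omega>\<bar> + K)"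
    have "?C \<ge> 0" using L gap0[of k \<omega>] \<open>K \<ge> 0\<close> by (intro mult_nonneg_nonneg) auto
    have "\<bar>l k (?P k) (?u k) - l k (X k \<omega>) (?u k)\<bar> \<le> ?C * \<bar>?P k - X k \<omega>\<bar>"
    proof (rule mean_value_bound)
      show "((\<lambda>y. l k y (?u k)) has_real_derivative partial_x (l k) z (?u k)) (at z)" for z
        by (rule has_real_derivative_partial_x[OF l_smooth[OF k]])
      fix z assume "\<bar>z - X k \<omega>\<bar> \<le> \<bar>?P k - X k \<omega>\<bar>"
      then have "\<bar>z\<bar> \<le> \<bar>X k \<omega>\<bar> + gap K k \<omega>" using close1[of k] k by linarith
      then have "L * (1 + \<bar>z\<bar> + \<bar>?u k\<bar>) \<le> ?C" using u L by (intro mult_left_mono) auto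
      then show "\<bar>partial_x (l k) z (?u k)\<bar> \<le> ?C" using l_growth[OF k, of z "?u k"] by linarith
    qed
    also have "\<dots> \<le> ?C * (\<epsilon> * gap K k \<omega>)"
      using close[of k] k \<open>?C \<ge> 0\<close> by (intro mult_left_mono) auto
    finally have "\<bar>l k (?P k) (?u k) - l k (X k \<omega>) (us k \<omega>)\<bar> \<le> ?C * (\<epsilon> * gap K k \<omega>) + \<epsilon> * C"
      using C[OF k] by linarith
    then show ?thesis by (simp only: distrib_left mult_ac)
  qed
  have terminal: "\<bar>\<Phi> (?P N) - \<Phi> (X N \<omega>)\<bar> \<le> \<epsilon> * (L * (1 + \<bar>X N \<omega>\<bar> + gap K N \<omega>) * gap K N \<omega>)"
  proof -
    let ?C = "L * (1 + \<bar>X N \<omega>\<bar> + gap K N \<omega>)"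
    have "?C \<ge> 0" using L gap0[of N \<omega>] by (intro mult_nonneg_nonneg) auto
    have "\<bar>\<Phi> (?P N) - \<Phi> (X N \<omega>)\<bar> \<le> ?C * \<bar>?P N - X N \<omega>\<bar>"
    proof (rule mean_value_bound[OF \<Phi>_deriv])
      fix z assume "\<bar>z - X N \<omega>\<bar> \<le> \<bar>?P N - X N \<omega>\<bar>"
      then have "\<bar>z\<bar> \<le> \<bar>X N \<omega>\<bar> + gap K N \<omega>" using close1[of N] by linarith
      then have "L * (1 + \<bar>z\<bar>) \<le> ?C" using L by (intro mult_left_mono) auto
      then show "\<bar>deriv \<Phi> z\<bar> \<le> ?C" using \<Phi>_growth[of z] by linarith
    qed
    also have "\<dots> \<le> ?C * (\<epsilon> * gap K N \<omega>)"
      using close[of N] \<open>?C \<ge> 0\<close> by (intro mult_left_mono) auto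
    finally show ?thesis by (simp only: mult_ac)
  qed
  have "\<bar>perturbed_cost h \<epsilon> \<omega> - total_cost l \<Phi> N X us \<omega>\<bar>
      = \<bar>(\<Sum>k<N. l k (?P k) (?u k) - l k (X k \<omega>) (us k \<omega>)) + (\<Phi> (?P N) - \<Phi> (X N \<omega>))\<bar>"
    by (simp add: total_cost_def sum_subtractf)
  also have "\<dots> \<le> (\<Sum>k<N. \<bar>l k (?P k) (?u k) - l k (X k \<omega>) (us k \<omega>)\<bar>) + \<bar>\<Phi> (?P N) - \<Phi> (X N \<omega>)\<bar>"
    by (intro order_trans[OF abs_triangle_ineq] add_mono sum_abs order_refl)
  also have "\<dots> \<le> (\<Sum>k<N. \<epsilon> * (L * (1 + \<bar>X k \<omega>\<bar> + gap K k \<omega> + \<bar>us k \<omega>\<bar> + K) * gap K k \<omega> + C))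
      + \<epsilon> * (L * (1 + \<bar>X N \<omega>\<bar> + gap K N \<omega>) * gap K N \<omega>)"
    by (intro add_mono sum_mono terminal running) auto
  also have "\<dots> = \<epsilon> * cost_gap K C \<omega>" by (simp add: cost_gap_def sum_distrib_left distrib_left)
  finally show ?thesis .
qed

lemma total_cost_measurable:
  assumes "\<And>k. k < N \<Longrightarrow> u k \<in> borel_measurable (F k)"
  shows "total_cost l \<Phi> N (state b \<sigma> \<xi> x u) u \<in> borel_measurable M"
  unfolding total_cost_def[abs_def]
proof (intro borel_measurable_add borel_measurable_sum)
  fix k assume "k \<in> {..<N}"
  then show "(\<lambda>\<omega>. l k (state b \<sigma> \<xi> x u k \<omega>) (u k \<omega>)) \<in> borel_measurable M"
    by (intro adapted_measurable[of _ k] coefficient_adapted state_adapted assms) auto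
next
  have "state b \<sigma> \<xi> x u N \<in> borel_measurable M" by (intro adapted_measurable[of _ N] state_adapted assms) auto
  then show "(\<lambda>\<omega>. \<Phi> (state b \<sigma> \<xi> x u N \<omega>)) \<in> borel_measurable M"
    using \<Phi>_measurable by measurable
qed

text \<open>
  Dominated convergence along the steps \<open>1/(m + 1)\<close>.  Since \<open>l\<close> may grow arbitrarily in the control,
  its difference quotients in the direction \<open>h\<close> are required to be bounded; directions with this
  property are obtained later by truncation.
\<close>

lemma first_variation:
  assumes h_adapted: "\<And>k. k < N \<Longrightarrow> h k \<in> borel_measurable (F k)"
    and h: "\<And>k \<omega>. k < N \<Longrightarrow> \<omega> \<in> space M \<Longrightarrow> \<bar>h k \<omega>\<bar> \<le> K"
    and C: "\<And>k \<omega> m. k < N \<Longrightarrow> \<omega> \<in> space M \<Longrightarrow>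
      \<bar>l k (X k \<omega>) (us k \<omega> + 1 / real (Suc m) * h k \<omega>) - l k (X k \<omega>) (us k \<omega>)\<bar> \<le> 1 / real (Suc m) * C"
    and int: "integrable M (total_cost l \<Phi> N X us)"
  shows "integrable M (perturbed_cost h (1 / real (Suc m)))"
    and "integrable M (cost_variation h)"
    and "(\<lambda>m. (expectation (perturbed_cost h (1 / real (Suc m))) - expectation (total_cost l \<Phi> N X us)) * real (Suc m))
      \<longlonglongrightarrow> expectation (cost_variation h)"
proof -
  have meas: "perturbed_cost h (1 / real (Suc m)) \<in> borel_measurable M" for m
    by (rule total_cost_measurable) (intro borel_measurable_add borel_measurable_times borel_measurable_const u_adapted h_adapted)
  note [measurable] = meas borel_measurable_integrable[OF int]
  have "K \<ge> 0"
  proof -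
    obtain \<omega> where "\<omega> \<in> space M" using not_empty by blast
    then show ?thesis using h[of 0 \<omega>] N by force
  qed
  have le: "\<bar>perturbed_cost h (1 / real (Suc m)) \<omega> - total_cost l \<Phi> N X us \<omega>\<bar> \<le> 1 / real (Suc m) * cost_gap K C \<omega>"
    if "\<omega> \<in> space M" for m \<omega>
    by (rule perturbed_cost_gap) (use h C that in auto)
  define quot where "quot m \<omega> = (perturbed_cost h (1 / real (Suc m)) \<omega> - total_cost l \<Phi> N X us \<omega>) * real (Suc m)" for m \<omega>
  have [measurable]: "quot m \<in> borel_measurable M" for m unfolding quot_def[abs_def] by measurable
  have quot: "\<bar>quot m \<omega>\<bar> \<le> cost_gap K C \<omega>" if "\<omega> \<in> space M" for m \<omega>
    using mult_right_mono[OF le[OF that, of m], of "real (Suc m)"]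
    by (simp add: quot_def abs_mult del: of_nat_Suc)
  have lim: "(\<lambda>m. quot m \<omega>) \<longlonglongrightarrow> cost_variation h \<omega>" if "\<omega> \<in> space M" for \<omega>
    using DERIV_sequentially[OF cost_has_derivative[OF that, of h]] by (simp add: quot_def)
  have cv [measurable]: "cost_variation h \<in> borel_measurable M"
    by (rule borel_measurable_LIMSEQ_real[OF lim]) auto
  note dom = integrable_dominated_convergence[OF cv _ cost_gap_integrable[of K C], of quot]
    integral_dominated_convergence[OF cv _ cost_gap_integrable[of K C], of quot]
  show "integrable M (cost_variation h)" using dom(1) lim quot by auto
  have iq: "integrable M (quot m)" for m
    by (rule Bochner_Integration.integrable_bound[OF cost_gap_integrable[of K C]])
       (use quot in \<open>auto intro!: AE_I2 intro: order_trans[OF _ abs_ge_self]\<close>)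
  have eq: "perturbed_cost h (1 / real (Suc m)) = (\<lambda>\<omega>. total_cost l \<Phi> N X us \<omega> + quot m \<omega> / real (Suc m))" for m
    by (simp add: quot_def fun_eq_iff)
  show i: "integrable M (perturbed_cost h (1 / real (Suc m)))" for m unfolding eq using int iq by simp
  have "expectation (quot m) = (expectation (perturbed_cost h (1 / real (Suc m))) - expectation (total_cost l \<Phi> N X us)) * real (Suc m)" for m
    unfolding quot_def[abs_def] using i[of m] int by simp
  moreover have "(\<lambda>m. expectation (quot m)) \<longlonglongrightarrow> expectation (cost_variation h)"
    using dom(2) lim quot by auto
  ultimately show "(\<lambda>m. (expectation (perturbed_cost h (1 / real (Suc m))) - expectation (total_cost l \<Phi> N X us)) * real (Suc m))
      \<longlonglongrightarrow> expectation (cost_variation h)" by simp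
qed

end

section \<open>Duality\<close>

context controlled_system
begin

text \<open>
  The right-hand side of the backward equation at time \<open>k\<close>.  The value at \<open>N\<close> combines the terminal
  condition with the convention that the coefficients vanish there.
\<close>

definition adjoint_source :: "(nat \<Rightarrow> 'w \<Rightarrow> real) \<Rightarrow> (nat \<Rightarrow> 'w \<Rightarrow> real) \<Rightarrow> nat \<Rightarrow> 'w \<Rightarrow> real" where
  "adjoint_source p q k \<omega> = (if k = N then deriv \<Phi> (X N \<omega>)
     else p k \<omega> + bx k \<omega> * p k \<omega> + d k * sx k \<omega> * q k \<omega> + lx k \<omega> + sx k \<omega> * p k \<omega> * \<xi> k \<omega>)"

text \<open>
  The bracket of the maximum principle: the derivative in the control of the Hamiltonian, with the
  noise replaced by its predictable part.
\<close>

definition hamiltonian_u :: "(nat \<Rightarrow> 'w \<Rightarrow> real) \<Rightarrow> (nat \<Rightarrow> 'w \<Rightarrow> real) \<Rightarrow> nat \<Rightarrow> 'w \<Rightarrow> real" where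
  "hamiltonian_u p q k \<omega> = bu k \<omega> * p k \<omega> + su k \<omega> * p k \<omega> * \<kappa> k \<omega> + d k * su k \<omega> * q k \<omega> + lu k \<omega>"

text \<open>
  By the backward equation the left-hand side pairs \<open>Z\<^sub>k\<^sub>+\<^sub>1\<close> with \<open>p\<^sub>k + q\<^sub>k \<eta>\<^sub>k\<close>.  Write
  \<open>Z\<^sub>k\<^sub>+\<^sub>1 = A + S \<xi>\<^sub>k\<close> with \<open>A\<close> and \<open>S\<close> known at time \<open>k\<close>: the product \<open>A q\<^sub>k \<eta>\<^sub>k\<close> has mean zero and
  \<open>S q\<^sub>k \<xi>\<^sub>k \<eta>\<^sub>k\<close> has the mean of \<open>d\<^sub>k S q\<^sub>k\<close>.  The terms linear in \<open>Z\<^sub>k\<close> then recombine to the source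
  at time \<open>k\<close> except for \<open>l\<^sub>x\<close>, and the terms linear in \<open>h\<^sub>k\<close> to the Hamiltonian derivative.
\<close>

lemma duality_step:
  assumes h_adapted: "\<And>k. k < N \<Longrightarrow> h k \<in> borel_measurable (F k)"
    and h: "\<And>k \<omega>. k < N \<Longrightarrow> \<omega> \<in> space M \<Longrightarrow> \<bar>h k \<omega>\<bar> \<le> K"
    and k: "k < N"
    and p: "p k \<in> borel_measurable (F k)" "almost_Lp M 2 (p k)"
    and q: "q k \<in> borel_measurable (F k)" "almost_Lp M 2 (q k)"
    and adj: "AE \<omega> in M. p k \<omega> + q k \<omega> * \<eta> k \<omega> = adjoint_source p q (Suc k) \<omega>"
    and adj_measurable: "adjoint_source p q (Suc k) \<in> borel_measurable M"
  shows "integrable M (\<lambda>\<omega>. h k \<omega> * (hamiltonian_u p q k \<omega> - lu k \<omega>))"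
    and "expectation (\<lambda>\<omega>. variation h (Suc k) \<omega> * adjoint_source p q (Suc k) \<omega>)
      = expectation (\<lambda>\<omega>. variation h k \<omega> * adjoint_source p q k \<omega>)
        - expectation (\<lambda>\<omega>. lx k \<omega> * variation h k \<omega>)
        + expectation (\<lambda>\<omega>. h k \<omega> * (hamiltonian_u p q k \<omega> - lu k \<omega>))"
proof -
  let ?Z = "variation h k"
  define A where "A \<omega> = ?Z \<omega> + bx k \<omega> * ?Z \<omega> + bu k \<omega> * h k \<omega>" for \<omega>
  define S where "S \<omega> = sx k \<omega> * ?Z \<omega> + su k \<omega> * h k \<omega>" for \<omega>
  have Z: "?Z \<in> borel_measurable (F k)" "all_moments M ?Z"
    using k by (intro variation_adapted variation_moments[OF h_adapted h] h_adapted; simp)+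
  have hk: "h k \<in> borel_measurable (F k)" "all_moments M (h k)"
    using h_adapted[OF k] adapted_measurable[OF h_adapted[OF k]] h[OF k]
    by (auto intro: bounded_all_moments)
  note mom = Z(2) hk(2) derivatives_moments[OF k]
  note adapted [measurable] = Z(1) hk(1) derivatives_adapted[OF k] p(1) q(1) predictable[of k]
  have A: "A \<in> borel_measurable (F k)" "all_moments M A"
    unfolding A_def[abs_def] by (measurable, intro all_moments_add all_moments_mult mom)
  have S: "S \<in> borel_measurable (F k)" "all_moments M S"
    unfolding S_def[abs_def] by (measurable, intro all_moments_add all_moments_mult mom)
  have Lp: "integrable M f" if "almost_Lp M 2 f" for f
    using that by (rule almost_Lp_integrable) simp
  have int: "integrable M (\<lambda>\<omega>. p k \<omega> * g \<omega>)" "integrable M (\<lambda>\<omega>. q k \<omega> * g \<omega>)"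
    if "all_moments M g" for g
    by (intro Lp almost_Lp_mult_all_moments that p q)+
  note orth = innovation_orthogonal[where n = k]
  have pS: "(\<lambda>\<omega>. p k \<omega> * S \<omega>) \<in> borel_measurable (F k)" "almost_Lp M 2 (\<lambda>\<omega>. p k \<omega> * S \<omega>)"
    "(\<lambda>\<omega>. q k \<omega> * S \<omega>) \<in> borel_measurable (F k)" "almost_Lp M 2 (\<lambda>\<omega>. q k \<omega> * S \<omega>)"
    "(\<lambda>\<omega>. q k \<omega> * A \<omega>) \<in> borel_measurable (F k)" "almost_Lp M 2 (\<lambda>\<omega>. q k \<omega> * A \<omega>)"
    using A(1) S(1) p(1) q(1) by (auto intro!: almost_Lp_mult_all_moments p q A S)
  let ?ph = "\<lambda>\<omega>. p k \<omega> * (su k \<omega> * h k \<omega>)"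
  have ph: "?ph \<in> borel_measurable (F k)" "almost_Lp M 2 ?ph"
    by (measurable, intro almost_Lp_mult_all_moments all_moments_mult p mom)
  have int6: "integrable M (\<lambda>\<omega>. p k \<omega> * (A \<omega> + S \<omega> * \<xi> k \<omega>))" "integrable M (\<lambda>\<omega>. q k \<omega> * A \<omega> * \<eta> k \<omega>)"
    "integrable M (\<lambda>\<omega>. q k \<omega> * S \<omega> * \<xi> k \<omega> * \<eta> k \<omega>)" "integrable M (\<lambda>\<omega>. q k \<omega> * S \<omega>)"
    by (intro int all_moments_add all_moments_mult A S noise_moments
        Lp almost_Lp_mult_all_moments innovation_moments q)+
  have ip: "integrable M (\<lambda>\<omega>. p k \<omega> * (?Z \<omega> + bx k \<omega> * ?Z \<omega> + sx k \<omega> * ?Z \<omega> * \<xi> k \<omega>))"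
    "integrable M (\<lambda>\<omega>. p k \<omega> * (bu k \<omega> * h k \<omega>))" "integrable M (\<lambda>\<omega>. ?ph \<omega> * \<xi> k \<omega>)"
    "integrable M (\<lambda>\<omega>. ?ph \<omega> * \<kappa> k \<omega>)"
    "integrable M (\<lambda>\<omega>. q k \<omega> * (sx k \<omega> * ?Z \<omega>))" "integrable M (\<lambda>\<omega>. q k \<omega> * (su k \<omega> * h k \<omega>))"
    by (intro int all_moments_add all_moments_mult mom noise_moments predictable_moments
        Lp almost_Lp_mult_all_moments p)+
  have il: "integrable M (\<lambda>\<omega>. lx k \<omega> * ?Z \<omega>)"
    by (rule almost_Lp_integrable[of r]) (use r k in \<open>auto intro!: running_gradient_moment Z\<close>)
  have ham: "h k \<omega> * (hamiltonian_u p q k \<omega> - lu k \<omega>)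
      = p k \<omega> * (bu k \<omega> * h k \<omega>) + ?ph \<omega> * \<kappa> k \<omega> + d k * (q k \<omega> * (su k \<omega> * h k \<omega>))" for \<omega>
    by (simp add: hamiltonian_u_def algebra_simps)
  show "integrable M (\<lambda>\<omega>. h k \<omega> * (hamiltonian_u p q k \<omega> - lu k \<omega>))"
    unfolding ham using ip by simp
  have "expectation (\<lambda>\<omega>. variation h (Suc k) \<omega> * adjoint_source p q (Suc k) \<omega>)
      = expectation (\<lambda>\<omega>. variation h (Suc k) \<omega> * (p k \<omega> + q k \<omega> * \<eta> k \<omega>))"
  proof (rule integral_cong_AE)
    have [measurable]: "p k \<in> borel_measurable M" "q k \<in> borel_measurable M" "\<eta> k \<in> borel_measurable M"
      "variation h (Suc k) \<in> borel_measurable M"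
      by (rule adapted_measurable[OF p(1)] adapted_measurable[OF q(1)]
          all_moments_measurable[OF innovation_moments]
          adapted_measurable[OF variation_adapted[OF h_adapted Suc_leI[OF k]]]; assumption)+
    show "(\<lambda>\<omega>. variation h (Suc k) \<omega> * (p k \<omega> + q k \<omega> * \<eta> k \<omega>)) \<in> borel_measurable M" by measurable
    show "(\<lambda>\<omega>. variation h (Suc k) \<omega> * adjoint_source p q (Suc k) \<omega>) \<in> borel_measurable M"
      using adj_measurable by measurable
    show "AE \<omega> in M. variation h (Suc k) \<omega> * adjoint_source p q (Suc k) \<omega>
        = variation h (Suc k) \<omega> * (p k \<omega> + q k \<omega> * \<eta> k \<omega>)" using adj by eventually_elim simp
  qed
  also have "\<dots> = expectation (\<lambda>\<omega>. p k \<omega> * (A \<omega> + S \<omega> * \<xi> k \<omega>) + q k \<omega> * A \<omega> * \<eta> k \<omega>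
      + q k \<omega> * S \<omega> * \<xi> k \<omega> * \<eta> k \<omega>)"
    by (simp add: A_def S_def algebra_simps)
  also have "\<dots> = expectation (\<lambda>\<omega>. p k \<omega> * (A \<omega> + S \<omega> * \<xi> k \<omega>)) + d k * expectation (\<lambda>\<omega>. q k \<omega> * S \<omega>)"
    using int6 orth(1)[OF pS(5,6)] orth(3)[OF pS(3,4)] by simp
  also have "expectation (\<lambda>\<omega>. p k \<omega> * (A \<omega> + S \<omega> * \<xi> k \<omega>))
      = expectation (\<lambda>\<omega>. p k \<omega> * (?Z \<omega> + bx k \<omega> * ?Z \<omega> + sx k \<omega> * ?Z \<omega> * \<xi> k \<omega>)
        + p k \<omega> * (bu k \<omega> * h k \<omega>) + ?ph \<omega> * \<xi> k \<omega>)"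
    by (simp add: A_def S_def algebra_simps)
  also have "\<dots> = expectation (\<lambda>\<omega>. p k \<omega> * (?Z \<omega> + bx k \<omega> * ?Z \<omega> + sx k \<omega> * ?Z \<omega> * \<xi> k \<omega>))
      + expectation (\<lambda>\<omega>. p k \<omega> * (bu k \<omega> * h k \<omega>)) + expectation (\<lambda>\<omega>. ?ph \<omega> * \<kappa> k \<omega>)"
    using ip orth(2)[OF ph] by simp
  also have "expectation (\<lambda>\<omega>. q k \<omega> * S \<omega>)
      = expectation (\<lambda>\<omega>. q k \<omega> * (sx k \<omega> * ?Z \<omega>) + q k \<omega> * (su k \<omega> * h k \<omega>))"
    by (simp add: S_def algebra_simps)
  also have "\<dots> = expectation (\<lambda>\<omega>. q k \<omega> * (sx k \<omega> * ?Z \<omega>)) + expectation (\<lambda>\<omega>. q k \<omega> * (su k \<omega> * h k \<omega>))"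
    using ip by simp
  finally have lhs: "expectation (\<lambda>\<omega>. variation h (Suc k) \<omega> * adjoint_source p q (Suc k) \<omega>) =
      expectation (\<lambda>\<omega>. p k \<omega> * (?Z \<omega> + bx k \<omega> * ?Z \<omega> + sx k \<omega> * ?Z \<omega> * \<xi> k \<omega>))
      + expectation (\<lambda>\<omega>. p k \<omega> * (bu k \<omega> * h k \<omega>)) + expectation (\<lambda>\<omega>. ?ph \<omega> * \<kappa> k \<omega>)
      + d k * (expectation (\<lambda>\<omega>. q k \<omega> * (sx k \<omega> * ?Z \<omega>)) + expectation (\<lambda>\<omega>. q k \<omega> * (su k \<omega> * h k \<omega>)))" .
  have "expectation (\<lambda>\<omega>. ?Z \<omega> * adjoint_source p q k \<omega>)
      = expectation (\<lambda>\<omega>. p k \<omega> * (?Z \<omega> + bx k \<omega> * ?Z \<omega> + sx k \<omega> * ?Z \<omega> * \<xi> k \<omega>)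
        + d k * (q k \<omega> * (sx k \<omega> * ?Z \<omega>)) + lx k \<omega> * ?Z \<omega>)"
    using k by (simp add: adjoint_source_def algebra_simps)
  also have "\<dots> = expectation (\<lambda>\<omega>. p k \<omega> * (?Z \<omega> + bx k \<omega> * ?Z \<omega> + sx k \<omega> * ?Z \<omega> * \<xi> k \<omega>))
      + d k * expectation (\<lambda>\<omega>. q k \<omega> * (sx k \<omega> * ?Z \<omega>)) + expectation (\<lambda>\<omega>. lx k \<omega> * ?Z \<omega>)"
    using ip il by simp
  finally have rhs: "expectation (\<lambda>\<omega>. ?Z \<omega> * adjoint_source p q k \<omega>) =
      expectation (\<lambda>\<omega>. p k \<omega> * (?Z \<omega> + bx k \<omega> * ?Z \<omega> + sx k \<omega> * ?Z \<omega> * \<xi> k \<omega>))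
      + d k * expectation (\<lambda>\<omega>. q k \<omega> * (sx k \<omega> * ?Z \<omega>)) + expectation (\<lambda>\<omega>. lx k \<omega> * ?Z \<omega>)" .
  have "expectation (\<lambda>\<omega>. h k \<omega> * (hamiltonian_u p q k \<omega> - lu k \<omega>)) =
      expectation (\<lambda>\<omega>. p k \<omega> * (bu k \<omega> * h k \<omega>)) + expectation (\<lambda>\<omega>. ?ph \<omega> * \<kappa> k \<omega>)
      + d k * expectation (\<lambda>\<omega>. q k \<omega> * (su k \<omega> * h k \<omega>))"
    unfolding ham using ip by simp
  with lhs rhs show "expectation (\<lambda>\<omega>. variation h (Suc k) \<omega> * adjoint_source p q (Suc k) \<omega>)
      = expectation (\<lambda>\<omega>. ?Z \<omega> * adjoint_source p q k \<omega>) - expectation (\<lambda>\<omega>. lx k \<omega> * ?Z \<omega>)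
        + expectation (\<lambda>\<omega>. h k \<omega> * (hamiltonian_u p q k \<omega> - lu k \<omega>))"
    by (simp add: distrib_left)
qed

text \<open>
  The steps telescope from \<open>Z\<^sub>0 = 0\<close> to the terminal condition, and the terms \<open>l\<^sub>x Z\<^sub>k\<close> that they leave
  behind cancel those in the variation of the cost.
\<close>

lemma duality:
  assumes h_adapted: "\<And>k. k < N \<Longrightarrow> h k \<in> borel_measurable (F k)"
    and h: "\<And>k \<omega>. k < N \<Longrightarrow> \<omega> \<in> space M \<Longrightarrow> \<bar>h k \<omega>\<bar> \<le> K"
    and lu: "\<And>k. k < N \<Longrightarrow> integrable M (\<lambda>\<omega>. lu k \<omega> * h k \<omega>)"
    and p: "\<And>k. k < N \<Longrightarrow> p k \<in> borel_measurable (F k)" "\<And>k. k < N \<Longrightarrow> almost_Lp M 2 (p k)"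
    and q: "\<And>k. k < N \<Longrightarrow> q k \<in> borel_measurable (F k)" "\<And>k. k < N \<Longrightarrow> almost_Lp M 2 (q k)"
    and adj: "\<And>k. k < N \<Longrightarrow> AE \<omega> in M. p k \<omega> + q k \<omega> * \<eta> k \<omega> = adjoint_source p q (Suc k) \<omega>"
  shows "\<And>k. k < N \<Longrightarrow> integrable M (\<lambda>\<omega>. h k \<omega> * hamiltonian_u p q k \<omega>)"
    and "expectation (cost_variation h) = (\<Sum>k<N. expectation (\<lambda>\<omega>. h k \<omega> * hamiltonian_u p q k \<omega>))"
proof -
  have adj_measurable: "adjoint_source p q k \<in> borel_measurable M" if "k \<le> N" for k
  proof (cases "k = N")
    case True
    then show ?thesis using almost_Lp_measurable[OF terminal_gradient_moment]
      by (simp add: adjoint_source_def[abs_def])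
  next
    case False
    with that have k: "k < N" by simp
    note [measurable] = derivatives_adapted[OF k, THEN adapted_measurable] all_moments_measurable[OF noise_moments]
      p(1)[OF k, THEN adapted_measurable] q(1)[OF k, THEN adapted_measurable]
    show ?thesis using False by (simp add: adjoint_source_def[abs_def])
  qed
  note step = duality_step[of h, OF h_adapted h _ p q adj adj_measurable]
  have i1: "integrable M (\<lambda>\<omega>. h k \<omega> * (hamiltonian_u p q k \<omega> - lu k \<omega>))" if "k < N" for k
    by (rule step(1)) (use that in auto)
  have split: "(\<lambda>\<omega>. h k \<omega> * hamiltonian_u p q k \<omega>)
      = (\<lambda>\<omega>. h k \<omega> * (hamiltonian_u p q k \<omega> - lu k \<omega>) + lu k \<omega> * h k \<omega>)" for k
    by (simp add: fun_eq_iff algebra_simps)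
  show ih: "integrable M (\<lambda>\<omega>. h k \<omega> * hamiltonian_u p q k \<omega>)" if "k < N" for k
    unfolding split using i1[OF that] lu[OF that] by simp
  have Z: "all_moments M (variation h k)" if "k \<le> N" for k
    by (rule variation_moments[OF h_adapted h that])
  have ilx: "integrable M (\<lambda>\<omega>. lx k \<omega> * variation h k \<omega>)" if "k < N" for k
    by (rule almost_Lp_integrable[of r]) (use r that in \<open>auto intro!: running_gradient_moment Z\<close>)
  have i\<Phi>: "integrable M (\<lambda>\<omega>. deriv \<Phi> (X N \<omega>) * variation h N \<omega>)"
    by (rule almost_Lp_integrable[of r]) (use r in \<open>auto intro!: terminal_gradient_moment Z\<close>)
  have telescope: "expectation (\<lambda>\<omega>. variation h k \<omega> * adjoint_source p q k \<omega>)
      = (\<Sum>j<k. expectation (\<lambda>\<omega>. h j \<omega> * (hamiltonian_u p q j \<omega> - lu j \<omega>))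
          - expectation (\<lambda>\<omega>. lx j \<omega> * variation h j \<omega>))" if "k \<le> N" for k
    using that
  proof (induction k)
    case (Suc k)
    then show ?case using step(2)[of k] by simp
  qed simp
  have "expectation (cost_variation h) = (\<Sum>k<N. expectation (\<lambda>\<omega>. lx k \<omega> * variation h k \<omega>)
      + expectation (\<lambda>\<omega>. lu k \<omega> * h k \<omega>)) + expectation (\<lambda>\<omega>. deriv \<Phi> (X N \<omega>) * variation h N \<omega>)"
  proof -
    have i: "integrable M (\<lambda>\<omega>. lx k \<omega> * variation h k \<omega> + lu k \<omega> * h k \<omega>)" if "k < N" for k
      using ilx[OF that] lu[OF that] by simp
    have "expectation (cost_variation h)
        = expectation (\<lambda>\<omega>. \<Sum>k<N. lx k \<omega> * variation h k \<omega> + lu k \<omega> * h k \<omega>)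
          + expectation (\<lambda>\<omega>. deriv \<Phi> (X N \<omega>) * variation h N \<omega>)"
      unfolding cost_variation_def[abs_def]
      by (intro Bochner_Integration.integral_add Bochner_Integration.integrable_sum i i\<Phi>) simp
    also have "expectation (\<lambda>\<omega>. \<Sum>k<N. lx k \<omega> * variation h k \<omega> + lu k \<omega> * h k \<omega>)
        = (\<Sum>k<N. expectation (\<lambda>\<omega>. lx k \<omega> * variation h k \<omega> + lu k \<omega> * h k \<omega>))"
      by (intro Bochner_Integration.integral_sum i) simp
    also have "\<dots> = (\<Sum>k<N. expectation (\<lambda>\<omega>. lx k \<omega> * variation h k \<omega>) + expectation (\<lambda>\<omega>. lu k \<omega> * h k \<omega>))"
      by (intro sum.cong refl Bochner_Integration.integral_add ilx lu) simp_all
    finally show ?thesis .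
  qed
  also have "expectation (\<lambda>\<omega>. deriv \<Phi> (X N \<omega>) * variation h N \<omega>)
      = expectation (\<lambda>\<omega>. variation h N \<omega> * adjoint_source p q N \<omega>)"
    by (simp add: adjoint_source_def mult.commute)
  also note telescope[OF order_refl]
  also have "(\<Sum>k<N. expectation (\<lambda>\<omega>. lx k \<omega> * variation h k \<omega>) + expectation (\<lambda>\<omega>. lu k \<omega> * h k \<omega>))
      + (\<Sum>k<N. expectation (\<lambda>\<omega>. h k \<omega> * (hamiltonian_u p q k \<omega> - lu k \<omega>))
          - expectation (\<lambda>\<omega>. lx k \<omega> * variation h k \<omega>))
      = (\<Sum>k<N. expectation (\<lambda>\<omega>. h k \<omega> * (hamiltonian_u p q k \<omega> - lu k \<omega>)) + expectation (\<lambda>\<omega>. lu k \<omega> * h k \<omega>))"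
    by (simp add: sum.distrib sum_subtractf)
  also have "\<dots> = (\<Sum>k<N. expectation (\<lambda>\<omega>. h k \<omega> * hamiltonian_u p q k \<omega>))"
    unfolding split by (intro sum.cong refl) (simp add: i1 lu)
  finally show "expectation (cost_variation h) = (\<Sum>k<N. expectation (\<lambda>\<omega>. h k \<omega> * hamiltonian_u p q k \<omega>))" .
qed

end

section \<open>Costs with values in the extended reals\<close>

text \<open>
  In the extended reals \<open>\<infinity> - \<infinity> = \<infinity>\<close>, so a finite difference of two nonnegative values has both of
  them finite.
\<close>

lemma integrable_of_ext_expectation:
  assumes "Y \<in> borel_measurable M" "\<bar>ext_expectation M Y\<bar> \<noteq> \<infinity>"
  shows "integrable M Y"
proof -
  let ?A = "\<integral>\<^sup>+\<omega>. ennreal (Y \<omega>) \<partial>M" and ?B = "\<integral>\<^sup>+\<omega>. ennreal (- Y \<omega>) \<partial>M"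
  have "?A \<noteq> \<infinity>"
  proof
    assume "?A = \<infinity>"
    then have "enn2ereal ?A = \<infinity>" by (simp add: enn2ereal_eq_top_iff)
    then have "ext_expectation M Y = \<infinity>" unfolding ext_expectation_def by simp
    with assms(2) show False by simp
  qed
  moreover have "?B \<noteq> \<infinity>"
  proof
    assume "?B = \<infinity>"
    then have B: "enn2ereal ?B = \<infinity>" by (simp add: enn2ereal_eq_top_iff)
    have "ext_expectation M Y = - \<infinity> \<or> ext_expectation M Y = \<infinity>"
      unfolding ext_expectation_def B by (cases "enn2ereal ?A") auto
    with assms(2) show False by auto
  qed
  ultimately show ?thesis using assms(1) by (simp add: real_integrable_def)
qed

lemma ext_expectation_integrable:
  assumes "integrable M Y"
  shows "ext_expectation M Y = ereal (\<integral>\<omega>. Y \<omega> \<partial>M)"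
proof -
  let ?A = "\<integral>\<^sup>+\<omega>. ennreal (Y \<omega>) \<partial>M" and ?B = "\<integral>\<^sup>+\<omega>. ennreal (- Y \<omega>) \<partial>M"
  have "?A \<noteq> \<infinity>" "?B \<noteq> \<infinity>" using assms by (auto simp: real_integrable_def)
  then have "enn2ereal ?A = ereal (enn2real ?A)" "enn2ereal ?B = ereal (enn2real ?B)"
    by (cases ?A, auto, cases ?B, auto)
  then show ?thesis
    unfolding ext_expectation_def real_lebesgue_integral_def[OF assms] by simp
qed

lemma in_Lp_process_nth:
  assumes "in_Lp_process M F r n1 n2 Y" "n1 \<le> n" "n \<le> n2" and sub: "subalgebra M (F n)"
  shows "Y n \<in> borel_measurable (F n)" and "integrable M (\<lambda>\<omega>. \<bar>Y n \<omega>\<bar> powr r)"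
proof -
  have n: "n \<in> {n1..n2}" using assms by simp
  then show Y: "Y n \<in> borel_measurable (F n)" using assms(1) unfolding in_Lp_process_def by blast
  then have [measurable]: "Y n \<in> borel_measurable M" by (rule measurable_from_subalg[OF sub])
  have "(\<Sum>n=n1..n2. \<integral>\<^sup>+\<omega>. ennreal (\<bar>Y n \<omega>\<bar> powr r) \<partial>M) < \<infinity>"
    using assms(1) unfolding in_Lp_process_def by blast
  then have "(\<integral>\<^sup>+\<omega>. ennreal (\<bar>Y n \<omega>\<bar> powr r) \<partial>M) < \<infinity>"
    using n by (auto simp: ennreal_sum_less_top less_top)
  then show "integrable M (\<lambda>\<omega>. \<bar>Y n \<omega>\<bar> powr r)" by (intro integrableI_nonneg) auto
qed

lemma admissibleD:
  assumes u: "u \<in> admissible M F a N U" and "n < N" and sub: "subalgebra M (F n)"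
  shows "u n \<in> borel_measurable (F n)" and "integrable M (\<lambda>\<omega>. \<bar>u n \<omega>\<bar> powr (2*a))"
    and "\<And>\<omega>. \<omega> \<in> space M \<Longrightarrow> u n \<omega> \<in> U"
proof -
  show un: "u n \<in> borel_measurable (F n)" and "\<And>\<omega>. \<omega> \<in> space M \<Longrightarrow> u n \<omega> \<in> U"
    using u \<open>n < N\<close> by (auto simp: admissible_def)
  have [measurable]: "u n \<in> borel_measurable M" by (rule measurable_from_subalg[OF sub un])
  have "(\<integral>\<^sup>+\<omega>. ennreal (\<bar>u n \<omega>\<bar> powr (2*a)) \<partial>M) \<le> (\<integral>\<^sup>+\<omega>. (\<Sum>n<N. ennreal (\<bar>u n \<omega>\<bar> powr (2*a))) \<partial>M)"
    using \<open>n < N\<close> by (intro nn_integral_mono member_le_sum) auto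
  also have "\<dots> < \<infinity>" using u by (simp add: admissible_def)
  finally show "integrable M (\<lambda>\<omega>. \<bar>u n \<omega>\<bar> powr (2*a))" by (intro integrableI_nonneg) auto
qed

lemma admissibleI:
  assumes "\<And>n. n < N \<Longrightarrow> u n \<in> borel_measurable (F n)"
    and "\<And>n \<omega>. n < N \<Longrightarrow> \<omega> \<in> space M \<Longrightarrow> u n \<omega> \<in> U"
    and "\<And>n. n < N \<Longrightarrow> integrable M (\<lambda>\<omega>. \<bar>u n \<omega>\<bar> powr (2*a))"
  shows "u \<in> admissible M F a N U"
proof -
  have "(\<integral>\<^sup>+\<omega>. (\<Sum>n<N. ennreal (\<bar>u n \<omega>\<bar> powr (2*a))) \<partial>M) = (\<integral>\<^sup>+\<omega>. ennreal (\<Sum>n<N. \<bar>u n \<omega>\<bar> powr (2*a)) \<partial>M)"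
    by simp
  also have "\<dots> < \<infinity>"
  proof -
    have "integrable M (\<lambda>\<omega>. \<Sum>n<N. \<bar>u n \<omega>\<bar> powr (2*a))"
      by (intro Bochner_Integration.integrable_sum assms(3)) simp
    then show ?thesis by (subst nn_integral_eq_integral) (auto intro!: AE_I2 sum_nonneg)
  qed
  finally show ?thesis using assms by (simp add: admissible_def)
qed

text \<open>
  Keeps the moment condition for admissible controls under bounded perturbations.
\<close>

lemma (in finite_measure) bounded_shift_integrable_powr:
  fixes u h :: "'a \<Rightarrow> real"
  assumes u: "integrable M (\<lambda>\<omega>. \<bar>u \<omega>\<bar> powr r)" and [measurable]: "u \<in> borel_measurable M" "h \<in> borel_measurable M"
    and h: "\<And>\<omega>. \<omega> \<in> space M \<Longrightarrow> \<bar>h \<omega>\<bar> \<le> K" and r: "r > 0"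
  shows "integrable M (\<lambda>\<omega>. \<bar>u \<omega> + h \<omega>\<bar> powr r)"
proof -
  have "integrable M (\<lambda>\<omega>. 2 powr r * (\<bar>u \<omega>\<bar> powr r + \<bar>K\<bar> powr r))" using u by simp
  then show ?thesis
  proof (rule Bochner_Integration.integrable_bound)
    show "AE \<omega> in M. norm (\<bar>u \<omega> + h \<omega>\<bar> powr r) \<le> norm (2 powr r * (\<bar>u \<omega>\<bar> powr r + \<bar>K\<bar> powr r))"
    proof (rule AE_I2)
      fix \<omega> assume "\<omega> \<in> space M"
      then have "\<bar>u \<omega> + h \<omega>\<bar> powr r \<le> (\<bar>u \<omega>\<bar> + \<bar>K\<bar>) powr r"
        using r by (intro powr_mono2) (use h in force)+
      also have "\<dots> \<le> 2 powr r * (\<bar>u \<omega>\<bar> powr r + \<bar>K\<bar> powr r)" using r by (intro powr_add_le) auto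
      finally show "norm (\<bar>u \<omega> + h \<omega>\<bar> powr r) \<le> norm (2 powr r * (\<bar>u \<omega>\<bar> powr r + \<bar>K\<bar> powr r))" by simp
    qed
  qed measurable
qed

section \<open>The maximum principle\<close>

context controlled_system
begin

lemma running_cost_quotient:
  assumes "n < N"
  shows "(\<lambda>m. (l n (X n \<omega>) (us n \<omega> + 1 / real (Suc m) * w) - l n (X n \<omega>) (us n \<omega>)) * real (Suc m))
    \<longlonglongrightarrow> lu n \<omega> * w"
proof -
  have "((\<lambda>\<epsilon>. us n \<omega> + \<epsilon> * w) has_real_derivative w) (at 0)" by (auto intro!: derivative_eq_intros)
  from chain_rule_xu[OF l_smooth[OF assms] DERIV_const this, of "X n \<omega>"]
  have "((\<lambda>\<epsilon>. l n (X n \<omega>) (us n \<omega> + \<epsilon> * w)) has_real_derivative lu n \<omega> * w) (at 0)"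
    by (simp add: lu_def)
  from DERIV_sequentially[OF this] show ?thesis by simp
qed

lemma variational_inequality:
  assumes h_adapted: "\<And>k. k < N \<Longrightarrow> h k \<in> borel_measurable (F k)"
    and h: "\<And>k \<omega>. k < N \<Longrightarrow> \<omega> \<in> space M \<Longrightarrow> \<bar>h k \<omega>\<bar> \<le> K"
    and C: "\<And>k \<omega> m. k < N \<Longrightarrow> \<omega> \<in> space M \<Longrightarrow>
      \<bar>l k (X k \<omega>) (us k \<omega> + 1 / real (Suc m) * h k \<omega>) - l k (X k \<omega>) (us k \<omega>)\<bar> \<le> 1 / real (Suc m) * C"
    and int: "integrable M (total_cost l \<Phi> N X us)"
    and opt: "\<And>m. integrable M (perturbed_cost h (1 / real (Suc m))) \<Longrightarrow>
      expectation (total_cost l \<Phi> N X us) \<le> expectation (perturbed_cost h (1 / real (Suc m)))"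
    and p: "\<And>k. k < N \<Longrightarrow> p k \<in> borel_measurable (F k)" "\<And>k. k < N \<Longrightarrow> almost_Lp M 2 (p k)"
    and q: "\<And>k. k < N \<Longrightarrow> q k \<in> borel_measurable (F k)" "\<And>k. k < N \<Longrightarrow> almost_Lp M 2 (q k)"
    and adj: "\<And>k. k < N \<Longrightarrow> AE \<omega> in M. p k \<omega> + q k \<omega> * \<eta> k \<omega> = adjoint_source p q (Suc k) \<omega>"
  shows "\<And>k. k < N \<Longrightarrow> integrable M (\<lambda>\<omega>. h k \<omega> * hamiltonian_u p q k \<omega>)"
    and "(\<Sum>k<N. expectation (\<lambda>\<omega>. h k \<omega> * hamiltonian_u p q k \<omega>)) \<ge> 0"
proof -
  have lu: "integrable M (\<lambda>\<omega>. lu k \<omega> * h k \<omega>)" if k: "k < N" for k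
  proof (rule integrable_const_bound[where B = C])
    note [measurable] = adapted_measurable[OF h_adapted[OF k]] adapted_measurable[OF derivatives_adapted(6)[OF k]]
    show "(\<lambda>\<omega>. lu k \<omega> * h k \<omega>) \<in> borel_measurable M" by measurable
    show "AE \<omega> in M. norm (lu k \<omega> * h k \<omega>) \<le> C"
    proof (rule AE_I2)
      fix \<omega> assume \<omega>: "\<omega> \<in> space M"
      have "\<bar>(l k (X k \<omega>) (us k \<omega> + 1 / real (Suc m) * h k \<omega>) - l k (X k \<omega>) (us k \<omega>)) * real (Suc m)\<bar> \<le> C" for m
        using mult_right_mono[OF C[OF k \<omega>, of m], of "real (Suc m)"] by (simp add: abs_mult del: of_nat_Suc)
      then have "\<bar>lu k \<omega> * h k \<omega>\<bar> \<le> C"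
        by (intro LIMSEQ_le_const2[OF tendsto_rabs[OF running_cost_quotient[OF k]]]) blast
      then show "norm (lu k \<omega> * h k \<omega>) \<le> C" by simp
    qed
  qed
  note first = first_variation[of h, OF h_adapted h C int]
  note dual = duality[of h, OF h_adapted h lu p q adj]
  show "integrable M (\<lambda>\<omega>. h k \<omega> * hamiltonian_u p q k \<omega>)" if "k < N" for k
    by (rule dual(1)) (use that in auto)
  have int': "integrable M (perturbed_cost h (1 / real (Suc m)))" for m by (rule first(1)) auto
  have "(\<lambda>m. (expectation (perturbed_cost h (1 / real (Suc m))) - expectation (total_cost l \<Phi> N X us)) * real (Suc m))
      \<longlonglongrightarrow> expectation (cost_variation h)" by (rule first(3)) auto
  moreover have "0 \<le> (expectation (perturbed_cost h (1 / real (Suc m))) - expectation (total_cost l \<Phi> N X us)) * real (Suc m)" for m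
    using opt[OF int', of m] by (intro mult_nonneg_nonneg) auto
  ultimately have "0 \<le> expectation (cost_variation h)" by (intro LIMSEQ_le_const) blast+
  moreover have "expectation (cost_variation h) = (\<Sum>k<N. expectation (\<lambda>\<omega>. h k \<omega> * hamiltonian_u p q k \<omega>))"
    by (rule dual(2)) auto
  ultimately show "(\<Sum>k<N. expectation (\<lambda>\<omega>. h k \<omega> * hamiltonian_u p q k \<omega>)) \<ge> 0" by simp
qed

text \<open>
  For each \<open>K\<close> the direction \<open>v - us n\<close>, restricted to the event \<open>bad K\<close>, is bounded and has bounded cost
  quotients, so the variational inequality applies; it says that a function which is negative on
  \<open>bad K\<close> and zero elsewhere has nonnegative integral.  The events \<open>bad K\<close> exhaust the event on which
  the claim fails, because a convergent sequence of quotients is bounded.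
\<close>

lemma maximum_principle:
  assumes U: "convex U" and us: "\<And>k \<omega>. k < N \<Longrightarrow> \<omega> \<in> space M \<Longrightarrow> us k \<omega> \<in> U"
    and int: "integrable M (total_cost l \<Phi> N X us)"
    and opt: "\<And>h K t. (\<And>k. k < N \<Longrightarrow> h k \<in> borel_measurable (F k)) \<Longrightarrow>
        (\<And>k \<omega>. k < N \<Longrightarrow> \<omega> \<in> space M \<Longrightarrow> \<bar>h k \<omega>\<bar> \<le> K) \<Longrightarrow> 0 \<le> t \<Longrightarrow>
        (\<And>k \<omega>. k < N \<Longrightarrow> \<omega> \<in> space M \<Longrightarrow> us k \<omega> + t * h k \<omega> \<in> U) \<Longrightarrow>
        integrable M (perturbed_cost h t) \<Longrightarrow>
        expectation (total_cost l \<Phi> N X us) \<le> expectation (perturbed_cost h t)"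
    and p: "\<And>k. k < N \<Longrightarrow> p k \<in> borel_measurable (F k)" "\<And>k. k < N \<Longrightarrow> almost_Lp M 2 (p k)"
    and q: "\<And>k. k < N \<Longrightarrow> q k \<in> borel_measurable (F k)" "\<And>k. k < N \<Longrightarrow> almost_Lp M 2 (q k)"
    and adj: "\<And>k. k < N \<Longrightarrow> AE \<omega> in M. p k \<omega> + q k \<omega> * \<eta> k \<omega> = adjoint_source p q (Suc k) \<omega>"
    and n: "n < N" and v: "v \<in> borel_measurable (F n)" "\<And>\<omega>. \<omega> \<in> space M \<Longrightarrow> v \<omega> \<in> U"
  shows "AE \<omega> in M. hamiltonian_u p q n \<omega> * (v \<omega> - us n \<omega>) \<ge> 0"
proof -
  define D where "D \<omega> = v \<omega> - us n \<omega>" for \<omega>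
  define step where "step m \<omega> = l n (X n \<omega>) (us n \<omega> + 1 / real (Suc m) * D \<omega>) - l n (X n \<omega>) (us n \<omega>)" for m \<omega>
  define bad where "bad K = {\<omega> \<in> space (F n). hamiltonian_u p q n \<omega> * D \<omega> < 0 \<and> \<bar>D \<omega>\<bar> \<le> real K \<and>
      (\<forall>m. \<bar>step m \<omega>\<bar> \<le> 1 / real (Suc m) * real K)}" for K :: nat
  note [measurable] = v(1) u_adapted[OF n] derivatives_adapted[OF n] p(1)[OF n] q(1)[OF n] predictable[of n]
  have D [measurable]: "D \<in> borel_measurable (F n)" unfolding D_def[abs_def] by measurable
  have [measurable]: "step m \<in> borel_measurable (F n)" for m
    unfolding step_def[abs_def] using n
    by (intro borel_measurable_diff coefficient_adapted state_adapted' u_adapted) (auto, measurable)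
  have [measurable]: "hamiltonian_u p q n \<in> borel_measurable (F n)"
    unfolding hamiltonian_u_def[abs_def] by measurable
  have bad [measurable]: "bad K \<in> sets (F n)" for K unfolding bad_def by measurable
  have null: "AE \<omega> in M. \<omega> \<notin> bad K" for K
  proof -
    define h where "h k \<omega> = (if k = n then indicator (bad K) \<omega> * D \<omega> else 0)" for k \<omega>
    have h_adapted: "h k \<in> borel_measurable (F k)" for k
      unfolding h_def[abs_def] by (cases "k = n") auto
    have h_bound: "\<bar>h k \<omega>\<bar> \<le> real K" for k \<omega>
      by (auto simp: h_def bad_def indicator_def)
    have quotient: "\<bar>l k (X k \<omega>) (us k \<omega> + 1 / real (Suc m) * h k \<omega>) - l k (X k \<omega>) (us k \<omega>)\<bar>
        \<le> 1 / real (Suc m) * real K" for k \<omega> m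
    proof (cases "k = n \<and> \<omega> \<in> bad K")
      case True
      then have "\<bar>step m \<omega>\<bar> \<le> 1 / real (Suc m) * real K" unfolding bad_def by blast
      with True show ?thesis by (simp add: h_def step_def)
    qed (auto simp: h_def)
    \<comment> \<open>On \<open>bad K\<close> the perturbed control is a convex combination of \<open>us n\<close> and \<open>v\<close>.\<close>
    have feasible: "us k \<omega> + 1 / real (Suc m) * h k \<omega> \<in> U" if "k < N" "\<omega> \<in> space M" for k \<omega> m
    proof (cases "k = n \<and> \<omega> \<in> bad K")
      case True
      have "(1 - 1 / real (Suc m)) *\<^sub>R us n \<omega> + (1 / real (Suc m)) *\<^sub>R v \<omega> \<in> U"
        by (rule convexD_alt[OF U us[OF n that(2)] v(2)[OF that(2)]]) auto
      also have "(1 - 1 / real (Suc m)) *\<^sub>R us n \<omega> + (1 / real (Suc m)) *\<^sub>R v \<omega>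
          = us k \<omega> + 1 / real (Suc m) * h k \<omega>"
        using True by (simp add: h_def D_def left_diff_distrib right_diff_distrib diff_divide_distrib del: of_nat_Suc)
      finally show ?thesis .
    qed (use us that in \<open>auto simp: h_def\<close>)
    note ineq = variational_inequality[of h, OF h_adapted h_bound quotient int
        opt[OF h_adapted h_bound _ feasible] p q adj]
    have ih: "integrable M (\<lambda>\<omega>. h n \<omega> * hamiltonian_u p q n \<omega>)" by (rule ineq(1)) (use n in auto)
    have "(\<Sum>k<N. expectation (\<lambda>\<omega>. h k \<omega> * hamiltonian_u p q k \<omega>))
        = (\<Sum>k\<in>{n}. expectation (\<lambda>\<omega>. h k \<omega> * hamiltonian_u p q k \<omega>))"
      by (rule sum.mono_neutral_right) (use n in \<open>auto simp: h_def\<close>)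
    moreover have "(\<Sum>k<N. expectation (\<lambda>\<omega>. h k \<omega> * hamiltonian_u p q k \<omega>)) \<ge> 0"
      by (rule ineq(2)) auto
    ultimately have "expectation (\<lambda>\<omega>. h n \<omega> * hamiltonian_u p q n \<omega>) \<ge> 0" by simp
    moreover have neg: "- (h n \<omega> * hamiltonian_u p q n \<omega>) \<ge> 0" for \<omega>
      by (auto simp: h_def bad_def indicator_def mult.commute)
    moreover have "expectation (\<lambda>\<omega>. - (h n \<omega> * hamiltonian_u p q n \<omega>)) \<ge> 0"
      by (rule integral_nonneg_AE) (use neg in auto)
    ultimately have "expectation (\<lambda>\<omega>. - (h n \<omega> * hamiltonian_u p q n \<omega>)) = 0" by simp
    then have "AE \<omega> in M. - (h n \<omega> * hamiltonian_u p q n \<omega>) = 0"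
      using integral_nonneg_eq_0_iff_AE[of M "\<lambda>\<omega>. - (h n \<omega> * hamiltonian_u p q n \<omega>)"] ih neg by auto
    then show ?thesis
    proof eventually_elim
      fix \<omega> assume zero: "- (h n \<omega> * hamiltonian_u p q n \<omega>) = 0"
      show "\<omega> \<notin> bad K"
      proof
        assume \<omega>: "\<omega> \<in> bad K"
        then have "h n \<omega> = D \<omega>" by (simp add: h_def)
        with zero have "hamiltonian_u p q n \<omega> * D \<omega> = 0" by auto
        moreover have "hamiltonian_u p q n \<omega> * D \<omega> < 0" using \<omega> unfolding bad_def by blast
        ultimately show False by linarith
      qed
    qed
  qed
  then have "AE \<omega> in M. \<forall>K. \<omega> \<notin> bad K" by (simp add: AE_all_countable)
  with AE_space show ?thesis
  proof eventually_elim
    fix \<omega> assume \<omega>: "\<omega> \<in> space M" and good: "\<forall>K. \<omega> \<notin> bad K"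
    show "hamiltonian_u p q n \<omega> * (v \<omega> - us n \<omega>) \<ge> 0"
    proof (rule ccontr)
      assume "\<not> hamiltonian_u p q n \<omega> * (v \<omega> - us n \<omega>) \<ge> 0"
      then have neg: "hamiltonian_u p q n \<omega> * D \<omega> < 0" by (simp add: D_def)
      have "Bseq (\<lambda>m. step m \<omega> * real (Suc m))"
        unfolding step_def by (rule convergent_imp_Bseq[OF convergentI[OF running_cost_quotient[OF n]]])
      then obtain K1 where K1: "\<And>m. \<bar>step m \<omega> * real (Suc m)\<bar> \<le> K1" unfolding Bseq_def by auto
      obtain K :: nat where K: "max \<bar>D \<omega>\<bar> K1 \<le> real K" using real_arch_simple by blast
      have "\<bar>step m \<omega>\<bar> \<le> 1 / real (Suc m) * real K" for m
      proof -
        have "\<bar>step m \<omega>\<bar> * real (Suc m) \<le> real K" using K1[of m] K by (simp add: abs_mult del: of_nat_Suc)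
        then show ?thesis by (simp add: pos_le_divide_eq del: of_nat_Suc)
      qed
      with \<omega> neg K have "\<omega> \<in> bad K" by (simp add: bad_def space_F)
      with good show False by blast
    qed
  qed
qed

end

theorem theorem2:
  fixes M F0 :: "'w measure"
    and F :: "nat \<Rightarrow> 'w measure"
    and H a L :: real
    and N :: nat
    and B :: "real \<Rightarrow> 'w \<Rightarrow> real"
    and \<xi> \<eta> :: "nat \<Rightarrow> 'w \<Rightarrow> real"
    and \<alpha> \<beta> c :: "nat \<Rightarrow> nat \<Rightarrow> real"
    and b \<sigma> :: "nat \<Rightarrow> 'w \<Rightarrow> real \<Rightarrow> real \<Rightarrow> real"
    and l :: "nat \<Rightarrow> real \<Rightarrow> real \<Rightarrow> real"
    and \<Phi> :: "real \<Rightarrow> real"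
    and x :: "'w \<Rightarrow> real"
    and U :: "real set"
    and J :: "(nat \<Rightarrow> 'w \<Rightarrow> real) \<Rightarrow> ereal"
    and us Xs p q :: "nat \<Rightarrow> 'w \<Rightarrow> real"
    and bx sx lx bu su lu :: "nat \<Rightarrow> 'w \<Rightarrow> real"
  assumes "prob_space M"
    and "0 < H" "H < 1" "a > 1" "N \<ge> 1" "L > 0"
    \<comment> \<open>noise, filtration, whitening\<close>
    and "fractional_brownian_motion M H B"
    and "\<xi> = fbm_increment B"
    and "subalgebra M F0"
    and "prob_space.indep_set M (sets F0) (process_sigma M \<xi>)"
    and "F = noise_filtration M F0 \<xi>"
    and "cholesky_array (noise_cov H) \<beta>"
    and "lower_triangular_inverse \<beta> \<alpha>"
    and "\<eta> = (\<lambda>n \<omega>. \<Sum>k\<le>n. \<alpha> n k * \<xi> k \<omega>)"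
    and "c = (\<lambda>n k. \<Sum>j<n. \<beta> n j * \<alpha> j k)"
    \<comment> \<open>data of the control problem\<close>
    and "in_Lp M F0 (2*a) x"
    and "prob_space.indep_set M (rv_sigma M x) (process_sigma M \<xi>)"
    and "closed U" "convex U"
    and "\<And>n. n < N \<Longrightarrow>
           (\<lambda>(\<omega>, y, v). b n \<omega> y v) \<in> borel_measurable (F n \<Otimes>\<^sub>M (borel \<Otimes>\<^sub>M borel))"
    and "\<And>n. n < N \<Longrightarrow>
           (\<lambda>(\<omega>, y, v). \<sigma> n \<omega> y v) \<in> borel_measurable (F n \<Otimes>\<^sub>M (borel \<Otimes>\<^sub>M borel))"
    and "\<And>n. n < N \<Longrightarrow> (\<lambda>(y, v). l n y v) \<in> borel_measurable (borel \<Otimes>\<^sub>M borel)"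
    and "\<Phi> \<in> borel_measurable borel"
    and "J = (\<lambda>u. cost M l \<Phi> N (state b \<sigma> \<xi> x u) u)"
    \<comment> \<open>(i)\<close>
    and "\<And>y v. in_Lp_process M F (2*a) 0 (N - 1) (\<lambda>n \<omega>. b n \<omega> y v)"
    and "\<And>y v. in_Lp_process M F (2*a) 0 (N - 1) (\<lambda>n \<omega>. \<sigma> n \<omega> y v)"
    \<comment> \<open>(ii)\<close>
    and "\<And>n \<omega>. n < N \<Longrightarrow> \<omega> \<in> space M \<Longrightarrow>
           differentiable_xu (b n \<omega>) \<and> differentiable_xu (\<sigma> n \<omega>)"
    and "\<And>n \<omega> \<phi>. n < N \<Longrightarrow> \<omega> \<in> space M \<Longrightarrow>
           \<phi> \<in> {b n \<omega>, \<sigma> n \<omega>, partial_x (b n \<omega>), partial_x (\<sigma> n \<omega>),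
                partial_u (b n \<omega>), partial_u (\<sigma> n \<omega>)} \<Longrightarrow> lipschitz_xu L \<phi>"
    \<comment> \<open>(iii)\<close>
    and "\<And>n. n < N \<Longrightarrow> differentiable_xu (l n)"
    and "\<And>y. \<Phi> differentiable (at y)"
    and "\<And>n y v. n < N \<Longrightarrow>
           \<bar>partial_x (l n) y v\<bar> + \<bar>deriv \<Phi> y\<bar> \<le> L * (1 + \<bar>y\<bar> + \<bar>v\<bar>)"
    \<comment> \<open>(iv)\<close>
    and "\<And>\<omega> y v. b N \<omega> y v = 0 \<and> \<sigma> N \<omega> y v = 0 \<and> l N y v = 0"
    \<comment> \<open>optimal pair and derivatives along it\<close>
    and "optimal_control (admissible M F a N U) J us"
    and "Xs = state b \<sigma> \<xi> x us"
    and "bx = (\<lambda>n \<omega>. partial_x (b n \<omega>) (Xs n \<omega>) (us n \<omega>))"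
    and "sx = (\<lambda>n \<omega>. partial_x (\<sigma> n \<omega>) (Xs n \<omega>) (us n \<omega>))"
    and "lx = (\<lambda>n \<omega>. partial_x (l n) (Xs n \<omega>) (us n \<omega>))"
    and "bu = (\<lambda>n \<omega>. partial_u (b n \<omega>) (Xs n \<omega>) (us n \<omega>))"
    and "su = (\<lambda>n \<omega>. partial_u (\<sigma> n \<omega>) (Xs n \<omega>) (us n \<omega>))"
    and "lu = (\<lambda>n \<omega>. partial_u (l n) (Xs n \<omega>) (us n \<omega>))"
    and "bsde_solution M F N \<beta> \<xi> \<eta> bx sx lx (\<lambda>\<omega>. deriv \<Phi> (Xs N \<omega>)) p q"
  shows "\<forall>n<N. \<forall>u\<in>admissible M F a N U. AE \<omega> in M.
           (bu n \<omega> * p n \<omega> + su n \<omega> * p n \<omega> * (\<Sum>k<n. c n k * \<xi> k \<omega>)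
             + \<beta> n n * su n \<omega> * q n \<omega> + lu n \<omega>) * (u n \<omega> - us n \<omega>) \<ge> 0"
proof -
  interpret prob_space M by fact
  define \<kappa> where "\<kappa> n \<omega> = (\<Sum>k<n. c n k * \<xi> k \<omega>)" for n \<omega>
  interpret innovation_noise M F \<xi> \<kappa> \<eta> "\<lambda>n. \<beta> n n"
    using fbm_innovation_noise[OF assms(7,9) assms(10)[unfolded assms(8)] assms(12,13)]
    unfolding assms(8,11,14,15) \<kappa>_def[abs_def] .
  have F0_F: "subalgebra (F 0) F0"
  proof -
    have "sets F0 \<subseteq> Pow (space M)" using assms(9) sets.space_closed[of F0] by (simp add: subalgebra_def)
    from sets_noise_filtration[OF this, of \<xi> 0] space_noise_filtration[OF this, of \<xi> 0]
    show ?thesis using assms(9) by (auto simp: assms(11) subalgebra_def)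
  qed
  have us: "us \<in> admissible M F a N U" using assms(33) by (simp add: optimal_control_def)
  note usD = admissibleD[OF us _ F_sub]
  have coefficient_moment: "almost_Lp M (2*a) (f n)"
    if "in_Lp_process M F (2*a) 0 (N - 1) f" "n < N" for f n
  proof (rule Lp_almost_Lp)
    have n: "n \<le> N - 1" using that by simp
    show "f n \<in> borel_measurable M"
      by (rule adapted_measurable[OF in_Lp_process_nth(1)[OF that(1) _ n F_sub]]) simp
    show "integrable M (\<lambda>\<omega>. \<bar>f n \<omega>\<bar> powr (2*a))" by (rule in_Lp_process_nth(2)[OF that(1) _ n F_sub]) simp
  qed
  have x_adapted: "x \<in> borel_measurable (F 0)"
    using assms(16) unfolding in_Lp_def by (blast intro: measurable_from_subalg[OF F0_F])
  have x_integrable: "integrable M (\<lambda>\<omega>. \<bar>x \<omega>\<bar> powr (2*a))"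
  proof (rule integrableI_nonneg)
    note [measurable] = adapted_measurable[OF x_adapted]
    show "(\<lambda>\<omega>. \<bar>x \<omega>\<bar> powr (2*a)) \<in> borel_measurable M" by measurable
    show "(\<integral>\<^sup>+\<omega>. ennreal (\<bar>x \<omega>\<bar> powr (2*a)) \<partial>M) < \<infinity>"
      using assms(16) unfolding in_Lp_def by (rule conjunct2)
  qed simp
  interpret sys: controlled_system M F \<xi> \<kappa> \<eta> "\<lambda>n. \<beta> n n" b \<sigma> l \<Phi> x us N "2*a" L
  proof unfold_locales
    show "2 * a > 2" "L \<ge> 0" "N \<ge> 1" using assms(4-6) by auto
    fix n assume n: "n < N"
    show "almost_Lp M (2*a) (\<lambda>\<omega>. b n \<omega> 0 0)" by (rule coefficient_moment[OF assms(25) n])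
    show "almost_Lp M (2*a) (\<lambda>\<omega>. \<sigma> n \<omega> 0 0)" by (rule coefficient_moment[OF assms(26) n])
    show "us n \<in> borel_measurable (F n)" by (rule usD[OF n])
    show "almost_Lp M (2*a) (us n)" by (intro Lp_almost_Lp adapted_measurable[OF usD(1)] usD(2) n)
    fix \<omega> assume \<omega>: "\<omega> \<in> space M"
    show "differentiable_xu (b n \<omega>) \<and> lipschitz_xu L (b n \<omega>)"
      "differentiable_xu (\<sigma> n \<omega>) \<and> lipschitz_xu L (\<sigma> n \<omega>)"
      using assms(27)[OF n \<omega>] assms(28)[OF n \<omega>] by auto
  next
    fix n y v assume "n < N"
    from assms(31)[OF this, of y v] show "\<bar>partial_x (l n) y v\<bar> \<le> L * (1 + \<bar>y\<bar> + \<bar>v\<bar>)" by linarith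
  next
    fix y
    from assms(31)[of 0 y 0] assms(5) show "\<bar>deriv \<Phi> y\<bar> \<le> L * (1 + \<bar>y\<bar>)" by simp
  next
    show "x \<in> borel_measurable (F 0)" by (rule x_adapted)
    show "almost_Lp M (2*a) x" by (rule Lp_almost_Lp[OF adapted_measurable[OF x_adapted] x_integrable])
  qed (rule assms(20-23,29,30); assumption)+
  have cost: "J u = ext_expectation M (total_cost l \<Phi> N (state b \<sigma> \<xi> x u) u)" for u
    by (simp add: assms(24) cost_def total_cost_def[abs_def])
  have int: "integrable M (total_cost l \<Phi> N (state b \<sigma> \<xi> x us) us)"
    using assms(33) cost sys.total_cost_measurable[of us] usD(1)
    by (intro integrable_of_ext_expectation) (auto simp: optimal_control_def)
  have pq: "p n \<in> borel_measurable (F n)" "almost_Lp M 2 (p n)" "q n \<in> borel_measurable (F n)" "almost_Lp M 2 (q n)"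
    if "n < N" for n
  proof -
    have Lp: "in_Lp_process M F 2 0 N p" "in_Lp_process M F 2 0 N q"
      using assms(41) by (auto simp: bsde_solution_def)
    note p = in_Lp_process_nth[OF Lp(1) _ less_imp_le[OF that] F_sub]
      and q = in_Lp_process_nth[OF Lp(2) _ less_imp_le[OF that] F_sub]
    show "p n \<in> borel_measurable (F n)" "q n \<in> borel_measurable (F n)" using p(1) q(1) by auto
    then show "almost_Lp M 2 (p n)" "almost_Lp M 2 (q n)"
      using p(2) q(2) by (auto intro!: Lp_almost_Lp adapted_measurable)
  qed
  have derivatives: "bx = sys.bx" "sx = sys.sx" "lx = sys.lx" "bu = sys.bu" "su = sys.su" "lu = sys.lu"
    by (simp_all add: fun_eq_iff assms(34-40) sys.bx_def sys.sx_def sys.lx_def sys.bu_def sys.su_def sys.lu_def)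
  have adj: "AE \<omega> in M. p n \<omega> + q n \<omega> * \<eta> n \<omega> = sys.adjoint_source p q (Suc n) \<omega>" if "n < N" for n
  proof -
    have eq: "AE \<omega> in M. p n \<omega> + q n \<omega> * \<eta> n \<omega> =
          p (n+1) \<omega> + bx (n+1) \<omega> * p (n+1) \<omega> + \<beta> (n+1) (n+1) * sx (n+1) \<omega> * q (n+1) \<omega>
          + lx (n+1) \<omega> + sx (n+1) \<omega> * p (n+1) \<omega> * \<xi> (n+1) \<omega>"
      and terminal: "AE \<omega> in M. p N \<omega> = deriv \<Phi> (Xs N \<omega>)"
      using assms(41) that by (auto simp: bsde_solution_def)
    show ?thesis
    proof (cases "Suc n = N")
      case False
      then show ?thesis using eq unfolding sys.adjoint_source_def derivatives by simp
    next
      case True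
      have "b N \<omega> = (\<lambda>y v. 0)" "\<sigma> N \<omega> = (\<lambda>y v. 0)" "l N = (\<lambda>y v. 0)" for \<omega>
        using assms(32) by (auto simp: fun_eq_iff)
      then have "bx N \<omega> = 0" "sx N \<omega> = 0" "lx N \<omega> = 0" for \<omega>
        unfolding assms(35-37) by (simp_all add: partial_x_def)
      then have "AE \<omega> in M. p n \<omega> + q n \<omega> * \<eta> n \<omega> = p N \<omega>" using eq by (simp add: True)
      with terminal show ?thesis
        unfolding sys.adjoint_source_def True assms(34) by eventually_elim simp
    qed
  qed
  have opt: "expectation (total_cost l \<Phi> N sys.X us) \<le> expectation (sys.perturbed_cost h t)"
    if h_adapted: "\<And>k. k < N \<Longrightarrow> h k \<in> borel_measurable (F k)"
      and h: "\<And>k \<omega>. k < N \<Longrightarrow> \<omega> \<in> space M \<Longrightarrow> \<bar>h k \<omega>\<bar> \<le> K" and "0 \<le> t"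
      and feasible: "\<And>k \<omega>. k < N \<Longrightarrow> \<omega> \<in> space M \<Longrightarrow> us k \<omega> + t * h k \<omega> \<in> U"
      and int': "integrable M (sys.perturbed_cost h t)" for h K t
  proof -
    let ?u = "\<lambda>k \<omega>. us k \<omega> + t * h k \<omega>"
    have "?u \<in> admissible M F a N U"
    proof (rule admissibleI)
      fix k assume k: "k < N"
      note [measurable] = usD(1)[OF k] h_adapted[OF k] 
      show m: "?u k \<in> borel_measurable (F k)" by measurable
      show "integrable M (\<lambda>\<omega>. \<bar>?u k \<omega>\<bar> powr (2 * a))"
      proof (rule bounded_shift_integrable_powr[OF usD(2)[OF k]])
        show "us k \<in> borel_measurable M" by (rule adapted_measurable[OF usD(1)[OF k]])
        show "(\<lambda>\<omega>. t * h k \<omega>) \<in> borel_measurable M" using adapted_measurable[OF h_adapted[OF k]] by measurable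
        show "\<bar>t * h k \<omega>\<bar> \<le> t * K" if "\<omega> \<in> space M" for \<omega>
          using h[OF k that] \<open>0 \<le> t\<close> by (simp add: abs_mult mult_left_mono)
        show "0 < 2 * a" using assms(4) by simp
      qed
    qed (rule feasible)
    then have "J us \<le> J ?u" using assms(33) by (auto simp: optimal_control_def intro: INF_lower)
    then show ?thesis using int int' by (simp add: cost ext_expectation_integrable)
  qed
  show ?thesis
  proof (intro allI impI ballI)
    fix n u assume n: "n < N" and u: "u \<in> admissible M F a N U"
    have "AE \<omega> in M. sys.hamiltonian_u p q n \<omega> * (u n \<omega> - us n \<omega>) \<ge> 0"
      by (rule sys.maximum_principle[OF assms(19) usD(3) int opt pq adj n admissibleD(1,3)[OF u n F_sub]])
    then show "AE \<omega> in M. (bu n \<omega> * p n \<omega> + su n \<omega> * p n \<omega> * (\<Sum>k<n. c n k * \<xi> k \<omega>)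
             + \<beta> n n * su n \<omega> * q n \<omega> + lu n \<omega>) * (u n \<omega> - us n \<omega>) \<ge> 0"
      unfolding sys.hamiltonian_u_def derivatives \<kappa>_def .
  qed
qed

end
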